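(* There exists a critical value $m_0^c>0$ such that for every $m_0\in(0,m_0^c]$ and every $L\in\mathbb R$ there exists a continuous function $\overline F:\mathbb R\to\mathbb R$ with the following property. Let $u_0:\mathbb R\to\mathbb R$ be Lipschitz continuous with $0<1/K_0\le (u_0)_x\le K_0$ on $\mathbb R$ for some $K_0>0$. For $\varepsilon>0$ let $U=U^\varepsilon=(U_i)_{i\in\mathbb Z}$ be the solution of $$m_0\frac{d^2U_i}{d\tau^2}+\frac{dU_i}{d\tau}=U_{i+1}-2U_i+U_{i-1}+\sin(2\pi U_i)+L,\qquad \tau>0,\ i\in\mathbb Z,$$ with initial data $U_i(0)=\varepsilon^{-1}u_0(i\varepsilon)$ and $\frac{dU_i}{d\tau}(0)=0$ for all $i\in\mathbb Z$, and set $$\overline u^\varepsilon(t,x)=\varepsilon\,U_{\lfloor \varepsilon^{-1}x\rfloor}(\varepsilon^{-1}t).$$ Then, as $\varepsilon\to0$, $\overline u^\varepsilon$ converges locally uniformly on $(0,+\infty)\times\mathbb R$ to the unique viscosity solution $u^0$ of $$u^0_t=\overline F(u^0_x)\ \text{ for }(t,x)\in(0,+\infty)\times\mathbb R,\qquad u^0(0,x)=u_0(x)\ \text{ for }x\in\mathbb R.$$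
   Context: $\lfloor\cdot\rfloor$ denotes the integer part (floor). The bounds on the derivative $(u_0)_x$ of the Lipschitz function $u_0$ hold almost everywhere. The function $\overline F$ may depend on $m_0$ and $L$. "The solution" of the infinite system of ODEs is the one staying at bounded distance from its initial data on bounded time intervals: for every $T>0$, $\sup_{i\in\mathbb Z,\,\tau\in[0,T]}|U_i(\tau)-U_i(0)|<\infty$. *)

theory Defs
  imports "HOL-Analysis.Analysis"
begin

text \<open>
  Solutions of the accelerated Frenkel--Kontorova system
  with initial positions \<open>a\<close> and zero initial velocities, in the class of functions staying at
  bounded distance from their initial data on bounded time intervals. The functions \<open>V i\<close> and
  \<open>A i\<close> are the velocity and the acceleration of particle \<open>i\<close>; only the values at times
  \<open>\<tau> \<ge> 0\<close> are constrained, and the time derivative at \<open>\<tau> = 0\<close> is one-sided.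
\<close>

definition FK_solution ::
  "real \<Rightarrow> real \<Rightarrow> (int \<Rightarrow> real) \<Rightarrow> (int \<Rightarrow> real \<Rightarrow> real) \<Rightarrow> bool" where
  "FK_solution m\<^sub>0 L a U \<longleftrightarrow>
     (\<exists>V A. \<forall>i.
        (\<forall>\<tau>\<ge>0. (U i has_real_derivative V i \<tau>) (at \<tau> within {0..})) \<and>
        continuous_on {0..} (V i) \<and>
        (\<forall>\<tau>>0. (V i has_real_derivative A i \<tau>) (at \<tau>)) \<and>
        (\<forall>\<tau>>0. m\<^sub>0 * A i \<tau> + V i \<tau> =
            U (i + 1) \<tau> - 2 * U i \<tau> + U (i - 1) \<tau> + sin (2 * pi * U i \<tau>) + L) \<and>
        U i 0 = a i \<and> V i 0 = 0) \<and>
     (\<forall>T>0. \<exists>C. \<forall>i. \<forall>\<tau>\<in>{0..T}. \<bar>U i \<tau> - U i 0\<bar> \<le> C)"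

definition rescaled :: "real \<Rightarrow> (int \<Rightarrow> real \<Rightarrow> real) \<Rightarrow> real \<times> real \<Rightarrow> real" where
  "rescaled \<epsilon> U = (\<lambda>(t, x). \<epsilon> * U \<lfloor>x / \<epsilon>\<rfloor> (t / \<epsilon>))"

text \<open>
  \<open>C1_test \<phi> \<phi>t \<phi>x\<close>: the function \<open>\<phi>\<close> is continuously differentiable on
  \<open>(0,\<infinity>) \<times> \<real>\<close> with partial derivatives \<open>\<phi>t\<close> and \<open>\<phi>x\<close>.
\<close>

definition C1_test ::
  "(real \<times> real \<Rightarrow> real) \<Rightarrow> (real \<times> real \<Rightarrow> real) \<Rightarrow> (real \<times> real \<Rightarrow> real) \<Rightarrow> bool" where
  "C1_test \<phi> \<phi>t \<phi>x \<longleftrightarrow>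
     (\<forall>z\<in>{0<..} \<times> UNIV. (\<phi> has_derivative (\<lambda>h. \<phi>t z * fst h + \<phi>x z * snd h)) (at z)) \<and>
     continuous_on ({0<..} \<times> UNIV) \<phi>t \<and> continuous_on ({0<..} \<times> UNIV) \<phi>x"

definition visc_subsolution :: "(real \<Rightarrow> real) \<Rightarrow> (real \<times> real \<Rightarrow> real) \<Rightarrow> bool" where
  "visc_subsolution F u \<longleftrightarrow>
     (\<forall>\<phi> \<phi>t \<phi>x. C1_test \<phi> \<phi>t \<phi>x \<longrightarrow>
        (\<forall>z\<in>{0<..} \<times> UNIV. (\<forall>\<^sub>F w in nhds z. u w - \<phi> w \<le> u z - \<phi> z) \<longrightarrow> \<phi>t z \<le> F (\<phi>x z)))"

definition visc_supersolution :: "(real \<Rightarrow> real) \<Rightarrow> (real \<times> real \<Rightarrow> real) \<Rightarrow> bool" where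
  "visc_supersolution F u \<longleftrightarrow>
     (\<forall>\<phi> \<phi>t \<phi>x. C1_test \<phi> \<phi>t \<phi>x \<longrightarrow>
        (\<forall>z\<in>{0<..} \<times> UNIV. (\<forall>\<^sub>F w in nhds z. u w - \<phi> w \<ge> u z - \<phi> z) \<longrightarrow> \<phi>t z \<ge> F (\<phi>x z)))"

text \<open>
  Continuous (Crandall--Lions) viscosity solutions of \<open>u\<^sub>t = F(u\<^sub>x)\<close> on
  \<open>(0,\<infinity>) \<times> \<real>\<close> attaining the initial datum \<open>u\<^sub>0\<close>. No growth condition at infinity is imposed,
  and the values of \<open>u\<close> at negative times are irrelevant.
\<close>

definition visc_solution ::
  "(real \<Rightarrow> real) \<Rightarrow> (real \<Rightarrow> real) \<Rightarrow> (real \<times> real \<Rightarrow> real) \<Rightarrow> bool" where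
  "visc_solution F u\<^sub>0 u \<longleftrightarrow>
     continuous_on ({0..} \<times> UNIV) u \<and>
     visc_subsolution F u \<and> visc_supersolution F u \<and> (\<forall>x. u (0, x) = u\<^sub>0 x)"

end

theory Submission
  imports Defs
begin

text \<open>
  With \<open>\<alpha> = 1 / (2 m\<^sub>0)\<close> and \<open>X = U + U' / \<alpha>\<close> the system becomes first order, and it is cooperative
  when \<open>m\<^sub>0\<close> is small. It therefore has a comparison principle, even with the barrier
  \<open>exp (40 \<tau> + \<bar>i - k\<bar>)\<close>, which expresses that remote particles have a negligible influence. As the
  flow commutes with shifts of the index and with integer translations of the particles, the solution
  with initial data \<open>p i\<close> stays within distance 1 of a plane of slope \<open>p\<close>, hence moves additively in time
  up to a bounded error, and \<open>F p\<close> is its mean velocity. The error is uniform in \<open>p\<close>, so \<open>F\<close> is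
  continuous; it is also bounded. The rescaled solutions are uniformly Lipschitz up to \<open>O(\<epsilon>)\<close>. Where
  a test function touches their pointwise upper limit from above, it is nearly a plane a short time
  earlier, and comparison with the planar solution gives the subsolution property; the symmetry
  \<open>U \<mapsto> - U\<close>, \<open>L \<mapsto> - L\<close> gives the supersolution property of the lower limit. The comparison principle
  for \<open>u\<^sub>t = F(u\<^sub>x)\<close>, where one of the two functions is Lipschitz, identifies both limits. An arbitrary
  viscosity solution stays within \<open>O(t)\<close> of the initial datum because \<open>F\<close> is bounded, so the same
  comparison gives uniqueness without growth conditions.
\<close>

section \<open>Ordinary differential equations in Banach spaces\<close>

text \<open>The second-order flow does not preserve the order of positions alone; what is preserved
  is the order of the pairs \<open>(U, X)\<close>. The price is that every restart at a later time
  needs control of \<open>X - U\<close>, that is, a velocity bound. The \<open>U\<close>-equation is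
  cooperative for every \<alpha> > 0; only the \<open>X\<close>-equation restricts the mass, and 20
  is a round number above 4 + 4\<pi> < 16.6, so that \<alpha> \<ge> 20 becomes
  \<open>m \<le> 1 / 40\<close>.

  With infinitely many particles a supremum of differences need not be attained. Solutions are
  therefore kept in a class of linear growth, which any multiple of the exponential barrier
  eventually dominates; a first contact then concerns finitely many indices.

  All particle-scale errors (rounding to integers, velocities, the barrier at the final time) are
  bounded independently of time and become O(\<epsilon>) after rescaling. This replaces the usual
  corrector: \<epsilon> tends to 0 for a fixed macroscopic time step \<open>h\<close>, and only
  errors of order o(h) have to be followed.\<close>

lemma integral_has_vector_derivative_atLeast:
  fixes g :: "real \<Rightarrow> 'a::banach"
  assumes "continuous_on {a..} g" "a \<le> t"
  shows "((\<lambda>u. integral {a..u} g) has_vector_derivative g t) (at t within {a..})"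
proof -
  have "((\<lambda>u. integral {a..u} g) has_vector_derivative g t) (at t within {a..t+1})"
    using assms by (intro integral_has_vector_derivative) (auto intro: continuous_on_subset)
  moreover have "at t within {a..t+1} = at t within {a..}"
    using assms by (intro at_within_nhd[of t "{..<t+1}"]) auto
  ultimately show ?thesis by simp
qed

text \<open>Bielecki's weighted norm: for the unknown \<open>exp (- l * t)\<close> times
  \<open>x t\<close> the integral operator has Lipschitz constant \<open>K / l < 1\<close>, so a
  single application of the fixed point theorem covers all times.\<close>

lemma lipschitz_ode_global_solution:
  fixes f :: "'a::banach \<Rightarrow> 'a"
  assumes lip: "K-lipschitz_on UNIV f"
  obtains x where "x 0 = x0" "\<And>t. 0 \<le> t \<Longrightarrow> (x has_vector_derivative f (x t)) (at t within {0..})"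
proof -
  define l where "l = K + 1"
  have K: "0 \<le> K" and l: "0 < l" "K / l < 1" "1 \<le> l"
    using lipschitz_on_nonneg[OF lip] by (auto simp: l_def)
  have lipD: "norm (f a - f b) \<le> K * norm (a - b)" for a b
    using lipschitz_onD[OF lip, of a b] by (simp add: dist_norm)
  have fcont: "continuous_on UNIV f" by (rule lipschitz_on_continuous_on[OF lip])
  define g where "g y s = f (exp (l * s) *\<^sub>R y s)" for y :: "real \<Rightarrow> 'a" and s
  define J where "J y t = x0 + integral {0..t} (g y)" for y t
  \<comment> \<open>Negative times are frozen at 0, because the space of bounded continuous
    functions lives on the whole line.\<close>
  define T where "T y t = exp (- l * max 0 t) *\<^sub>R J y (max 0 t)" for y t
  have gcont: "continuous_on A (g y)" if "continuous_on UNIV y" for A y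
    unfolding g_def
    by (intro continuous_on_compose2[OF fcont] continuous_intros)
      (auto intro: continuous_on_subset[OF that])
  have Jder: "(J y has_vector_derivative g y t) (at t within {0..})"
    if "continuous_on UNIV y" "0 \<le> t" for y t
    unfolding J_def
    using integral_has_vector_derivative_atLeast[OF gcont[OF that(1)] that(2)]
    by (auto intro!: derivative_eq_intros)
  have Jcont: "continuous_on {0..} (J y)" if "continuous_on UNIV y" for y
    using Jder[OF that] by (auto simp: continuous_on_eq_continuous_within
      intro: has_vector_derivative_continuous)
  have Tcont: "continuous_on UNIV (T y)" if "continuous_on UNIV y" for y
    unfolding T_def
    by (intro continuous_intros continuous_on_compose2[OF Jcont[OF that]]) auto
  have Tdist: "norm (T y t - T w t) \<le> K / l * d"
    if y: "continuous_on UNIV y" and w: "continuous_on UNIV w" and d: "\<And>s. norm (y s - w s) \<le> d"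
    for y w d t
  proof -
    define r where "r = max 0 t"
    have r: "0 \<le> r" by (simp add: r_def)
    have d0: "0 \<le> d" using d[of 0] norm_ge_zero order_trans by blast
    have I: "((\<lambda>s. K * d * exp (l * s)) has_integral (K * d * exp (l * r) / l - K * d * exp (l * 0) / l)) {0..r}"
      using l r by (intro fundamental_theorem_of_calculus)
        (auto intro!: derivative_eq_intros simp: has_real_derivative_iff_has_vector_derivative[symmetric])
    have "norm (integral {0..r} (g y) - integral {0..r} (g w)) = norm (integral {0..r} (\<lambda>s. g y s - g w s))"
      by (subst integral_diff) (auto intro!: integrable_continuous_real gcont y w)
    also have "\<dots> \<le> integral {0..r} (\<lambda>s. K * d * exp (l * s))"
    proof (rule integral_norm_bound_integral)
      show "(\<lambda>s. g y s - g w s) integrable_on {0..r}"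
        by (intro integrable_continuous_real continuous_intros gcont y w)
      show "(\<lambda>s. K * d * exp (l * s)) integrable_on {0..r}" using I by blast
      fix s
      have "norm (g y s - g w s) \<le> K * norm (exp (l * s) *\<^sub>R (y s - w s))"
        using lipD unfolding g_def scaleR_diff_right .
      also have "\<dots> \<le> K * (exp (l * s) * d)"
        using K d by (intro mult_left_mono) auto
      finally show "norm (g y s - g w s) \<le> K * d * exp (l * s)" by (simp add: mult_ac)
    qed
    also have "\<dots> \<le> K * d * exp (l * r) / l"
      unfolding integral_unique[OF I] using l K d0 by simp
    finally have *: "norm (integral {0..r} (g y) - integral {0..r} (g w)) \<le> K * d * exp (l * r) / l" .
    have "norm (T y t - T w t) = exp (- l * r) * norm (integral {0..r} (g y) - integral {0..r} (g w))"
      by (simp add: T_def J_def r_def scaleR_diff_right[symmetric])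
    also have "\<dots> \<le> exp (- l * r) * (K * d * exp (l * r) / l)"
      using * by (intro mult_left_mono) auto
    also have "\<dots> = K / l * d" by (simp add: exp_minus)
    finally show ?thesis .
  qed
  have T0: "norm (T (\<lambda>_. 0) t) \<le> norm x0 + norm (f 0)" for t
  proof -
    define r where "r = max 0 t"
    have r: "0 \<le> r" by (simp add: r_def)
    have "r \<le> exp r" using exp_ge_add_one_self[of r] by linarith
    also have "\<dots> \<le> exp (l * r)" using l r by (simp add: mult_le_cancel_right1)
    finally have e: "exp (- l * r) * r \<le> 1" by (simp add: exp_minus field_simps)
    have "norm (T (\<lambda>_. 0) t) \<le> exp (- l * r) * (norm x0 + r * norm (f 0))"
      using r unfolding T_def J_def g_def r_def[symmetric]
      by (auto intro!: norm_triangle_le)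
    also have "\<dots> \<le> norm x0 + norm (f 0)"
      using e l r mult_right_mono[OF e, of "norm (f 0)"]
        mult_right_mono[of "exp (- l * r)" 1 "norm x0"] by (auto simp: algebra_simps)
    finally show ?thesis .
  qed
  define B where "B y = Bcontfun (T (apply_bcontfun y))" for y :: "real \<Rightarrow>\<^sub>C 'a"
  have Tb: "T (apply_bcontfun y) \<in> bcontfun" for y
  proof (rule bcontfun_normI)
    show "continuous_on UNIV (T (apply_bcontfun y))" by (intro Tcont continuous_on_apply_bcontfun)
    fix t
    have "norm (T y t - T (\<lambda>_. 0) t) \<le> K / l * norm y"
      by (intro Tdist) (auto simp: norm_bounded)
    then show "norm (T y t) \<le> norm x0 + norm (f 0) + K / l * norm y"
      using T0[of t] norm_triangle_sub[of "T y t" "T (\<lambda>_. 0) t"] by linarith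
  qed
  have "dist (B y) (B w) \<le> K / l * dist y w" for y w
  proof (rule dist_bound)
    fix t
    show "dist (B y t) (B w t) \<le> K / l * dist y w"
      unfolding B_def Bcontfun_inverse[OF Tb] dist_norm
      by (intro Tdist continuous_on_apply_bcontfun)
       (metis dist_norm norm_bounded minus_bcontfun.rep_eq)
  qed
  then obtain y where y: "B y = y"
    using banach_fix_type[of "K / l" B] K l by auto
  define x where "x t = exp (l * t) *\<^sub>R y t" for t
  have xJ: "x t = J y t" if "0 \<le> t" for t
  proof -
    have "y t = T y t" using y Bcontfun_inverse[OF Tb] B_def by metis
    with that show ?thesis by (simp add: x_def T_def exp_minus)
  qed
  show thesis
  proof
    show "x 0 = x0" by (simp add: xJ J_def)
    fix t :: real assume t: "0 \<le> t"
    have "(J y has_vector_derivative f (x t)) (at t within {0..})"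
      using Jder[OF continuous_on_apply_bcontfun t, of y] by (simp add: g_def x_def)
    then show "(x has_vector_derivative f (x t)) (at t within {0..})"
      using t by (rule_tac has_vector_derivative_transform[rotated 2]) (auto simp: xJ)
  qed
qed

section \<open>The cooperative first-order system\<close>

text \<open>Finiteness of \<open>J\<close> makes the set of contact times closed, so there is a
  first one. All \<open>E k\<close> are nonpositive then, and the negative derivative forces
  \<open>E j\<close> to have been positive just before.\<close>

lemma finite_first_touch:
  fixes E :: "'j \<Rightarrow> real \<Rightarrow> real"
  assumes J: "finite J"
    and cont: "\<And>j. j \<in> J \<Longrightarrow> continuous_on {0..T} (E j)"
    and init: "\<And>j. j \<in> J \<Longrightarrow> E j 0 < 0"
    and touch: "\<And>j \<tau>. j \<in> J \<Longrightarrow> 0 < \<tau> \<Longrightarrow> \<tau> \<le> T \<Longrightarrow> E j \<tau> = 0 \<Longrightarrow> (\<And>k. k \<in> J \<Longrightarrow> E k \<tau> \<le> 0) \<Longrightarrow>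
        \<exists>d<0. (E j has_real_derivative d) (at \<tau>)"
    and j: "j \<in> J" and t: "0 \<le> t" "t \<le> T"
  shows "E j t < 0"
proof (rule ccontr)
  assume neg: "\<not> E j t < 0"
  define S where "S = (\<Union>k\<in>J. {s \<in> {0..T}. 0 \<le> E k s})"
  have cl: "closed S"
    unfolding S_def using J cont
    by (intro closed_UN ballI continuous_on_closed_Collect_le continuous_on_const) auto
  have ne: "S \<noteq> {}" using neg j t by (auto simp: S_def not_less)
  have bd: "bdd_below S" by (rule bdd_belowI[of _ 0]) (auto simp: S_def)
  define s where "s = Inf S"
  have sS: "s \<in> S" unfolding s_def by (rule closed_contains_Inf[OF ne bd cl])
  then obtain k where k: "k \<in> J" "0 \<le> E k s" "0 \<le> s" "s \<le> T" by (auto simp: S_def)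
  have s0: "0 < s" using k init[of k] by (cases "s = 0") auto
  have before: "E i r < 0" if "i \<in> J" "0 \<le> r" "r < s" for i r
  proof (rule ccontr)
    assume "\<not> E i r < 0"
    then have "r \<in> S" using that k by (auto simp: S_def not_less)
    then show False using cInf_lower[OF _ bd, of r] that by (auto simp: s_def)
  qed
  have le: "E i s \<le> 0" if i: "i \<in> J" for i
  proof (rule ccontr)
    assume "\<not> E i s \<le> 0"
    moreover have "continuous_on {0..s} (E i)"
      using cont[OF i] k by (auto intro: continuous_on_subset)
    ultimately obtain r where r: "0 \<le> r" "r \<le> s" "E i r = 0"
      using IVT'[of "E i" 0 0 s] init[OF i] s0 by auto
    then show False using before[OF i, of r] \<open>\<not> E i s \<le> 0\<close> by (cases "r = s") auto
  qed
  have "E k s = 0" using le[OF k(1)] k by simp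
  then obtain d where "d < 0" "(E k has_real_derivative d) (at s)"
    using touch[OF k(1) s0 k(4)] le by blast
  then obtain e where e: "0 < e" "\<And>h. 0 < h \<Longrightarrow> h < e \<Longrightarrow> E k s < E k (s - h)"
    using DERIV_neg_dec_left by blast
  have "E k s < E k (s - min (e/2) s)" using e s0 by (intro e(2)) auto
  moreover have "E k (s - min (e/2) s) < 0" using e s0 by (intro before[OF k(1)]) auto
  ultimately show False using \<open>E k s = 0\<close> by simp
qed

definition FK_force :: "real \<Rightarrow> (int \<Rightarrow> real \<Rightarrow> real) \<Rightarrow> int \<Rightarrow> real \<Rightarrow> real" where
  "FK_force L U i \<tau> = U (i + 1) \<tau> - 2 * U i \<tau> + U (i - 1) \<tau> + sin (2 * pi * U i \<tau>) + L"

text \<open>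
  With \<open>\<alpha> = 1 / (2 m\<^sub>0)\<close> and \<open>X i = U i + U i' / \<alpha>\<close> the second-order equation becomes this
  first-order system, which is cooperative as soon as \<open>\<alpha> \<ge> 4 + 4\<pi>\<close>.
\<close>
definition FK_system :: "real \<Rightarrow> real \<Rightarrow> (int \<Rightarrow> real \<Rightarrow> real) \<Rightarrow> (int \<Rightarrow> real \<Rightarrow> real) \<Rightarrow> bool" where
  "FK_system \<alpha> L U X \<longleftrightarrow>
     (\<forall>i. continuous_on {0..} (U i) \<and> continuous_on {0..} (X i) \<and>
        (\<forall>\<tau>>0. (U i has_real_derivative \<alpha> * (X i \<tau> - U i \<tau>)) (at \<tau>) \<and>
               (X i has_real_derivative 2 * FK_force L U i \<tau> + \<alpha> * (U i \<tau> - X i \<tau>)) (at \<tau>))) \<and>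
     (\<forall>T. \<exists>C. \<forall>i. \<forall>\<tau>\<in>{0..T}. \<bar>U i \<tau>\<bar> \<le> C * (1 + \<bar>of_int i\<bar>) \<and> \<bar>X i \<tau>\<bar> \<le> C * (1 + \<bar>of_int i\<bar>))"

lemma FK_systemD:
  assumes "FK_system \<alpha> L U X"
  shows "continuous_on {0..} (U i)" "continuous_on {0..} (X i)"
    "0 < \<tau> \<Longrightarrow> (U i has_real_derivative \<alpha> * (X i \<tau> - U i \<tau>)) (at \<tau>)"
    "0 < \<tau> \<Longrightarrow> (X i has_real_derivative 2 * FK_force L U i \<tau> + \<alpha> * (U i \<tau> - X i \<tau>)) (at \<tau>)"
  using assms unfolding FK_system_def by auto

lemma sin_diff_le: "sin x - sin y \<le> \<bar>x - y\<bar>" for x y :: real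
proof -
  have "\<bar>sin x - sin y\<bar> \<le> 1 * \<bar>x - y\<bar>"
    using field_differentiable_bound[of UNIV sin cos 1 x y]
    by (simp add: has_field_derivative_at_within)
  then show ?thesis by simp
qed

text \<open>The function \<open>2 * (sin (2 * pi * u) - 2 * u) + \<alpha> * u\<close> is
  nondecreasing, and its slope stays below \<alpha> + 10. With 2\<pi> < 6.3 the two cases reduce to
  \<alpha> + 8.6 \<le> \<alpha> + 10 and to 16.6 - \<alpha> \<le> 0.\<close>

lemma cooperative_bound:
  fixes u w b \<alpha> :: real
  assumes "u \<le> w + b" "0 \<le> b" "20 \<le> \<alpha>"
  shows "2 * (sin (2 * pi * u) - 2 * u) + \<alpha> * u \<le> 2 * (sin (2 * pi * w) - 2 * w) + \<alpha> * w + (\<alpha> + 10) * b"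
proof -
  have pi: "pi < 3.15" using pi_approx by simp
  show ?thesis
  proof (cases "w \<le> u")
    case True
    have "sin (2 * pi * u) - sin (2 * pi * w) \<le> 2 * pi * (u - w)"
      using sin_diff_le[of "2 * pi * u" "2 * pi * w"] True
      by (simp add: abs_mult flip: right_diff_distrib)
    also have "\<dots> \<le> 6.3 * (u - w)" using pi True by (intro mult_right_mono) auto
    finally have "2 * (sin (2 * pi * u) - 2 * u) + \<alpha> * u - (2 * (sin (2 * pi * w) - 2 * w) + \<alpha> * w) \<le> (\<alpha> + 10) * (u - w)"
      using True by (simp add: algebra_simps)
    also have "\<dots> \<le> (\<alpha> + 10) * b" using assms by (intro mult_left_mono) auto
    finally show ?thesis by simp
  next
    case False
    have "sin (2 * pi * u) - sin (2 * pi * w) \<le> 2 * pi * (w - u)"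
      using sin_diff_le[of "2 * pi * u" "2 * pi * w"] False
      by (simp add: abs_mult flip: right_diff_distrib)
    also have "\<dots> \<le> 6.3 * (w - u)" using pi False by (intro mult_right_mono) auto
    finally have *: "sin (2 * pi * u) - sin (2 * pi * w) \<le> 6.3 * (w - u)" .
    have "2 * (sin (2 * pi * u) - 2 * u) + \<alpha> * u - (2 * (sin (2 * pi * w) - 2 * w) + \<alpha> * w)
        = 2 * (sin (2 * pi * u) - sin (2 * pi * w)) + (4 - \<alpha>) * (w - u)"
      by (simp add: algebra_simps)
    also have "\<dots> \<le> 2 * (6.3 * (w - u)) + (4 - \<alpha>) * (w - u)" using * by simp
    also have "\<dots> = (16.6 - \<alpha>) * (w - u)" by (simp add: field_simps)
    also have "\<dots> \<le> 0" using assms False by (intro mult_nonpos_nonneg) auto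
    also have "\<dots> \<le> (\<alpha> + 10) * b" using assms by auto
    finally show ?thesis by simp
  qed
qed

lemma linear_le_exp_eventually:
  fixes C D \<delta> :: real
  assumes "0 < \<delta>"
  shows "\<exists>N::real. \<forall>x>N. C * (D + x) < \<delta> * exp x"
proof -
  have "((\<lambda>x. C * (D + x) / exp x) \<longlongrightarrow> 0) at_top"
  proof -
    have "((\<lambda>x::real. C * D * (x ^ 0 / exp x) + C * (x ^ 1 / exp x)) \<longlongrightarrow> C * D * 0 + C * 0) at_top"
      by (intro tendsto_intros tendsto_power_div_exp_0)
    then show ?thesis by (simp add: field_simps)
  qed
  then have "\<forall>\<^sub>F x in at_top. C * (D + x) / exp x < \<delta>"
    by (rule order_tendstoD) (use assms in auto)
  then show ?thesis
    by (auto simp: eventually_at_top_dense field_simps)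
qed

lemma exp_neighbour_le: "exp (c + \<bar>of_int (i + j) - of_int k\<bar>) \<le> 3 * exp (c + \<bar>of_int i - of_int k\<bar> :: real)"
  if "\<bar>j\<bar> \<le> 1" for i j k :: int
proof -
  have "\<bar>of_int (i + j) - of_int k\<bar> \<le> 1 + \<bar>of_int i - of_int k :: real\<bar>"
    using that by linarith
  then have "exp (c + \<bar>of_int (i + j) - of_int k\<bar>) \<le> exp (1 + (c + \<bar>of_int i - of_int k\<bar> :: real))" by simp
  also have "\<dots> \<le> 3 * exp (c + \<bar>of_int i - of_int k\<bar>)" using exp_le by (simp add: exp_add)
  finally show ?thesis .
qed

text \<open>The rate 40 has to beat what the barrier feeds into the \<open>X\<close>-equation at a
  contact: 2 * (3 + 3) from the two neighbours, since \<open>exp 1 \<le> 3\<close>, and \<alpha> +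
  10 from the particle itself, minus \<alpha> from \<open>X\<close>. That is 22 times the barrier.
  At a contact in \<open>U\<close> the reaction term is nonpositive. The index \<open>k\<close> is
  the particle under observation, where the barrier is smallest.\<close>

lemma FK_comparison:
  fixes B :: real and k :: int
  assumes \<alpha>: "20 \<le> \<alpha>"
    and sub: "FK_system \<alpha> L U X" and super: "FK_system \<alpha> L W Y" and B: "0 \<le> B"
    and initU: "\<And>i. U i 0 \<le> W i 0 + B * exp \<bar>of_int i - of_int k\<bar>"
    and initX: "\<And>i. X i 0 \<le> Y i 0 + B * exp \<bar>of_int i - of_int k\<bar>"
    and t: "0 \<le> t"
  shows "U i t \<le> W i t + B * exp (40 * t + \<bar>of_int i - of_int k\<bar>) \<and>
         X i t \<le> Y i t + B * exp (40 * t + \<bar>of_int i - of_int k\<bar>)"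
proof -
  define e where "e \<tau> i = exp (40 * \<tau> + \<bar>of_int i - of_int k\<bar> :: real)" for \<tau> and i :: int
  have main: "U i t - W i t < (B + \<delta>) * e t i \<and> X i t - Y i t < (B + \<delta>) * e t i" if \<delta>: "0 < \<delta>" for \<delta> i
  proof -
    define b where "b = B + \<delta>"
    have b: "0 < b" "\<delta> \<le> b" using B \<delta> by (auto simp: b_def)
    \<comment> \<open>\<open>True\<close> marks the inequality for \<open>U\<close>,
      \<open>False\<close> the one for \<open>X\<close>. They are tracked together, since each
      equation is increasing in the other unknown.\<close>
    define E where "E j \<tau> = (case j of (i, True) \<Rightarrow> U i \<tau> - W i \<tau> - b * e \<tau> i | (i, False) \<Rightarrow> X i \<tau> - Y i \<tau> - b * e \<tau> i)"
      for j :: "int \<times> bool" and \<tau>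
    obtain C1 where C1: "\<And>i \<tau>. \<tau> \<in> {0..t} \<Longrightarrow> \<bar>U i \<tau>\<bar> \<le> C1 * (1 + \<bar>of_int i\<bar>) \<and> \<bar>X i \<tau>\<bar> \<le> C1 * (1 + \<bar>of_int i\<bar>)"
      using sub unfolding FK_system_def by blast
    obtain C2 where C2: "\<And>i \<tau>. \<tau> \<in> {0..t} \<Longrightarrow> \<bar>W i \<tau>\<bar> \<le> C2 * (1 + \<bar>of_int i\<bar>) \<and> \<bar>Y i \<tau>\<bar> \<le> C2 * (1 + \<bar>of_int i\<bar>)"
      using super unfolding FK_system_def by blast
    have C0: "0 \<le> C1" "0 \<le> C2" using C1[of 0 0] C2[of 0 0] t by auto
    obtain N where N: "\<And>x. N < x \<Longrightarrow> (C1 + C2) * ((1 + \<bar>of_int k\<bar>) + x) < \<delta> * exp x"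
      using linear_le_exp_eventually[OF \<delta>] by blast
    \<comment> \<open>The slack \<delta> alone already dominates the linear growth far from
      \<open>k\<close>, even when \<open>B = 0\<close>.\<close>
    have far: "E (i, c) \<tau> < 0" if "N < \<bar>of_int i - of_int k\<bar>" "0 \<le> \<tau>" "\<tau> \<le> t" for i c \<tau>
    proof -
      let ?x = "\<bar>of_int i - of_int k :: real\<bar>"
      have "(C1 + C2) * (1 + \<bar>of_int i\<bar>) \<le> (C1 + C2) * ((1 + \<bar>of_int k\<bar>) + ?x)"
        using C0 by (intro mult_left_mono) auto
      also have "\<dots> < \<delta> * exp ?x" using N that by blast
      also have "\<dots> \<le> b * e \<tau> i"
        unfolding e_def using b \<delta> that by (intro mult_mono) auto
      finally have "(C1 + C2) * (1 + \<bar>of_int i\<bar>) < b * e \<tau> i" .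
      moreover have "\<bar>U i \<tau>\<bar> + \<bar>W i \<tau>\<bar> \<le> (C1 + C2) * (1 + \<bar>of_int i\<bar>)"
        "\<bar>X i \<tau>\<bar> + \<bar>Y i \<tau>\<bar> \<le> (C1 + C2) * (1 + \<bar>of_int i\<bar>)"
        unfolding distrib_right[of C1] using C1[of \<tau> i] C2[of \<tau> i] that by (auto intro: add_mono)
      ultimately show ?thesis by (cases c) (auto simp: E_def)
    qed
    define J where "J = {i. \<bar>of_int i - of_int k :: real\<bar> \<le> N} \<times> (UNIV :: bool set)"
    have "{i. \<bar>of_int i - of_int k :: real\<bar> \<le> N} \<subseteq> {k - \<lceil>N\<rceil>..k + \<lceil>N\<rceil>}"
      by (auto simp: abs_le_iff; linarith)
    then have J: "finite J" unfolding J_def by (auto dest: finite_subset)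
    have econt: "continuous_on A (\<lambda>\<tau>. e \<tau> i)" for A i
      unfolding e_def by (intro continuous_intros)
    have UW: "continuous_on {0..t} (U i)" "continuous_on {0..t} (X i)"
      "continuous_on {0..t} (W i)" "continuous_on {0..t} (Y i)" for i
      by (rule continuous_on_subset[of "{0..}"], simp add: FK_systemD[OF sub] FK_systemD[OF super], simp)+
    have near: "E j \<tau> < 0" if j: "j \<in> J" and \<tau>: "0 \<le> \<tau>" "\<tau> \<le> t" for j \<tau>
    proof (rule finite_first_touch[OF J _ _ _ j \<tau>])
      fix j assume "j \<in> J"
      obtain i c where j: "j = (i, c)" by (cases j)
      show "continuous_on {0..t} (E j)"
        unfolding E_def j
        by (cases c) (simp_all, (intro continuous_on_diff continuous_on_mult continuous_on_const UW econt)+)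
      have "0 < \<delta> * exp \<bar>of_int i - of_int k\<bar>" using \<delta> by simp
      then show "E j 0 < 0"
        using initU[of i] initX[of i]
        unfolding E_def j e_def b_def by (cases c) (auto simp: algebra_simps)
    next
      fix j \<tau> assume jJ: "j \<in> J" and \<tau>: "0 < \<tau>" "\<tau> \<le> t" and E0: "E j \<tau> = 0"
        and le: "\<And>k. k \<in> J \<Longrightarrow> E k \<tau> \<le> 0"
      have all: "E l \<tau> \<le> 0" for l
      proof (cases "l \<in> J")
        case False
        then show ?thesis using far[of "fst l" \<tau> "snd l"] \<tau> by (cases l) (auto simp: J_def)
      qed (use le in auto)
      obtain i c where j: "j = (i, c)" by (cases j)
      have e0: "0 < e \<tau> i" by (simp add: e_def)
      have ed: "((\<lambda>\<tau>. e \<tau> i) has_real_derivative 40 * e \<tau> i) (at \<tau>)"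
        unfolding e_def by (auto intro!: derivative_eq_intros)
      have dU: "(U i has_real_derivative \<alpha> * (X i \<tau> - U i \<tau>)) (at \<tau>)"
        and dX: "(X i has_real_derivative 2 * FK_force L U i \<tau> + \<alpha> * (U i \<tau> - X i \<tau>)) (at \<tau>)"
        and dW: "(W i has_real_derivative \<alpha> * (Y i \<tau> - W i \<tau>)) (at \<tau>)"
        and dY: "(Y i has_real_derivative 2 * FK_force L W i \<tau> + \<alpha> * (W i \<tau> - Y i \<tau>)) (at \<tau>)"
        using FK_systemD[OF sub] FK_systemD[OF super] \<tau> by auto
      have Ule: "U i \<tau> \<le> W i \<tau> + b * e \<tau> i" for i using all[of "(i, True)"] by (simp add: E_def)
      have Xle: "X i \<tau> \<le> Y i \<tau> + b * e \<tau> i" for i using all[of "(i, False)"] by (simp add: E_def)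
      show "\<exists>d<0. (E j has_real_derivative d) (at \<tau>)"
      proof (cases c)
        case True
        let ?d = "\<alpha> * (X i \<tau> - U i \<tau>) - \<alpha> * (Y i \<tau> - W i \<tau>) - b * (40 * e \<tau> i)"
        have "(E j has_real_derivative ?d) (at \<tau>)"
        proof -
          have "E j = (\<lambda>\<tau>. U i \<tau> - W i \<tau> - b * e \<tau> i)" using True by (simp add: E_def j fun_eq_iff)
          then show ?thesis using DERIV_diff[OF DERIV_diff[OF dU dW] DERIV_cmult[OF ed]] by simp
        qed
        moreover have "U i \<tau> = W i \<tau> + b * e \<tau> i" using E0 j True by (simp add: E_def)
        then have "\<alpha> * (X i \<tau> - U i \<tau>) - \<alpha> * (Y i \<tau> - W i \<tau>) \<le> 0"
          using Xle[of i] \<alpha> by (auto simp flip: right_diff_distrib intro: mult_nonneg_nonpos)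
        then have "?d < 0" using b e0 mult_pos_pos[OF b(1) e0] by linarith
        ultimately show ?thesis by blast
      next
        case False
        let ?d = "(2 * FK_force L U i \<tau> + \<alpha> * (U i \<tau> - X i \<tau>)) - (2 * FK_force L W i \<tau> + \<alpha> * (W i \<tau> - Y i \<tau>)) - b * (40 * e \<tau> i)"
        have "(E j has_real_derivative ?d) (at \<tau>)"
        proof -
          have "E j = (\<lambda>\<tau>. X i \<tau> - Y i \<tau> - b * e \<tau> i)" using False by (simp add: E_def j fun_eq_iff)
          then show ?thesis using DERIV_diff[OF DERIV_diff[OF dX dY] DERIV_cmult[OF ed]] by simp
        qed
        moreover have X: "X i \<tau> = Y i \<tau> + b * e \<tau> i" using E0 j False by (simp add: E_def)
        have n: "U (i + j) \<tau> \<le> W (i + j) \<tau> + 3 * (b * e \<tau> i)" if "\<bar>j\<bar> \<le> 1" for j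
        proof -
          have "b * e \<tau> (i + j) \<le> b * (3 * e \<tau> i)"
            unfolding e_def using exp_neighbour_le[OF that] b by (intro mult_left_mono) auto
          then show ?thesis using Ule[of "i + j"] by linarith
        qed
        have "0 < b * e \<tau> i" using b e0 by simp
        then have "?d < 0"
          using n[of 1] n[of "-1"] cooperative_bound[OF Ule[of i] _ \<alpha>]
          unfolding FK_force_def X by (simp add: algebra_simps)
        ultimately show ?thesis by blast
      qed
    qed
    have neg: "E (i, c) t < 0" for i c
    proof (cases "(i, c) \<in> J")
      case True
      then show ?thesis using near t by auto
    next
      case False
      then show ?thesis using far[of i t c] t by (auto simp: J_def)
    qed
    show ?thesis using neg[of i True] neg[of i False] by (simp add: E_def b_def)
  qed
  have lim: "((\<lambda>\<delta>. (B + \<delta>) * e t i) \<longlongrightarrow> (B + 0) * e t i) (at_right 0)"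
    by (intro tendsto_intros)
  have "U i t - W i t \<le> (B + 0) * e t i"
    by (rule tendsto_lowerbound[OF lim])
      (auto simp: eventually_at_filter main less_imp_le)
  moreover have "X i t - Y i t \<le> (B + 0) * e t i"
    by (rule tendsto_lowerbound[OF lim])
      (auto simp: eventually_at_filter main less_imp_le)
  ultimately show ?thesis by (simp add: e_def)
qed

section \<open>Symmetries of the flow and a priori bounds\<close>

lemma FK_system_growth:
  assumes "FK_system \<alpha> L U X"
  obtains C where "0 \<le> C" "\<And>i \<tau>. 0 \<le> \<tau> \<Longrightarrow> \<tau> \<le> T \<Longrightarrow>
    \<bar>U i \<tau>\<bar> \<le> C * (1 + \<bar>of_int i\<bar>) \<and> \<bar>X i \<tau>\<bar> \<le> C * (1 + \<bar>of_int i\<bar>)"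
proof -
  obtain C where C: "\<And>i \<tau>. \<tau> \<in> {0..T} \<Longrightarrow>
    \<bar>U i \<tau>\<bar> \<le> C * (1 + \<bar>of_int i\<bar>) \<and> \<bar>X i \<tau>\<bar> \<le> C * (1 + \<bar>of_int i\<bar>)"
    using assms unfolding FK_system_def by blast
  show thesis
  proof (rule that[of "\<bar>C\<bar>"])
    fix i \<tau> assume "0 \<le> \<tau>" "\<tau> \<le> T"
    moreover have "C * (1 + \<bar>of_int i\<bar>) \<le> \<bar>C\<bar> * (1 + \<bar>of_int i\<bar>)" by (intro mult_right_mono) auto
    ultimately show "\<bar>U i \<tau>\<bar> \<le> \<bar>C\<bar> * (1 + \<bar>of_int i\<bar>) \<and> \<bar>X i \<tau>\<bar> \<le> \<bar>C\<bar> * (1 + \<bar>of_int i\<bar>)"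
      using C[of \<tau> i] by auto
  qed auto
qed

lemma sin_2pi_add_int: "sin (2 * pi * (u + of_int n)) = sin (2 * pi * u)"
  using sin_int_2pin[of n] cos_int_2pin[of n] by (simp add: distrib_left sin_add)

text \<open>Three symmetries at once: the index shift \<open>j\<close>, the restart at time
  \<open>s\<close>, and the integer translation \<open>n\<close>, which the periodic force does not
  see.\<close>

lemma FK_system_shift:
  assumes sys: "FK_system \<alpha> L U X" and s: "0 \<le> s"
  shows "FK_system \<alpha> L (\<lambda>i \<tau>. U (i + j) (\<tau> + s) + of_int n) (\<lambda>i \<tau>. X (i + j) (\<tau> + s) + of_int n)"
proof -
  have ind: "i + 1 + j = (i + j) + 1" "i - 1 + j = (i + j) - 1" for i by auto
  have force: "FK_force L (\<lambda>i \<tau>. U (i + j) (\<tau> + s) + of_int n) i \<tau> = FK_force L U (i + j) (\<tau> + s)" for i \<tau>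
    unfolding FK_force_def sin_2pi_add_int ind by simp
  have cont: "continuous_on {0..} (\<lambda>\<tau>. f (\<tau> + s) + of_int n)" if "continuous_on {0..} f" for f :: "real \<Rightarrow> real"
    using s by (intro continuous_intros continuous_on_compose2[OF that]) auto
  have growth: "\<exists>C. \<forall>i. \<forall>\<tau>\<in>{0..T}. \<bar>U (i + j) (\<tau> + s) + of_int n\<bar> \<le> C * (1 + \<bar>of_int i\<bar>) \<and>
      \<bar>X (i + j) (\<tau> + s) + of_int n\<bar> \<le> C * (1 + \<bar>of_int i\<bar>)" for T
  proof -
    obtain C where C: "0 \<le> C" "\<And>i \<tau>. 0 \<le> \<tau> \<Longrightarrow> \<tau> \<le> T + s \<Longrightarrow>
        \<bar>U i \<tau>\<bar> \<le> C * (1 + \<bar>of_int i\<bar>) \<and> \<bar>X i \<tau>\<bar> \<le> C * (1 + \<bar>of_int i\<bar>)"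
      using FK_system_growth[OF sys] by blast
    have le: "C * (1 + \<bar>of_int (i + j)\<bar>) + \<bar>of_int n\<bar> \<le> (C * (1 + \<bar>of_int j\<bar>) + \<bar>of_int n\<bar>) * (1 + \<bar>of_int i\<bar>)" for i
    proof -
      have "C * (1 + \<bar>of_int (i + j)\<bar>) \<le> C * ((1 + \<bar>of_int j\<bar>) * (1 + \<bar>of_int i\<bar>))"
      proof (rule mult_left_mono[OF _ C(1)])
        have "\<bar>of_int (i + j)\<bar> \<le> \<bar>of_int i\<bar> + \<bar>of_int j\<bar> + \<bar>of_int j\<bar> * \<bar>of_int i :: real\<bar>"
          by (auto intro: add_increasing2 abs_triangle_ineq)
        then show "1 + \<bar>of_int (i + j)\<bar> \<le> (1 + \<bar>of_int j\<bar>) * (1 + \<bar>of_int i :: real\<bar>)"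
          by (simp add: algebra_simps)
      qed
      moreover have "0 \<le> \<bar>of_int n\<bar> * \<bar>of_int i :: real\<bar>" by simp
      moreover have "(C * (1 + \<bar>of_int j\<bar>) + \<bar>of_int n\<bar>) * (1 + \<bar>of_int i\<bar>)
          = C * ((1 + \<bar>of_int j\<bar>) * (1 + \<bar>of_int i\<bar>)) + \<bar>of_int n\<bar> + \<bar>of_int n\<bar> * \<bar>of_int i\<bar>"
        by (simp add: algebra_simps)
      ultimately show ?thesis by linarith
    qed
    show ?thesis
    proof (intro exI[of _ "C * (1 + \<bar>of_int j\<bar>) + \<bar>of_int n\<bar>"] allI ballI)
      fix i \<tau> assume "\<tau> \<in> {0..T}"
      then show "\<bar>U (i + j) (\<tau> + s) + of_int n\<bar> \<le> (C * (1 + \<bar>of_int j\<bar>) + \<bar>of_int n\<bar>) * (1 + \<bar>of_int i\<bar>) \<and>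
        \<bar>X (i + j) (\<tau> + s) + of_int n\<bar> \<le> (C * (1 + \<bar>of_int j\<bar>) + \<bar>of_int n\<bar>) * (1 + \<bar>of_int i\<bar>)"
        using C(2)[of "\<tau> + s" "i + j"] le[of i] s by (simp del: of_int_add) linarith
    qed
  qed
  have "((\<lambda>\<tau>. U (i + j) (\<tau> + s) + of_int n) has_real_derivative \<alpha> * (X (i + j) (\<tau> + s) - U (i + j) (\<tau> + s))) (at \<tau>)"
    "((\<lambda>\<tau>. X (i + j) (\<tau> + s) + of_int n) has_real_derivative
      2 * FK_force L U (i + j) (\<tau> + s) + \<alpha> * (U (i + j) (\<tau> + s) - X (i + j) (\<tau> + s))) (at \<tau>)"
    if "0 < \<tau>" for i \<tau>
    using FK_systemD(3,4)[OF sys, of "\<tau> + s" "i + j"] s that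
    by (auto intro!: derivative_eq_intros simp: DERIV_shift)
  then show ?thesis
    unfolding FK_system_def force using growth FK_systemD(1,2)[OF sys] by (auto intro!: cont)
qed

lemma FK_system_minus:
  assumes sys: "FK_system \<alpha> L U X"
  shows "FK_system \<alpha> (- L) (\<lambda>i \<tau>. - U i \<tau>) (\<lambda>i \<tau>. - X i \<tau>)"
proof -
  have force: "FK_force (- L) (\<lambda>i \<tau>. - U i \<tau>) i \<tau> = - FK_force L U i \<tau>" for i \<tau>
    unfolding FK_force_def by simp
  have "((\<lambda>\<tau>. - U i \<tau>) has_real_derivative \<alpha> * (- X i \<tau> - - U i \<tau>)) (at \<tau>)"
    "((\<lambda>\<tau>. - X i \<tau>) has_real_derivative 2 * - FK_force L U i \<tau> + \<alpha> * (- U i \<tau> - - X i \<tau>)) (at \<tau>)"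
    if "0 < \<tau>" for i \<tau>
    using FK_systemD(3,4)[OF sys that, THEN DERIV_minus] by (simp_all add: algebra_simps)
  then show ?thesis
    using sys unfolding FK_system_def force by (simp add: continuous_on_minus)
qed

lemma FK_monotone:
  assumes "20 \<le> \<alpha>" "FK_system \<alpha> L U X" "FK_system \<alpha> L W Y"
    and "\<And>i. U i 0 \<le> W i 0" "\<And>i. X i 0 \<le> Y i 0" "0 \<le> t"
  shows "U i t \<le> W i t" "X i t \<le> Y i t"
  using FK_comparison[of \<alpha> L U X W Y 0 _ t i] assms by auto

lemma FK_unique:
  assumes "20 \<le> \<alpha>" "FK_system \<alpha> L U X" "FK_system \<alpha> L W Y"
    and "\<And>i. U i 0 = W i 0" "\<And>i. X i 0 = Y i 0" "0 \<le> t"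
  shows "U i t = W i t"
proof (rule antisym)
  show "U i t \<le> W i t"
    by (rule FK_monotone(1)[OF assms(1-3)]) (simp_all add: assms(4-6))
  show "W i t \<le> U i t"
    by (rule FK_monotone(1)[OF assms(1,3,2)]) (simp_all add: assms(4-6))
qed

text \<open>Only integer translates of a solution are again solutions, so \<open>d + e\<close> is
  rounded up and \<open>d - e\<close> down before monotonicity is applied. This rounding is the
  whole loss of 1, and it does not accumulate in time.\<close>

lemma FK_spread:
  assumes \<alpha>: "20 \<le> \<alpha>" and sys: "FK_system \<alpha> L U X" and UX: "\<And>i. X i 0 = U i 0"
    and d: "\<And>i. \<bar>U (i + j) 0 - U i 0 - d\<bar> \<le> e" and t: "0 \<le> t"
  shows "\<bar>U (i + j) t - U i t - d\<bar> \<le> e + 1"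
proof -
  have sh: "FK_system \<alpha> L (\<lambda>i \<tau>. U (i + j) \<tau>) (\<lambda>i \<tau>. X (i + j) \<tau>)"
    using FK_system_shift[OF sys order.refl, of j 0] by simp
  have up: "FK_system \<alpha> L (\<lambda>i \<tau>. U i \<tau> + of_int n) (\<lambda>i \<tau>. X i \<tau> + of_int n)" for n
    using FK_system_shift[OF sys order.refl, of 0 n] by simp
  have d': "U (i + j) 0 - U i 0 \<le> of_int \<lceil>d + e\<rceil>" "of_int \<lfloor>d - e\<rfloor> \<le> U (i + j) 0 - U i 0" for i
    using d[of i] by linarith+
  have "U (i + j) t \<le> U i t + of_int \<lceil>d + e\<rceil>"
    by (rule FK_monotone(1)[OF \<alpha> sh up _ _ t]) (use d' UX in \<open>simp_all add: algebra_simps\<close>)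
  moreover have "U i t + of_int \<lfloor>d - e\<rfloor> \<le> U (i + j) t"
    by (rule FK_monotone(1)[OF \<alpha> up sh _ _ t]) (use d' UX in \<open>simp_all add: algebra_simps\<close>)
  ultimately show ?thesis by linarith
qed

text \<open>Maximum principle for relaxation: \<open>V\<close> is pulled towards \<open>f\<close> at
  rate \<open>c\<close>, so it would be decreasing at the level \<open>M + \<delta>\<close>. The
  slack \<delta> makes the initial inequality strict.\<close>

lemma damped_le:
  fixes V f :: "real \<Rightarrow> real"
  assumes "continuous_on {0..T} V" "V 0 \<le> M" "0 < c"
    and der: "\<And>\<tau>. 0 < \<tau> \<Longrightarrow> \<tau> \<le> T \<Longrightarrow> (V has_real_derivative c * (f \<tau> - V \<tau>)) (at \<tau>)"
    and f: "\<And>\<tau>. 0 < \<tau> \<Longrightarrow> \<tau> \<le> T \<Longrightarrow> f \<tau> \<le> M"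
    and t: "0 \<le> t" "t \<le> T"
  shows "V t \<le> M"
proof (rule field_le_epsilon)
  fix \<delta> :: real assume \<delta>: "0 < \<delta>"
  have "V t - (M + \<delta>) < 0"
  proof (rule finite_first_touch[of "{()}" T "\<lambda>_ \<tau>. V \<tau> - (M + \<delta>)"])
    fix \<tau> assume \<tau>: "0 < \<tau>" "\<tau> \<le> T" "V \<tau> - (M + \<delta>) = 0"
    have "c * (f \<tau> - V \<tau>) < 0"
      using assms(3) f[OF \<tau>(1,2)] \<tau>(3) \<delta> by (intro mult_pos_neg) auto
    moreover have "((\<lambda>\<tau>. V \<tau> - (M + \<delta>)) has_real_derivative c * (f \<tau> - V \<tau>)) (at \<tau>)"
      using der[OF \<tau>(1,2)] by (auto intro!: derivative_eq_intros)
    ultimately show "\<exists>d<0. ((\<lambda>\<tau>. V \<tau> - (M + \<delta>)) has_real_derivative d) (at \<tau>)" by blast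
  qed (use assms(1,2) t \<delta> in \<open>auto intro!: continuous_on_diff\<close>)
  then show "V t \<le> M + \<delta>" by simp
qed

lemma damped_abs_le:
  fixes V f :: "real \<Rightarrow> real"
  assumes "continuous_on {0..T} V" "V 0 = 0" "0 < c" "0 \<le> M"
    and der: "\<And>\<tau>. 0 < \<tau> \<Longrightarrow> \<tau> \<le> T \<Longrightarrow> (V has_real_derivative c * (f \<tau> - V \<tau>)) (at \<tau>)"
    and f: "\<And>\<tau>. 0 < \<tau> \<Longrightarrow> \<tau> \<le> T \<Longrightarrow> \<bar>f \<tau>\<bar> \<le> M"
    and t: "0 \<le> t" "t \<le> T"
  shows "\<bar>V t\<bar> \<le> M"
proof -
  have "V t \<le> M"
    by (rule damped_le[of T V M c f]) (use assms(1-4) der f t in \<open>auto simp: abs_le_iff\<close>)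
  moreover have "- V t \<le> M"
  proof (rule damped_le[of T "\<lambda>t. - V t" M c "\<lambda>t. - f t"])
    fix \<tau> assume "0 < \<tau>" "\<tau> \<le> T"
    from DERIV_minus[OF der[OF this]]
    show "((\<lambda>t. - V t) has_real_derivative c * (- f \<tau> - - V \<tau>)) (at \<tau>)" by (simp add: algebra_simps)
  qed (use assms(1-4) f t in \<open>auto simp: abs_le_iff intro!: continuous_on_minus\<close>)
  ultimately show ?thesis by simp
qed

text \<open>The force is a difference of two consecutive gaps, each within \<open>e + 1\<close> of
  \<open>d\<close>, plus a sine and \<open>L\<close>; hence \<open>d\<close> cancels and the bound
  is independent of the mean slope. The velocity \<open>\<alpha> * (X i t - U i t)\<close> starts at
  0 and relaxes towards the force at rate 2\<alpha>, so it inherits the bound.\<close>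

lemma FK_velocity:
  assumes \<alpha>: "20 \<le> \<alpha>" and sys: "FK_system \<alpha> L U X" and UX: "\<And>i. X i 0 = U i 0"
    and d: "\<And>i. \<bar>U (i + 1) 0 - U i 0 - d\<bar> \<le> e"
  shows "0 \<le> t \<Longrightarrow> \<bar>X i t - U i t\<bar> \<le> 2 * e + 3 + \<bar>L\<bar>"
    and "0 \<le> s \<Longrightarrow> 0 \<le> t \<Longrightarrow> \<bar>U i s - U i t\<bar> \<le> (2 * e + 3 + \<bar>L\<bar>) * \<bar>s - t\<bar>"
proof -
  define M where "M = 2 * e + 3 + \<bar>L\<bar>"
  have e: "0 \<le> e" using d[of 0] by linarith
  then have M: "0 \<le> M" by (simp add: M_def)
  have force: "\<bar>FK_force L U i \<tau>\<bar> \<le> M" if "0 \<le> \<tau>" for i \<tau>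
  proof -
    have "\<bar>U (i + 1) \<tau> - U i \<tau> - d\<bar> \<le> e + 1" "\<bar>U i \<tau> - U (i - 1) \<tau> - d\<bar> \<le> e + 1"
      using FK_spread[OF \<alpha> sys UX d that, of i] FK_spread[OF \<alpha> sys UX d that, of "i - 1"] by simp_all
    then show ?thesis
      unfolding FK_force_def M_def abs_le_iff
      using sin_le_one[of "2 * pi * U i \<tau>"] sin_ge_minus_one[of "2 * pi * U i \<tau>"] by linarith
  qed
  have V: "\<bar>\<alpha> * (X i t - U i t)\<bar> \<le> M" if "0 \<le> t" for i t
  proof (rule damped_abs_le[of t "\<lambda>t. \<alpha> * (X i t - U i t)" "2 * \<alpha>" M "FK_force L U i"])
    show "continuous_on {0..t} (\<lambda>t. \<alpha> * (X i t - U i t))"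
      by (intro continuous_intros continuous_on_subset[OF FK_systemD(1)[OF sys]]
          continuous_on_subset[OF FK_systemD(2)[OF sys]]) auto
    fix \<tau> :: real assume \<tau>: "0 < \<tau>"
    then show "\<bar>FK_force L U i \<tau>\<bar> \<le> M" by (simp add: force)
    show "((\<lambda>t. \<alpha> * (X i t - U i t)) has_real_derivative 2 * \<alpha> * (FK_force L U i \<tau> - \<alpha> * (X i \<tau> - U i \<tau>))) (at \<tau>)"
      using FK_systemD(3,4)[OF sys \<tau>] by (auto intro!: derivative_eq_intros simp: algebra_simps)
  qed (use \<alpha> M UX that in auto)
  show "\<bar>X i t - U i t\<bar> \<le> 2 * e + 3 + \<bar>L\<bar>" if "0 \<le> t"
  proof -
    have "1 * \<bar>X i t - U i t\<bar> \<le> \<alpha> * \<bar>X i t - U i t\<bar>" using \<alpha> by (intro mult_right_mono) auto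
    then show ?thesis using V[OF that, of i] \<alpha> by (simp add: abs_mult M_def)
  qed
  have *: "\<bar>U i t - U i s\<bar> \<le> M * \<bar>t - s\<bar>" if st: "0 \<le> s" "s < t" for s t
  proof -
    have "continuous_on {s..t} (U i)" using st by (auto intro: continuous_on_subset[OF FK_systemD(1)[OF sys]])
    then obtain l z where z: "s < z" "z < t" "(U i has_real_derivative l) (at z)" "U i t - U i s = (t - s) * l"
      using MVT[OF st(2), of "U i"] FK_systemD(3)[OF sys] st
      by (meson le_less_trans real_differentiable_def)
    have "l = \<alpha> * (X i z - U i z)"
      using DERIV_unique[OF z(3) FK_systemD(3)[OF sys]] z st by auto
    then show ?thesis using V[of z i] z st by (simp add: abs_mult mult.commute mult_left_mono)
  qed
  show "\<bar>U i s - U i t\<bar> \<le> (2 * e + 3 + \<bar>L\<bar>) * \<bar>s - t\<bar>" if "0 \<le> s" "0 \<le> t"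
    using *[of s t] *[of t s] that unfolding M_def
    by (cases s t rule: linorder_cases) (auto simp: abs_minus_commute)
qed

section \<open>Existence for the cooperative system\<close>

instance bcontfun :: (metric_space, banach) banach ..

text \<open>
  The initial profile is a function on the whole line since bounded continuous functions on \<open>real\<close>,
  unlike those on \<open>int\<close>, form an instance of the class of Banach spaces.
\<close>
lemma FK_system_exists:
  fixes a :: "real \<Rightarrow> real"
  assumes acont: "continuous_on UNIV a" and a: "\<And>x. \<bar>a (x + 1) - a x\<bar> \<le> K" and \<alpha>: "0 \<le> \<alpha>"
  obtains U X where "FK_system \<alpha> L U X" "\<And>i. U i 0 = a (of_int i)" "\<And>i. X i 0 = a (of_int i)"
    "\<And>i \<tau>. 0 \<le> \<tau> \<Longrightarrow> (U i has_real_derivative \<alpha> * (X i \<tau> - U i \<tau>)) (at \<tau> within {0..})"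
    "\<And>T. \<exists>C. \<forall>i. \<forall>\<tau>\<in>{0..T}. \<bar>U i \<tau> - a (of_int i)\<bar> \<le> C"
proof -
  \<comment> \<open>The unknown is the pair of deviations of \<open>U\<close> and \<open>X\<close>
    from \<open>a\<close>, which stay bounded although \<open>a\<close> is not. The vector field
    couples \<open>i\<close> only with \<open>i - 1\<close> and \<open>i + 1\<close>, so restricting
    a real index to the integers yields the particle system.\<close>
  define g where "g y i = (\<alpha> * (snd (y i) - fst (y i)),
      2 * (fst (y (i + 1)) - 2 * fst (y i) + fst (y (i - 1)) + (a (i + 1) - 2 * a i + a (i - 1))
        + sin (2 * pi * (a i + fst (y i))) + L) + \<alpha> * (fst (y i) - snd (y i)))" for y :: "real \<Rightarrow> real \<times> real" and i
  define G where "G y = Bcontfun (g (apply_bcontfun y))" for y :: "real \<Rightarrow>\<^sub>C (real \<times> real)"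
  have fs: "\<bar>fst (apply_bcontfun y i)\<bar> \<le> norm y" "\<bar>snd (apply_bcontfun y i)\<bar> \<le> norm y"
    for y :: "real \<Rightarrow>\<^sub>C (real \<times> real)" and i
    using norm_bounded[of y i] norm_fst_le[of "fst (y i)" "snd (y i)"] norm_snd_le[of "snd (y i)" "fst (y i)"]
    by (auto simp: real_norm_def)
  have pair: "norm (p, q) \<le> \<bar>p\<bar> + \<bar>q\<bar>" for p q :: real using norm_Pair_le[of p q] by simp
  have aK: "\<bar>a (i + 1) - 2 * a i + a (i - 1)\<bar> \<le> 2 * K" for i
    using a[of i] a[of "i - 1"] by (simp add: abs_le_iff)
  have gcont: "continuous_on UNIV (g (apply_bcontfun y))" for y
    unfolding g_def
    by (intro continuous_intros continuous_on_compose2[OF acont] continuous_on_apply_bcontfun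
        continuous_on_compose2[OF continuous_on_apply_bcontfun, of UNIV]) auto
  have Gb: "g (apply_bcontfun y) \<in> bcontfun" for y
  proof (rule bcontfun_normI)
    fix i
    have m: "\<bar>\<alpha> * (snd (y i) - fst (y i))\<bar> \<le> \<alpha> * (2 * norm y)"
      unfolding abs_mult using fs[of y i] \<alpha> by (simp, intro mult_left_mono) auto
    have "\<bar>2 * (fst (y (i + 1)) - 2 * fst (y i) + fst (y (i - 1)) + (a (i + 1) - 2 * a i + a (i - 1))
        + sin (2 * pi * (a i + fst (y i))) + L)\<bar> \<le> 2 * (4 * norm y + 2 * K + 1 + \<bar>L\<bar>)"
      using fs(1)[of y i] fs(1)[of y "i + 1"] fs(1)[of y "i - 1"] aK[of i]
        sin_le_one[of "2 * pi * (a i + fst (y i))"] sin_ge_minus_one[of "2 * pi * (a i + fst (y i))"]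
        abs_ge_self[of L] abs_ge_minus_self[of L]
      unfolding abs_le_iff by (intro conjI; argo)
    moreover have "\<alpha> * (fst (y i) - snd (y i)) = - (\<alpha> * (snd (y i) - fst (y i)))" by (simp add: algebra_simps)
    ultimately show "norm (g y i) \<le> \<alpha> * (2 * norm y) + (2 * (4 * norm y + 2 * K + 1 + \<bar>L\<bar>) + \<alpha> * (2 * norm y))"
      unfolding g_def using m by (intro order_trans[OF pair]) linarith
  qed (rule gcont)
  have lip: "(\<alpha> * 4 + 2 * (4 + 2 * pi))-lipschitz_on UNIV G"
  proof (rule lipschitz_onI)
    fix y z :: "real \<Rightarrow>\<^sub>C (real \<times> real)"
    show "dist (G y) (G z) \<le> (\<alpha> * 4 + 2 * (4 + 2 * pi)) * dist y z"
    proof (rule dist_bound)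
      fix i
      define D where "D = dist y z"
      have D: "\<bar>fst (y i) - fst (z i)\<bar> \<le> D" "\<bar>snd (y i) - snd (z i)\<bar> \<le> D" for i
        using fs[of "y - z" i] by (simp_all add: D_def dist_norm)
      have m: "\<bar>\<alpha> * ((snd (y i) - snd (z i)) - (fst (y i) - fst (z i)))\<bar> \<le> \<alpha> * (2 * D)"
        unfolding abs_mult using D[of i] \<alpha> by (simp, intro mult_left_mono) auto
      have "\<bar>2 * pi * (a i + fst (y i)) - 2 * pi * (a i + fst (z i))\<bar> = 2 * pi * \<bar>fst (y i) - fst (z i)\<bar>"
        by (simp add: abs_mult flip: right_diff_distrib)
      then have "\<bar>sin (2 * pi * (a i + fst (y i))) - sin (2 * pi * (a i + fst (z i)))\<bar> \<le> 2 * pi * \<bar>fst (y i) - fst (z i)\<bar>"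
        using sin_diff_le[of "2 * pi * (a i + fst (y i))" "2 * pi * (a i + fst (z i))"]
          sin_diff_le[of "2 * pi * (a i + fst (z i))" "2 * pi * (a i + fst (y i))"]
        by (simp add: abs_minus_commute abs_le_iff)
      also have "\<dots> \<le> 2 * pi * D" using D by (intro mult_left_mono) auto
      finally have "\<bar>2 * ((fst (y (i + 1)) - fst (z (i + 1))) - 2 * (fst (y i) - fst (z i)) + (fst (y (i - 1)) - fst (z (i - 1)))
          + (sin (2 * pi * (a i + fst (y i))) - sin (2 * pi * (a i + fst (z i)))))\<bar> \<le> 2 * (4 * D + 2 * pi * D)"
        using D(1)[of i] D(1)[of "i + 1"] D(1)[of "i - 1"] unfolding abs_le_iff by (intro conjI; argo)
      then have "\<bar>2 * ((fst (y (i + 1)) - fst (z (i + 1))) - 2 * (fst (y i) - fst (z i)) + (fst (y (i - 1)) - fst (z (i - 1)))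
          + (sin (2 * pi * (a i + fst (y i))) - sin (2 * pi * (a i + fst (z i)))))
          - \<alpha> * ((snd (y i) - snd (z i)) - (fst (y i) - fst (z i)))\<bar> \<le> 2 * (4 * D + 2 * pi * D) + \<alpha> * (2 * D)"
        using m by linarith
      with m have "norm (\<alpha> * ((snd (y i) - snd (z i)) - (fst (y i) - fst (z i))),
          2 * ((fst (y (i + 1)) - fst (z (i + 1))) - 2 * (fst (y i) - fst (z i)) + (fst (y (i - 1)) - fst (z (i - 1)))
          + (sin (2 * pi * (a i + fst (y i))) - sin (2 * pi * (a i + fst (z i)))))
          - \<alpha> * ((snd (y i) - snd (z i)) - (fst (y i) - fst (z i))))
        \<le> \<alpha> * (2 * D) + (2 * (4 * D + 2 * pi * D) + \<alpha> * (2 * D))"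
        by (intro order_trans[OF pair]) linarith
      also have "\<dots> = (\<alpha> * 4 + 2 * (4 + 2 * pi)) * D" by (simp add: algebra_simps)
      finally show "dist (G y i) (G z i) \<le> (\<alpha> * 4 + 2 * (4 + 2 * pi)) * dist y z"
        unfolding G_def Bcontfun_inverse[OF Gb] dist_norm g_def D_def[symmetric, unfolded dist_norm]
        by (simp add: algebra_simps)
    qed
  qed (use \<alpha> in simp)
  obtain x where x0: "x 0 = 0"
    and x: "\<And>t. 0 \<le> t \<Longrightarrow> (x has_vector_derivative G (x t)) (at t within {0..})"
    by (rule lipschitz_ode_global_solution[OF lip, of 0]) iprover
  define U where "U i t = a (of_int i) + fst (x t (of_int i))"  for i :: int and t
  define X where "X i t = a (of_int i) + snd (x t (of_int i))"  for i :: int and t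
  have bl: "bounded_linear (\<lambda>y :: real \<Rightarrow>\<^sub>C (real \<times> real). apply_bcontfun y i)" for i
    by (rule bounded_linear_intro[of _ 1]) (auto simp: norm_bounded)
  have x_at: "((\<lambda>t. x t i) has_vector_derivative g (x t) i) (at t within {0..})" if "0 \<le> t" for t i
    using bounded_linear.has_vector_derivative[OF bl x[OF that], of i]
    by (simp add: G_def Bcontfun_inverse[OF Gb])
  have Ud: "(U i has_real_derivative \<alpha> * (X i t - U i t)) (at t within {0..})" if "0 \<le> t" for t i
    using bounded_linear.has_vector_derivative[OF bounded_linear_fst x_at[OF that], of "of_int i"]
    unfolding U_def X_def has_real_derivative_iff_has_vector_derivative
    by (auto intro!: derivative_eq_intros simp: g_def)
  have Xd: "(X i has_real_derivative 2 * FK_force L U i t + \<alpha> * (U i t - X i t)) (at t within {0..})" if "0 \<le> t" for t i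
    using bounded_linear.has_vector_derivative[OF bounded_linear_snd x_at[OF that], of "of_int i"]
    unfolding U_def X_def has_real_derivative_iff_has_vector_derivative
    by (auto intro!: derivative_eq_intros simp: g_def FK_force_def algebra_simps)
  have xb: "\<exists>C. \<forall>i. \<forall>\<tau>\<in>{0..T}. \<bar>fst (x \<tau> i)\<bar> \<le> C \<and> \<bar>snd (x \<tau> i)\<bar> \<le> C" for T
  proof -
    have "continuous_on {0..} x"
      using x unfolding continuous_on_eq_continuous_within
      by (auto intro: has_vector_derivative_continuous)
    then have "continuous_on {0..T} x" by (rule continuous_on_subset) auto
    then have "bounded (x ` {0..T})" by (intro compact_imp_bounded compact_continuous_image) auto
    then obtain C where "\<forall>\<tau>\<in>{0..T}. norm (x \<tau>) \<le> C" by (auto simp: bounded_iff)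
    then show ?thesis using fs order_trans by blast
  qed
  have aj: "\<bar>a (of_int i)\<bar> \<le> \<bar>a 0\<bar> + K * \<bar>of_int i\<bar>" for i :: int
  proof (induction i rule: int_induct[of _ 0])
    case (step1 i)
    then show ?case using a[of "of_int i"] by (simp add: algebra_simps abs_le_iff)
  next
    case (step2 i)
    then show ?case using a[of "of_int i - 1"] by (simp add: algebra_simps)
  qed auto
  show thesis
  proof (rule that[of U X])
    show "FK_system \<alpha> L U X"
      unfolding FK_system_def
    proof (intro conjI allI impI)
      show "continuous_on {0..} (U i)" "continuous_on {0..} (X i)" for i
        using Ud Xd by (auto intro!: DERIV_continuous_on)
      fix i and \<tau> :: real assume \<tau>: "0 < \<tau>"
      then have "at \<tau> within {0..} = at \<tau>" by (intro at_within_interior) auto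
      then show "(U i has_real_derivative \<alpha> * (X i \<tau> - U i \<tau>)) (at \<tau>)"
        "(X i has_real_derivative 2 * FK_force L U i \<tau> + \<alpha> * (U i \<tau> - X i \<tau>)) (at \<tau>)"
        using Ud[of \<tau> i] Xd[of \<tau> i] \<tau> by simp_all
    next
      fix T
      obtain C where C: "\<And>i \<tau>. \<tau> \<in> {0..T} \<Longrightarrow> \<bar>fst (x \<tau> i)\<bar> \<le> C \<and> \<bar>snd (x \<tau> i)\<bar> \<le> C"
        using xb by blast
      have K: "0 \<le> K" using a[of 0] by linarith
      have le: "\<bar>a 0\<bar> + K * \<bar>of_int i\<bar> + \<bar>C\<bar> \<le> (\<bar>a 0\<bar> + \<bar>C\<bar> + K) * (1 + \<bar>of_int i\<bar>)" for i
        using K by (simp add: algebra_simps)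
      show "\<exists>C. \<forall>i. \<forall>\<tau>\<in>{0..T}. \<bar>U i \<tau>\<bar> \<le> C * (1 + \<bar>of_int i\<bar>) \<and> \<bar>X i \<tau>\<bar> \<le> C * (1 + \<bar>of_int i\<bar>)"
      proof (intro exI[of _ "\<bar>a 0\<bar> + \<bar>C\<bar> + K"] allI ballI)
        fix i \<tau> assume "\<tau> \<in> {0..T}"
        then show "\<bar>U i \<tau>\<bar> \<le> (\<bar>a 0\<bar> + \<bar>C\<bar> + K) * (1 + \<bar>of_int i\<bar>) \<and> \<bar>X i \<tau>\<bar> \<le> (\<bar>a 0\<bar> + \<bar>C\<bar> + K) * (1 + \<bar>of_int i\<bar>)"
          using C[of \<tau> "of_int i"] aj[of i] le[of i] unfolding U_def X_def by linarith
      qed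
    qed
    show "\<exists>C. \<forall>i. \<forall>\<tau>\<in>{0..T}. \<bar>U i \<tau> - a (of_int i)\<bar> \<le> C" for T
      using xb[of T] unfolding U_def by auto
  qed (use Ud x0 in \<open>auto simp: U_def X_def\<close>)
qed

section \<open>Mean velocities of planar solutions\<close>

text \<open>A two-sided Fekete argument. Since \<open>g (n * t)\<close> differs from
  \<open>n * g t\<close> by at most \<open>(n + 1) * C\<close>, following multiples of
  \<open>t\<close> and of \<open>s\<close> that stay within \<open>s\<close> of each other gives
  \<open>(g t - C) / t \<le> (g s + C) / s\<close>. Any number separating the two families is a
  slope with error \<open>C\<close>, not merely o(t).\<close>

lemma quasi_additive_slope:
  fixes g :: "real \<Rightarrow> real"
  assumes add: "\<And>s t. 0 \<le> s \<Longrightarrow> 0 \<le> t \<Longrightarrow> \<bar>g (s + t) - g s - g t\<bar> \<le> C"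
    and lip: "\<And>s t. 0 \<le> s \<Longrightarrow> 0 \<le> t \<Longrightarrow> \<bar>g s - g t\<bar> \<le> M * \<bar>s - t\<bar>"
  obtains l where "\<And>t. 0 \<le> t \<Longrightarrow> \<bar>g t - l * t\<bar> \<le> C"
proof -
  have g0: "\<bar>g 0\<bar> \<le> C" using add[of 0 0] by simp
  have M: "0 \<le> M" using lip[of 0 1] by simp
  have mult: "g (real n * t) \<le> real n * (g t + C) + C" "real n * (g t - C) - C \<le> g (real n * t)"
    if "0 \<le> t" for n t
  proof (induction n)
    case (Suc n)
    have "\<bar>g (real n * t + t) - g (real n * t) - g t\<bar> \<le> C" using add that by simp
    moreover have "real (Suc n) * t = real n * t + t" by (simp add: algebra_simps)
    ultimately show "g (real (Suc n) * t) \<le> real (Suc n) * (g t + C) + C"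
      "real (Suc n) * (g t - C) - C \<le> g (real (Suc n) * t)"
      using Suc by (simp_all add: algebra_simps abs_le_iff)
  qed (use g0 in auto)
  have le: "(g t - C) / t \<le> (g s + C) / s" if "0 < s" "0 < t" for s t
  proof -
    define A B where "A = g t - C" and "B = g s + C"
    \<comment> \<open>Everything that stays bounded as \<open>n\<close> grows; a positive factor
      \<open>A - t / s * B\<close> would eventually exceed it.\<close>
    define K where "K = 2 * C + \<bar>B\<bar> + M * s"
    have "real n * (A - t / s * B) \<le> K" for n
    proof -
      define m where "m = nat \<lfloor>real n * t / s\<rfloor>"
      have m: "real m \<le> real n * t / s" "real n * t / s < real m + 1"
        using that by (auto simp: m_def)
      then have ms: "real m * s \<le> real n * t" "real n * t \<le> real m * s + s"
        using that by (auto simp: field_simps)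
      have "real n * A - C \<le> g (real n * t)" using mult(2)[of t n] that by (simp add: A_def)
      also have "\<dots> \<le> g (real m * s) + M * (real n * t - real m * s)"
        using lip[of "real n * t" "real m * s"] ms that by (simp add: abs_le_iff)
      also have "M * (real n * t - real m * s) \<le> M * s" using ms M by (intro mult_left_mono) auto
      also have "g (real m * s) \<le> real m * B + C" using mult(1)[of s m] that by (simp add: B_def)
      finally have *: "real n * A \<le> real m * B + 2 * C + M * s" by simp
      have "real m * B - real n * t / s * B = (real m - real n * t / s) * B" by (simp add: algebra_simps)
      also have "\<dots> \<le> \<bar>real m - real n * t / s\<bar> * \<bar>B\<bar>" by (metis abs_ge_self abs_mult)
      also have "\<dots> \<le> 1 * \<bar>B\<bar>" using m by (intro mult_right_mono) auto
      finally show ?thesis using * by (simp add: K_def algebra_simps)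
    qed
    then have "\<not> 0 < A - t / s * B" using ex_less_of_nat_mult[of "A - t / s * B" K] by (meson not_le)
    then show ?thesis using that by (simp add: A_def B_def field_simps)
  qed
  define l where "l = (SUP t\<in>{0<..}. (g t - C) / t)"
  have bdd: "bdd_above ((\<lambda>t. (g t - C) / t) ` {0<..})"
    using le[of 1] by (auto intro!: bdd_aboveI[of _ "(g 1 + C) / 1"])
  show thesis
  proof (rule that[of l])
    fix t :: real assume "0 \<le> t"
    show "\<bar>g t - l * t\<bar> \<le> C"
    proof (cases "t = 0")
      case False
      then have t: "0 < t" using \<open>0 \<le> t\<close> by simp
      have "(g t - C) / t \<le> l" unfolding l_def using t by (intro cSUP_upper bdd) auto
      moreover have "l \<le> (g t + C) / t" unfolding l_def using le t by (intro cSUP_least) auto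
      ultimately show ?thesis using t by (simp add: field_simps abs_le_iff)
    qed (use g0 in simp)
  qed
qed

text \<open>One constant \<open>C\<close> serves all slopes and all times. This uniformity yields
  the continuity of \<open>F\<close>, and it turns the deviation from the mean motion into an
  O(\<epsilon>) error after rescaling.\<close>

definition planar_mean_velocity :: "real \<Rightarrow> real \<Rightarrow> real \<Rightarrow> (real \<Rightarrow> real) \<Rightarrow> bool" where
  "planar_mean_velocity \<alpha> L C F \<longleftrightarrow>
     (\<forall>p U X. FK_system \<alpha> L U X \<longrightarrow> (\<forall>i. U i 0 = p * of_int i \<and> X i 0 = p * of_int i) \<longrightarrow>
        (\<forall>t\<ge>0. \<bar>U 0 t - F p * t\<bar> \<le> C))"

lemma planar_mean_velocityD:
  assumes "planar_mean_velocity \<alpha> L C F" "FK_system \<alpha> L U X"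
    "\<And>i. U i 0 = p * of_int i" "\<And>i. X i 0 = p * of_int i" "0 \<le> t"
  shows "\<bar>U 0 t - F p * t\<bar> \<le> C"
  using assms unfolding planar_mean_velocity_def by blast

lemma FK_planar_exists:
  assumes "0 \<le> \<alpha>"
  obtains U X where "FK_system \<alpha> L U X" "\<And>i. U i 0 = p * of_int i" "\<And>i. X i 0 = p * of_int i"
  by (rule FK_system_exists[of "\<lambda>x. p * x" "\<bar>p\<bar>" \<alpha> L])
    (use assms in \<open>auto intro!: continuous_intros simp: algebra_simps\<close>)

text \<open>At the restart time \<open>s\<close> the positions lie within 1 of the plane of slope
  \<open>p\<close> through \<open>U 0 s\<close>, and \<open>X\<close> within a further
  \<open>3 + \<bar>L\<bar>\<close>. Integer translates of the initial plane with margin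
  \<open>4 + \<bar>L\<bar>\<close> thus bracket the state; rounding them adds 1.\<close>

lemma FK_planar_quasi_additive:
  assumes \<alpha>: "20 \<le> \<alpha>" and sys: "FK_system \<alpha> L U X"
    and U0: "\<And>i. U i 0 = p * of_int i" and X0: "\<And>i. X i 0 = p * of_int i"
    and st: "0 \<le> s" "0 \<le> t"
  shows "\<bar>U 0 (s + t) - U 0 s - U 0 t\<bar> \<le> 5 + \<bar>L\<bar>"
proof -
  have late: "FK_system \<alpha> L (\<lambda>i \<tau>. U i (\<tau> + s)) (\<lambda>i \<tau>. X i (\<tau> + s))"
    using FK_system_shift[OF sys st(1), of 0 0] by simp
  have up: "FK_system \<alpha> L (\<lambda>i \<tau>. U i \<tau> + of_int n) (\<lambda>i \<tau>. X i \<tau> + of_int n)" for n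
    using FK_system_shift[OF sys order.refl, of 0 n] by simp
  have Us: "\<bar>U i s - U 0 s - p * of_int i\<bar> \<le> 1" for i
    using FK_spread[OF \<alpha> sys, of i "p * of_int i" 0 s 0] st U0 X0 by (simp add: algebra_simps)
  have Xs: "\<bar>X i s - U i s\<bar> \<le> 3 + \<bar>L\<bar>" for i
    using FK_velocity(1)[OF \<alpha> sys, of p 0 s i] st U0 X0 by (simp add: algebra_simps)
  define m n where "m = \<lfloor>U 0 s - 4 - \<bar>L\<bar>\<rfloor>" and "n = \<lceil>U 0 s + 4 + \<bar>L\<bar>\<rceil>"
  have "U i s \<le> p * of_int i + of_int n" "X i s \<le> p * of_int i + of_int n"
    "p * of_int i + of_int m \<le> U i s" "p * of_int i + of_int m \<le> X i s" for i
    using Us[of i] Xs[of i] unfolding m_def n_def by linarith+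
  then have "U 0 (t + s) \<le> U 0 t + of_int n" "U 0 t + of_int m \<le> U 0 (t + s)"
    using U0 X0
    by (intro FK_monotone(1)[OF \<alpha> late up _ _ st(2)] FK_monotone(1)[OF \<alpha> up late _ _ st(2)]; simp)+
  then show ?thesis unfolding m_def n_def by (simp add: add.commute) linarith
qed

lemma planar_mean_velocity_exists:
  assumes \<alpha>: "20 \<le> \<alpha>"
  obtains F where "planar_mean_velocity \<alpha> L (5 + \<bar>L\<bar>) F"
proof -
  have "\<exists>l. \<forall>U X. FK_system \<alpha> L U X \<longrightarrow> (\<forall>i. U i 0 = p * of_int i \<and> X i 0 = p * of_int i) \<longrightarrow>
        (\<forall>t\<ge>0. \<bar>U 0 t - l * t\<bar> \<le> 5 + \<bar>L\<bar>)" for p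
  proof -
    obtain P Q where P: "FK_system \<alpha> L P Q" "\<And>i. P i 0 = p * of_int i" "\<And>i. Q i 0 = p * of_int i"
      using FK_planar_exists[of \<alpha> L p] \<alpha> by auto
    have "\<bar>P 0 s - P 0 t\<bar> \<le> (3 + \<bar>L\<bar>) * \<bar>s - t\<bar>" if "0 \<le> s" "0 \<le> t" for s t
      using FK_velocity(2)[OF \<alpha> P(1), of p 0 s t 0] that P(2,3) by (simp add: algebra_simps)
    then obtain l where l: "\<And>t. 0 \<le> t \<Longrightarrow> \<bar>P 0 t - l * t\<bar> \<le> 5 + \<bar>L\<bar>"
      using quasi_additive_slope[OF FK_planar_quasi_additive[OF \<alpha> P]] by blast
    have "U 0 t = P 0 t" if "FK_system \<alpha> L U X" "\<forall>i. U i 0 = p * of_int i \<and> X i 0 = p * of_int i" "0 \<le> t" for U X t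
      by (rule FK_unique[OF \<alpha> that(1) P(1)]) (use that P in simp_all)
    then show ?thesis using l by (intro exI[of _ l] allI impI) metis
  qed
  then obtain F where "\<forall>p U X. FK_system \<alpha> L U X \<longrightarrow> (\<forall>i. U i 0 = p * of_int i \<and> X i 0 = p * of_int i) \<longrightarrow>
        (\<forall>t\<ge>0. \<bar>U 0 t - F p * t\<bar> \<le> 5 + \<bar>L\<bar>)"
    by metis
  then show thesis using that unfolding planar_mean_velocity_def by blast
qed

lemma planar_mean_velocity_minus:
  assumes F: "planar_mean_velocity \<alpha> L C F"
  shows "planar_mean_velocity \<alpha> (- L) C (\<lambda>p. - F (- p))"
  unfolding planar_mean_velocity_def
proof (intro allI impI)
  fix p U X and t :: real
  assume "FK_system \<alpha> (- L) U X" "\<forall>i. U i 0 = p * of_int i \<and> X i 0 = p * of_int i" "0 \<le> t"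
  then have "\<bar>- U 0 t - F (- p) * t\<bar> \<le> C"
    using planar_mean_velocityD[OF F, of "\<lambda>i \<tau>. - U i \<tau>" "\<lambda>i \<tau>. - X i \<tau>" "- p" t]
      FK_system_minus[of \<alpha> "- L" U X] by simp
  then show "\<bar>U 0 t - - F (- p) * t\<bar> \<le> C" by (simp add: abs_le_iff)
qed

text \<open>Planar data have \<open>e = 0\<close> in the velocity estimate, whose bound passes to
  the mean velocity over times \<open>n\<close> tending to infinity.\<close>

lemma planar_mean_velocity_bounded:
  assumes \<alpha>: "20 \<le> \<alpha>" and F: "planar_mean_velocity \<alpha> L C F"
  shows "\<bar>F p\<bar> \<le> 3 + \<bar>L\<bar>"
proof -
  obtain P Q where P: "FK_system \<alpha> L P Q" "\<And>i. P i 0 = p * of_int i" "\<And>i. Q i 0 = p * of_int i"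
    using FK_planar_exists[of \<alpha> L p] \<alpha> by auto
  have "real n * (\<bar>F p\<bar> - (3 + \<bar>L\<bar>)) \<le> C" for n
  proof -
    have "\<bar>P 0 (real n)\<bar> \<le> (3 + \<bar>L\<bar>) * real n"
      using FK_velocity(2)[OF \<alpha> P(1), of p 0 "real n" 0 0] P(2,3) by (simp add: algebra_simps)
    moreover have "\<bar>P 0 (real n) - F p * real n\<bar> \<le> C" using planar_mean_velocityD[OF F P] by simp
    moreover have "\<bar>F p * real n\<bar> = \<bar>F p\<bar> * real n" by (simp add: abs_mult)
    ultimately show ?thesis by (simp add: algebra_simps)
  qed
  then have "\<not> 0 < \<bar>F p\<bar> - (3 + \<bar>L\<bar>)" using ex_less_of_nat_mult[of "\<bar>F p\<bar> - (3 + \<bar>L\<bar>)" C] by (meson not_le)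
  then show ?thesis by simp
qed

text \<open>Two planes through the origin differ by at most
  \<open>\<bar>q - p\<bar> * exp \<bar>of_int i\<bar>\<close>, which is exactly an initial barrier.
  Over a finite time \<open>t\<close> the gap at particle 0 is controlled, and the deviations from
  the mean motion contribute \<open>2 * C / t\<close>.\<close>

lemma planar_mean_velocity_diff:
  assumes \<alpha>: "20 \<le> \<alpha>" and F: "planar_mean_velocity \<alpha> L C F" and t: "0 < t"
  shows "F q - F p \<le> (2 * C + \<bar>q - p\<bar> * exp (40 * t)) / t"
proof -
  obtain P Q where P: "FK_system \<alpha> L P Q" "\<And>i. P i 0 = p * of_int i" "\<And>i. Q i 0 = p * of_int i"
    using FK_planar_exists[of \<alpha> L p] \<alpha> by auto
  obtain U X where U: "FK_system \<alpha> L U X" "\<And>i. U i 0 = q * of_int i" "\<And>i. X i 0 = q * of_int i"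
    using FK_planar_exists[of \<alpha> L q] \<alpha> by auto
  have le: "q * of_int i \<le> p * of_int i + \<bar>q - p\<bar> * exp \<bar>of_int i\<bar>" for i :: int
  proof -
    have "(q - p) * of_int i \<le> \<bar>q - p\<bar> * \<bar>of_int i\<bar>" by (metis abs_ge_self abs_mult)
    also have "\<dots> \<le> \<bar>q - p\<bar> * exp \<bar>of_int i\<bar>"
      using exp_ge_add_one_self[of "\<bar>of_int i\<bar>"] by (intro mult_left_mono) linarith+
    finally show ?thesis by (simp add: algebra_simps)
  qed
  have "U 0 t \<le> P 0 t + \<bar>q - p\<bar> * exp (40 * t)"
    using FK_comparison[OF \<alpha> U(1) P(1), of "\<bar>q - p\<bar>" 0 t 0] le t U P by simp
  moreover have "\<bar>U 0 t - F q * t\<bar> \<le> C" "\<bar>P 0 t - F p * t\<bar> \<le> C"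
    using planar_mean_velocityD[OF F P] planar_mean_velocityD[OF F U] t by auto
  ultimately have "(F q - F p) * t \<le> 2 * C + \<bar>q - p\<bar> * exp (40 * t)"
    by (simp add: algebra_simps abs_le_iff)
  then show ?thesis using t by (simp add: field_simps)
qed

lemma planar_mean_velocity_continuous:
  assumes \<alpha>: "20 \<le> \<alpha>" and F: "planar_mean_velocity \<alpha> L C F"
  shows "continuous_on UNIV F"
  unfolding continuous_on_iff
proof (intro ballI allI impI)
  fix p e :: real assume e: "0 < e"
  obtain P Q where P: "FK_system \<alpha> L P Q" "\<And>i. P i 0 = p * of_int i" "\<And>i. Q i 0 = p * of_int i"
    using FK_planar_exists[of \<alpha> L p] \<alpha> by auto
  have C: "0 \<le> C" using planar_mean_velocityD[OF F P, of 0] by linarith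
  \<comment> \<open>The time is fixed before the neighbourhood of \<open>p\<close>: it makes the
    term with \<open>C\<close> small, and then \<open>q\<close> is so close to \<open>p\<close> that
    the barrier is at most 1 at time \<open>t\<close>.\<close>
  define t where "t = (2 * C + 1) / (e / 2)"
  have t: "0 < t" using C e by (simp add: t_def)
  show "\<exists>d>0. \<forall>q\<in>UNIV. dist q p < d \<longrightarrow> dist (F q) (F p) < e"
  proof (intro exI[of _ "exp (- 40 * t)"] conjI ballI impI)
    fix q assume "dist q p < exp (- 40 * t)"
    then have "\<bar>q - p\<bar> * exp (40 * t) \<le> exp (- 40 * t) * exp (40 * t)"
      by (intro mult_right_mono) (auto simp: dist_real_def)
    then have q: "\<bar>q - p\<bar> * exp (40 * t) \<le> 1" by (simp add: exp_minus)
    then have "(2 * C + \<bar>q - p\<bar> * exp (40 * t)) / t \<le> (2 * C + 1) / t" using t by (intro divide_right_mono) auto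
    also have "(2 * C + 1) / t = e / 2" using C e by (simp add: t_def divide_simps)
    finally have h: "(2 * C + \<bar>q - p\<bar> * exp (40 * t)) / t \<le> e / 2" .
    have "F q - F p \<le> e / 2" using planar_mean_velocity_diff[OF \<alpha> F t, of q p] h by linarith
    moreover have "F p - F q \<le> e / 2"
      using planar_mean_velocity_diff[OF \<alpha> F t, of p q] h unfolding abs_minus_commute[of p q] by linarith
    ultimately show "dist (F q) (F p) < e" using e by (simp add: dist_real_def abs_less_iff)
  qed simp
qed

section \<open>Comparison of viscosity solutions\<close>

lemma visc_supersolution_minus:
  assumes "visc_subsolution F u"
  shows "visc_supersolution (\<lambda>p. - F (- p)) (\<lambda>z. - u z)"
  unfolding visc_supersolution_def
proof (intro allI impI ballI)
  fix \<phi> \<phi>t \<phi>x z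
  assume \<phi>: "C1_test \<phi> \<phi>t \<phi>x" and z: "z \<in> {0::real<..} \<times> (UNIV :: real set)"
    and loc: "\<forall>\<^sub>F w in nhds z. - u z - \<phi> z \<le> - u w - \<phi> w"
  have "C1_test (\<lambda>z. - \<phi> z) (\<lambda>z. - \<phi>t z) (\<lambda>z. - \<phi>x z)"
    using \<phi> unfolding C1_test_def
    by (auto intro!: continuous_on_minus derivative_eq_intros simp: algebra_simps fun_eq_iff)
  moreover have "\<forall>\<^sub>F w in nhds z. u w - - \<phi> w \<le> u z - - \<phi> z"
    using loc by (rule eventually_mono) simp
  ultimately have "- \<phi>t z \<le> F (- \<phi>x z)"
    using assms z unfolding visc_subsolution_def by blast
  then show "- F (- \<phi>x z) \<le> \<phi>t z" by simp
qed

lemma visc_subsolution_minus: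
  assumes "visc_supersolution F u"
  shows "visc_subsolution (\<lambda>p. - F (- p)) (\<lambda>z. - u z)"
  unfolding visc_subsolution_def
proof (intro allI impI ballI)
  fix \<phi> \<phi>t \<phi>x z
  assume \<phi>: "C1_test \<phi> \<phi>t \<phi>x" and z: "z \<in> {0::real<..} \<times> (UNIV :: real set)"
    and loc: "\<forall>\<^sub>F w in nhds z. - u w - \<phi> w \<le> - u z - \<phi> z"
  have "C1_test (\<lambda>z. - \<phi> z) (\<lambda>z. - \<phi>t z) (\<lambda>z. - \<phi>x z)"
    using \<phi> unfolding C1_test_def
    by (auto intro!: continuous_on_minus derivative_eq_intros simp: algebra_simps fun_eq_iff)
  moreover have "\<forall>\<^sub>F w in nhds z. u z - - \<phi> z \<le> u w - - \<phi> w"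
    using loc by (rule eventually_mono) simp
  ultimately have "F (- \<phi>x z) \<le> - \<phi>t z"
    using assms z unfolding visc_supersolution_def by blast
  then show "\<phi>t z \<le> - F (- \<phi>x z)" by simp
qed

text \<open>
  The exponential term keeps the minimum away from the top of the compact box and its derivative
  makes the differential inequality strict; no growth condition is needed because \<open>F\<close> is bounded.
\<close>
lemma visc_supersolution_time_lower_bound:
  assumes F: "\<And>p. - M \<le> F p" and M: "0 \<le> M" and cont: "continuous_on ({0..} \<times> UNIV) v"
    and super: "visc_supersolution F v" and t1: "0 \<le> t1"
  shows "v (0, x0) - M * t1 \<le> v (t1, x0)"
proof (rule ccontr)
  define \<sigma> where "\<sigma> = v (0, x0) - M * t1 - v (t1, x0)"
  assume "\<not> ?thesis"
  then have \<sigma>: "0 < \<sigma>" by (simp add: \<sigma>_def)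
  define S where "S = {0..t1 + 1} \<times> {x0 - 1..x0 + 1}"
  have S: "compact S" unfolding S_def by (intro compact_Times) auto
  have vS: "continuous_on S v" using cont by (rule continuous_on_subset) (auto simp: S_def)
  have "bounded (v ` S)" using S vS by (intro compact_imp_bounded compact_continuous_image)
  then obtain B where B: "0 < B" "\<And>z. z \<in> S \<Longrightarrow> \<bar>v z\<bar> \<le> B" unfolding bounded_pos by auto
  have "continuous_on UNIV (\<lambda>x. v (0, x))"
    by (intro continuous_on_compose2[OF cont] continuous_intros) auto
  then obtain \<rho>' where \<rho>': "0 < \<rho>'" "\<And>x. \<bar>x - x0\<bar> < \<rho>' \<Longrightarrow> \<bar>v (0, x) - v (0, x0)\<bar> < \<sigma> / 2"
    using \<sigma> unfolding continuous_on_iff dist_real_def by (metis UNIV_I half_gt_zero)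
  define \<rho> where "\<rho> = min \<rho>' 1"
  have \<rho>: "0 < \<rho>" "\<rho> \<le> 1" using \<rho>'(1) by (auto simp: \<rho>_def)
  have near: "v (0, x0) - \<sigma> / 2 < v (0, x)" if "\<bar>x - x0\<bar> < \<rho>" for x
  proof -
    have "\<bar>x - x0\<bar> < \<rho>'" using that by (simp add: \<rho>_def)
    from \<rho>'(2)[OF this] show ?thesis by linarith
  qed
  define A where "A = \<sigma> / 4"
  define k where "k = (2 * B + 1 + A) / A"
  define D where "D = (2 * B + 1 + M * t1 + A) / \<rho>\<^sup>2"
  have A: "0 < A" and k: "0 < k" and D0: "0 < D"
    using \<sigma> B M t1 \<rho> by (auto simp: A_def k_def D_def intro!: divide_pos_pos add_pos_nonneg)
  have D: "2 * B + 1 + M * t1 + A \<le> D * y\<^sup>2" if "\<rho> \<le> \<bar>y\<bar>" for y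
  proof -
    have "\<rho>\<^sup>2 \<le> y\<^sup>2" using that \<rho> power_mono[of \<rho> "\<bar>y\<bar>" 2] by simp
    then have "D * \<rho>\<^sup>2 \<le> D * y\<^sup>2" using D0 by (intro mult_left_mono) auto
    then show ?thesis using \<rho> by (simp add: D_def)
  qed
  define G where "G z = v z + M * fst z + A * exp (k * (fst z - t1)) + D * (snd z - x0)\<^sup>2" for z
  have "continuous_on S G" unfolding G_def by (intro continuous_intros vS)
  moreover have z1: "(t1, x0) \<in> S" using t1 by (simp add: S_def)
  ultimately obtain z where z: "z \<in> S" "\<And>w. w \<in> S \<Longrightarrow> G z \<le> G w"
    using continuous_attains_inf[OF S] by blast
  obtain t x where tx: "z = (t, x)" by (cases z)
  have "G (t1, x0) = v (t1, x0) + M * t1 + \<sigma> / 4" by (simp add: G_def A_def)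
  then have G1: "G (t1, x0) = v (0, x0) - 3 / 4 * \<sigma>" using \<sigma>_def by linarith
  have Gz: "G z \<le> v (0, x0) - 3 / 4 * \<sigma>" using z(2)[OF z1] G1 by simp
  have Gz': "G z \<le> B + M * t1 + A" using z(2)[OF z1] B(2)[OF z1] by (simp add: G_def)
  have tS: "0 \<le> t" "t \<le> t1 + 1" "\<bar>x - x0\<bar> \<le> 1" using z(1) by (auto simp: S_def tx abs_le_iff)
  have vz: "- B \<le> v z" using B(2)[OF z(1)] by simp
  have pos: "0 \<le> M * t" "0 < A * exp (k * (t - t1))" "0 \<le> D * (x - x0)\<^sup>2"
    using M tS A D0 by auto
  have lt: "\<bar>x - x0\<bar> < \<rho>"
  proof (rule ccontr)
    assume "\<not> ?thesis"
    then show False using D[of "x - x0"] Gz' vz pos B(1) by (simp add: G_def tx)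
  qed
  have t0: "0 < t"
  proof (rule ccontr)
    assume "\<not> 0 < t"
    then have "t = 0" using tS by simp
    then show False using near[OF lt] Gz pos \<sigma> by (simp add: G_def tx)
  qed
  have t_top: "t < t1 + 1"
  proof (rule ccontr)
    assume "\<not> t < t1 + 1"
    then have t: "t = t1 + 1" using tS by simp
    have "A * (1 + k) \<le> A * exp k" using A exp_ge_add_one_self[of k] by (intro mult_left_mono) auto
    moreover have "A * k = 2 * B + 1 + A" using A by (simp add: k_def)
    moreover have "M * t1 \<le> M * t" using t M by (simp add: algebra_simps)
    ultimately show False using Gz' vz pos B(1) A t by (simp add: G_def tx algebra_simps)
  qed
  define \<phi> where "\<phi> z = - (M * fst z + A * exp (k * (fst z - t1)) + D * (snd z - x0)\<^sup>2)" for z :: "real \<times> real"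
  define \<phi>t where "\<phi>t z = - (M + A * (k * exp (k * (fst z - t1))))" for z :: "real \<times> real"
  define \<phi>x where "\<phi>x z = - (D * (2 * (snd z - x0)))" for z :: "real \<times> real"
  have "C1_test \<phi> \<phi>t \<phi>x"
    unfolding C1_test_def \<phi>_def \<phi>t_def \<phi>x_def
    by (auto intro!: derivative_eq_intros continuous_intros simp: fun_eq_iff algebra_simps)
  moreover have "\<forall>\<^sub>F w in nhds z. v w - \<phi> w \<ge> v z - \<phi> z"
  proof (rule eventually_nhds_in_open[THEN eventually_mono])
    show "open ({0<..<t1 + 1} \<times> {x0 - 1<..<x0 + 1})" by (intro open_Times) auto
    show "z \<in> {0<..<t1 + 1} \<times> {x0 - 1<..<x0 + 1}" using t0 t_top lt \<rho>(2) by (auto simp: tx abs_less_iff)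
    fix w assume "w \<in> {0<..<t1 + 1} \<times> {x0 - 1<..<x0 + 1}"
    then have "w \<in> S" by (auto simp: S_def)
    then show "v w - \<phi> w \<ge> v z - \<phi> z" using z(2)[of w] by (simp add: G_def \<phi>_def)
  qed
  ultimately have "F (\<phi>x z) \<le> \<phi>t z"
    using super t0 unfolding visc_supersolution_def by (auto simp: tx)
  moreover have "\<phi>t z < - M" using A k by (simp add: \<phi>t_def)
  ultimately show False using F[of "\<phi>x z"] by simp
qed

text \<open>Shared test functions for the doubling argument: the subsolution side uses
  \<open>b = d = 0\<close>, the supersolution side four negative coefficients.\<close>

lemma C1_test_quadratic:
  "C1_test (\<lambda>z. a * (fst z - s)\<^sup>2 + b * (fst z + 1)\<^sup>2 + c * (snd z - y)\<^sup>2 + d * (snd z)\<^sup>2)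
     (\<lambda>z. 2 * a * (fst z - s) + 2 * b * (fst z + 1)) (\<lambda>z. 2 * c * (snd z - y) + 2 * d * snd z)"
  unfolding C1_test_def
  by (auto intro!: derivative_eq_intros continuous_intros simp: fun_eq_iff algebra_simps)

lemma quadratic_bound:
  fixes a k x :: real
  assumes "0 < k"
  shows "a * x - k * x\<^sup>2 \<le> a\<^sup>2 / (2 * k) - k / 2 * x\<^sup>2"
proof -
  have "0 \<le> (a - k * x)\<^sup>2 / (2 * k)" using assms by simp
  also have "\<dots> = a\<^sup>2 / (2 * k) - a * x + k / 2 * x\<^sup>2"
    using assms by (simp add: power2_eq_square field_simps)
  finally show ?thesis by (simp add: algebra_simps)
qed

text \<open>
  Doubling of variables. Both penalizations at infinity are attached to the variables of \<open>v\<close>, so that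
  comparing the maximum point \<open>(z, w)\<close> with \<open>(w, w)\<close> bounds \<open>\<kappa> * dist z w\<close> by the Lipschitz constant of \<open>u\<close>.
\<close>
lemma visc_comparison:
  assumes F: "continuous_on UNIV F"
    and ulip: "K-lipschitz_on ({0..} \<times> UNIV) u" and sub: "visc_subsolution F u"
    and vcont: "continuous_on ({0..} \<times> UNIV) v" and super: "visc_supersolution F v"
    and init: "\<And>s y. 0 \<le> s \<Longrightarrow> u (0, y) - C * s \<le> v (s, y)"
    and t1: "0 \<le> t1"
  shows "u (t1, x1) \<le> v (t1, x1)"
proof (rule ccontr)
  define Q where "Q = {0::real..} \<times> (UNIV :: real set)"
  define d0 where "d0 = u (t1, x1) - v (t1, x1)"
  assume "\<not> ?thesis"
  then have d0: "0 < d0" by (simp add: d0_def)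
  have K: "0 \<le> K" using ulip by (rule lipschitz_on_nonneg)
  have ucont: "continuous_on Q u" unfolding Q_def by (rule lipschitz_on_continuous_on[OF ulip])
  have uK: "u z - u w \<le> K * dist z w" if "z \<in> Q" "w \<in> Q" for z w
    using lipschitz_onD[OF ulip, of z w] that by (auto simp: Q_def dist_real_def abs_le_iff)
  define c where "c = K + \<bar>C\<bar>"
  have c: "0 \<le> c" using K by (simp add: c_def)
  have init': "u (0, y) - \<bar>C\<bar> * s \<le> v (s, y)" if "0 \<le> s" for s y
    using init[OF that, of y] mult_right_mono[OF abs_ge_self[of C] that] by linarith
  have uv: "u w - v w \<le> c * fst w" if "w \<in> Q" for w
  proof -
    obtain s y where w: "w = (s, y)" "0 \<le> s" using \<open>w \<in> Q\<close> by (auto simp: Q_def)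
    have "u w - u (0, y) \<le> K * s" using uK[of w "(0, y)"] w by (simp add: Q_def dist_prod_def)
    then show ?thesis using init'[OF w(2), of y] w by (simp add: c_def algebra_simps)
  qed
  \<comment> \<open>The time penalty spends a quarter of the gap \<open>d0\<close> at
    \<open>t1\<close>. The shift in \<open>(fst w + 1)\<^sup>2\<close> keeps its derivative
    \<open>2 * \<beta> * (s + 1)\<close> at least 2\<beta> even for small \<open>s\<close>; this
    strict gain has to beat the oscillation of \<open>F\<close> between the two slopes.\<close>
  define \<beta> where "\<beta> = d0 / (4 * (1 + t1)\<^sup>2)"
  have \<beta>: "0 < \<beta>" using d0 t1 by (simp add: \<beta>_def)
  have "uniformly_continuous_on {- (2 * K + 1)..2 * K + 1} F"
    using F by (intro compact_uniformly_continuous) (auto intro: continuous_on_subset)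
  then have "\<exists>d>0. \<forall>p\<in>{- (2 * K + 1)..2 * K + 1}. \<forall>q\<in>{- (2 * K + 1)..2 * K + 1}.
      dist q p < d \<longrightarrow> dist (F q) (F p) < 2 * \<beta>"
    using \<beta> unfolding uniformly_continuous_on_def by (elim allE[of _ "2 * \<beta>"]) simp
  then obtain \<rho>' where \<rho>'0: "0 < \<rho>'" and "\<And>p q. p \<in> {- (2 * K + 1)..2 * K + 1} \<Longrightarrow>
      q \<in> {- (2 * K + 1)..2 * K + 1} \<Longrightarrow> dist q p < \<rho>' \<Longrightarrow> dist (F q) (F p) < 2 * \<beta>"
    by blast
  then have \<rho>': "\<bar>F q - F p\<bar> < 2 * \<beta>" if "\<bar>p\<bar> \<le> 2 * K + 1" "\<bar>q\<bar> \<le> 2 * K + 1" "\<bar>q - p\<bar> < \<rho>'" for p q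
    using that by (simp add: dist_real_def abs_le_iff)
  define \<rho> where "\<rho> = min \<rho>' 1"
  have \<rho>: "0 < \<rho>" "\<rho> \<le> 1" "\<rho> \<le> \<rho>'" using \<rho>'0 by (auto simp: \<rho>_def)
  \<comment> \<open>Large enough that \<open>c * (K / \<kappa>) < d0 / 2\<close>: the two maximum
    points are then too close for either of them to lie at time 0.\<close>
  define \<kappa> where "\<kappa> = 2 * c * K / d0 + 1"
  have \<kappa>: "0 < \<kappa>" using c K d0 by (simp add: \<kappa>_def add_nonneg_pos)
  have \<kappa>c: "c * (K / \<kappa>) < d0 / 2"
  proof -
    have "c * K < d0 / 2 * \<kappa>" using d0 by (simp add: \<kappa>_def algebra_simps)
    then show ?thesis using \<kappa> by (simp add: divide_less_eq)
  qed
  \<comment> \<open>\<open>E\<close> bounds all penalties wherever \<Phi> is nonnegative. It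
    involves \<kappa> and \<beta> only, so \<alpha> may be chosen afterwards:
    \<open>(2 * \<alpha> * y)\<^sup>2 \<le> 4 * \<alpha> * E\<close> keeps the slopes
    \<open>p\<close> and \<open>q\<close> within \<rho> of each other.\<close>
  define E where "E = K\<^sup>2 / (2 * \<kappa>) + c\<^sup>2 / (2 * \<beta>)"
  have E: "0 \<le> E" using \<kappa> \<beta> by (simp add: E_def)
  define \<alpha> where "\<alpha> = min (d0 / (4 * (1 + x1\<^sup>2))) (\<rho>\<^sup>2 / (8 * (E + 1)))"
  have \<alpha>: "0 < \<alpha>" using d0 \<rho> E by (simp add: \<alpha>_def add_pos_nonneg)
  have \<alpha>x1: "\<alpha> * x1\<^sup>2 \<le> d0 / 4"
  proof -
    have "\<alpha> * x1\<^sup>2 \<le> \<alpha> * (1 + x1\<^sup>2)" using \<alpha> by simp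
    also have "\<dots> \<le> d0 / (4 * (1 + x1\<^sup>2)) * (1 + x1\<^sup>2)"
      by (intro mult_right_mono) (auto simp: \<alpha>_def)
    also have "\<dots> = d0 / 4" by (simp add: add_pos_nonneg divide_simps add_nonneg_eq_0_iff)
    finally show ?thesis .
  qed
  have \<alpha>E: "4 * \<alpha> * E < \<rho>\<^sup>2"
  proof -
    have "4 * \<alpha> * E \<le> 4 * \<alpha> * (E + 1)" using \<alpha> by simp
    also have "\<dots> \<le> 4 * (\<rho>\<^sup>2 / (8 * (E + 1))) * (E + 1)"
      using E by (intro mult_right_mono mult_left_mono) (auto simp: \<alpha>_def)
    also have "\<dots> = \<rho>\<^sup>2 / 2" using E by (simp add: divide_simps)
    also have "\<dots> < \<rho>\<^sup>2" using \<rho> by simp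
    finally show ?thesis .
  qed
  define \<Phi> where "\<Phi> z w = u z - v w - \<kappa> * (dist z w)\<^sup>2 - \<beta> * (fst w + 1)\<^sup>2 - \<alpha> * (snd w)\<^sup>2" for z w
  have coercive: "\<kappa> / 2 * (dist z w)\<^sup>2 + \<beta> / 2 * (fst w)\<^sup>2 + \<alpha> * (snd w)\<^sup>2 \<le> E"
    if "z \<in> Q" "w \<in> Q" "0 \<le> \<Phi> z w" for z w
  proof -
    have "u z - v w \<le> K * dist z w + c * fst w" using uK[OF that(1,2)] uv[OF that(2)] by simp
    moreover have "\<beta> * (fst w)\<^sup>2 \<le> \<beta> * (fst w + 1)\<^sup>2"
      using \<beta> that(2) by (intro mult_left_mono power_mono) (auto simp: Q_def)
    ultimately have "\<alpha> * (snd w)\<^sup>2 \<le> (K * dist z w - \<kappa> * (dist z w)\<^sup>2) + (c * fst w - \<beta> * (fst w)\<^sup>2)"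
      using that(3) by (simp add: \<Phi>_def)
    also have "\<dots> \<le> (K\<^sup>2 / (2 * \<kappa>) - \<kappa> / 2 * (dist z w)\<^sup>2) + (c\<^sup>2 / (2 * \<beta>) - \<beta> / 2 * (fst w)\<^sup>2)"
      by (intro add_mono quadratic_bound \<kappa> \<beta>)
    finally show ?thesis by (simp add: E_def)
  qed
  define R where "R = 1 + 2 * E / \<kappa> + 2 * E / \<beta> + E / \<alpha>"
  have sq: "\<bar>x\<bar> \<le> 1 + b" if "x\<^sup>2 \<le> b" for x b :: real
  proof -
    have "0 \<le> (\<bar>x\<bar> - 1 / 2)\<^sup>2" by simp
    then have "\<bar>x\<bar> \<le> x\<^sup>2 + 1 / 4" by (simp add: power2_eq_square algebra_simps)
    then show ?thesis using that by linarith
  qed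
  have box: "dist z w \<le> R" "fst w \<le> R" "\<bar>snd w\<bar> \<le> R" if "z \<in> Q" "w \<in> Q" "0 \<le> \<Phi> z w" for z w
  proof -
    have n: "0 \<le> \<kappa> / 2 * (dist z w)\<^sup>2" "0 \<le> \<beta> / 2 * (fst w)\<^sup>2" "0 \<le> \<alpha> * (snd w)\<^sup>2"
      using \<kappa> \<beta> \<alpha> by auto
    have q: "0 \<le> 2 * E / \<kappa>" "0 \<le> 2 * E / \<beta>" "0 \<le> E / \<alpha>" using \<kappa> \<beta> \<alpha> E by auto
    have "(dist z w)\<^sup>2 \<le> 2 * E / \<kappa>" "(fst w)\<^sup>2 \<le> 2 * E / \<beta>" "(snd w)\<^sup>2 \<le> E / \<alpha>"
    proof -
      have "\<kappa> / 2 * (dist z w)\<^sup>2 \<le> E" "\<beta> / 2 * (fst w)\<^sup>2 \<le> E" "\<alpha> * (snd w)\<^sup>2 \<le> E"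
        using coercive[OF that] n by linarith+
      then show "(dist z w)\<^sup>2 \<le> 2 * E / \<kappa>" "(fst w)\<^sup>2 \<le> 2 * E / \<beta>" "(snd w)\<^sup>2 \<le> E / \<alpha>"
        using \<kappa> \<beta> \<alpha> by (simp_all add: field_simps)
    qed
    then show "dist z w \<le> R" "fst w \<le> R" "\<bar>snd w\<bar> \<le> R"
      using q sq unfolding R_def by (smt (verit))+
  qed
  define S where "S = ({0..2 * R} \<times> {- 2 * R..2 * R}) \<times> ({0..2 * R} \<times> {- 2 * R..2 * R})"
  have S: "compact S" unfolding S_def by (intro compact_Times) auto
  have SQ: "S \<subseteq> Q \<times> Q" by (auto simp: S_def Q_def)
  have inS: "(z, w) \<in> S" if "z \<in> Q" "w \<in> Q" "0 \<le> \<Phi> z w" for z w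
  proof -
    have "\<bar>fst z - fst w\<bar> \<le> dist z w" "\<bar>snd z - snd w\<bar> \<le> dist z w"
      using dist_fst_le[of z w] dist_snd_le[of z w] by (auto simp: dist_real_def)
    then show ?thesis using box[OF that] that(1,2) by (cases z, cases w) (auto simp: S_def Q_def abs_le_iff)
  qed
  have \<Phi>1: "d0 / 2 \<le> \<Phi> (t1, x1) (t1, x1)"
  proof -
    have "\<beta> * (t1 + 1)\<^sup>2 = d0 / 4" using t1 by (simp add: \<beta>_def add.commute)
    then show ?thesis using \<alpha>x1 by (simp add: \<Phi>_def d0_def)
  qed
  have z1: "(t1, x1) \<in> Q" using t1 by (simp add: Q_def)
  have "continuous_on S (\<lambda>zw. \<Phi> (fst zw) (snd zw))"
    unfolding \<Phi>_def
    by (intro continuous_intros continuous_on_compose2[OF ucont] continuous_on_compose2[OF vcont])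
      (use SQ in \<open>auto simp: Q_def\<close>)
  moreover have z1S: "((t1, x1), (t1, x1)) \<in> S" using inS[OF z1 z1] \<Phi>1 d0 by simp
  ultimately obtain zw where zw: "zw \<in> S" "\<And>y. y \<in> S \<Longrightarrow> \<Phi> (fst y) (snd y) \<le> \<Phi> (fst zw) (snd zw)"
    using continuous_attains_sup[OF S] by blast
  obtain z w where zw_eq: "zw = (z, w)" by (cases zw)
  have zQ: "z \<in> Q" and wQ: "w \<in> Q" using zw SQ zw_eq by auto
  have \<Phi>zw: "d0 / 2 \<le> \<Phi> z w" using zw(2)[OF z1S] \<Phi>1 zw_eq by simp
  have max: "\<Phi> z' w' \<le> \<Phi> z w" if "z' \<in> Q" "w' \<in> Q" for z' w'
  proof (cases "0 \<le> \<Phi> z' w'")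
    case True
    then show ?thesis using zw(2)[OF inS[OF that]] zw_eq by simp
  qed (use \<Phi>zw d0 in simp)
  obtain t x s y where tx: "z = (t, x)" and sy: "w = (s, y)" by (cases z, cases w)
  have ts: "0 \<le> t" "0 \<le> s" using zQ wQ by (auto simp: tx sy Q_def)
  have dK: "\<kappa> * dist z w \<le> K"
  proof (cases "dist z w = 0")
    case False
    have "\<kappa> * (dist z w)\<^sup>2 \<le> K * dist z w" using max[OF wQ wQ] uK[OF zQ wQ] by (simp add: \<Phi>_def)
    then have "\<kappa> * dist z w * dist z w \<le> K * dist z w" by (simp add: power2_eq_square mult_ac)
    then show ?thesis using False by (simp add: mult_le_cancel_right)
  qed (use K in simp)
  then have d: "dist z w \<le> K / \<kappa>" using \<kappa> by (simp add: field_simps)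
  have comp: "\<bar>t - s\<bar> \<le> dist z w" "\<bar>x - y\<bar> \<le> dist z w"
    using dist_fst_le[of z w] dist_snd_le[of z w] by (auto simp: dist_real_def tx sy)
  have cd: "c * dist z w < d0 / 2"
    using mult_left_mono[OF d c] \<kappa>c by linarith
  have Kc: "K * dist z w \<le> c * dist z w" "(K + \<bar>C\<bar>) * dist z w = c * dist z w"
    by (auto simp: c_def mult_right_mono)
  have "0 \<le> \<kappa> * (dist z w)\<^sup>2" "0 \<le> \<beta> * (fst w + 1)\<^sup>2" "0 \<le> \<alpha> * (snd w)\<^sup>2"
    using \<kappa> \<beta> \<alpha> by auto
  then have \<Phi>le: "\<Phi> z w \<le> u z - v w" unfolding \<Phi>_def by linarith
  have s0: "0 < s"
  proof (rule ccontr)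
    assume "\<not> 0 < s"
    then have "s = 0" using ts by simp
    then have "u z - v w \<le> K * dist z w" using uK[OF zQ wQ] uv[OF wQ] by (simp add: sy)
    then show False using \<Phi>zw \<Phi>le cd Kc by linarith
  qed
  \<comment> \<open>If \<open>t = 0\<close>, then \<open>s \<le> dist z w\<close>, so the initial
    lower bound on \<open>v\<close> loses at most \<open>\<bar>C\<bar> * dist z w\<close>.\<close>
  have t0: "0 < t"
  proof (rule ccontr)
    assume "\<not> 0 < t"
    then have t: "t = 0" using ts by simp
    have "u z - u (0, y) \<le> K * dist z (0, y)" using zQ by (intro uK) (auto simp: Q_def)
    also have "dist z (0, y) \<le> dist z w" using comp by (simp add: tx t dist_prod_def dist_real_def)
    then have "K * dist z (0, y) \<le> K * dist z w" using K by (rule mult_left_mono)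
    finally have "u z - v w \<le> K * dist z w + \<bar>C\<bar> * s" using init'[OF ts(2), of y] by (simp add: sy)
    also have "\<bar>C\<bar> * s \<le> \<bar>C\<bar> * dist z w" using comp t s0 by (intro mult_left_mono) auto
    finally have "u z - v w \<le> c * dist z w" by (simp add: c_def algebra_simps)
    then show False using \<Phi>zw \<Phi>le cd by linarith
  qed
  have dist2: "(dist a b)\<^sup>2 = (fst a - fst b)\<^sup>2 + (snd a - snd b)\<^sup>2" for a b :: "real \<times> real"
    by (simp add: dist_prod_def dist_real_def)
  have pos: "\<forall>\<^sub>F z' in nhds a. z' \<in> Q" if "0 < fst a" for a :: "real \<times> real"
  proof (rule eventually_nhds_in_open[THEN eventually_mono])
    show "open ({0::real<..} \<times> (UNIV :: real set))" by (intro open_Times) auto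
  qed (use that in \<open>auto simp: Q_def mem_Times_iff\<close>)
  define p where "p = 2 * \<kappa> * (x - y)"
  define q where "q = p - 2 * \<alpha> * y"
  have tsF: "2 * \<kappa> * (t - s) \<le> F p"
  proof -
    have "\<forall>\<^sub>F z' in nhds z. u z' - (\<kappa> * (fst z' - s)\<^sup>2 + 0 * (fst z' + 1)\<^sup>2 + \<kappa> * (snd z' - y)\<^sup>2 + 0 * (snd z')\<^sup>2)
        \<le> u z - (\<kappa> * (fst z - s)\<^sup>2 + 0 * (fst z + 1)\<^sup>2 + \<kappa> * (snd z - y)\<^sup>2 + 0 * (snd z)\<^sup>2)"
    proof (rule pos[THEN eventually_mono])
      fix z' assume "z' \<in> Q"
      then show "u z' - (\<kappa> * (fst z' - s)\<^sup>2 + 0 * (fst z' + 1)\<^sup>2 + \<kappa> * (snd z' - y)\<^sup>2 + 0 * (snd z')\<^sup>2)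
        \<le> u z - (\<kappa> * (fst z - s)\<^sup>2 + 0 * (fst z + 1)\<^sup>2 + \<kappa> * (snd z - y)\<^sup>2 + 0 * (snd z)\<^sup>2)"
        using max[of z' w] wQ by (simp add: \<Phi>_def dist2 sy algebra_simps)
    qed (use t0 in \<open>simp add: tx\<close>)
    from sub[unfolded visc_subsolution_def, rule_format, OF C1_test_quadratic _ this]
    show ?thesis using t0 by (simp add: tx p_def)
  qed
  have \<Phi>z: "\<Phi> z w' = u z - v w' - \<kappa> * ((fst w' - t)\<^sup>2 + (snd w' - x)\<^sup>2) - \<beta> * (fst w' + 1)\<^sup>2 - \<alpha> * (snd w')\<^sup>2" for w'
    by (simp add: \<Phi>_def dist2 tx power2_commute[of t] power2_commute[of x])
  have tsF': "F q \<le> 2 * \<kappa> * (t - s) - 2 * \<beta> * (s + 1)"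
  proof -
    have "\<forall>\<^sub>F w' in nhds w. v w' - (- \<kappa> * (fst w' - t)\<^sup>2 + - \<beta> * (fst w' + 1)\<^sup>2 + - \<kappa> * (snd w' - x)\<^sup>2 + - \<alpha> * (snd w')\<^sup>2)
        \<ge> v w - (- \<kappa> * (fst w - t)\<^sup>2 + - \<beta> * (fst w + 1)\<^sup>2 + - \<kappa> * (snd w - x)\<^sup>2 + - \<alpha> * (snd w)\<^sup>2)"
    proof (rule pos[THEN eventually_mono])
      fix w' assume "w' \<in> Q"
      then show "v w' - (- \<kappa> * (fst w' - t)\<^sup>2 + - \<beta> * (fst w' + 1)\<^sup>2 + - \<kappa> * (snd w' - x)\<^sup>2 + - \<alpha> * (snd w')\<^sup>2)
        \<ge> v w - (- \<kappa> * (fst w - t)\<^sup>2 + - \<beta> * (fst w + 1)\<^sup>2 + - \<kappa> * (snd w - x)\<^sup>2 + - \<alpha> * (snd w)\<^sup>2)"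
        using max[of z w'] zQ unfolding \<Phi>z by (simp add: algebra_simps)
    qed (use s0 in \<open>simp add: sy\<close>)
    from super[unfolded visc_supersolution_def, rule_format, OF C1_test_quadratic _ this]
    show ?thesis using s0 by (simp add: sy q_def p_def algebra_simps)
  qed
  have "\<bar>p\<bar> \<le> 2 * K"
  proof -
    have "\<kappa> * \<bar>x - y\<bar> \<le> \<kappa> * dist z w" using \<kappa> by (intro mult_left_mono comp(2)) simp
    then have "\<kappa> * \<bar>x - y\<bar> \<le> K" using dK by linarith
    then show ?thesis using \<kappa> by (simp add: p_def abs_mult)
  qed
  moreover have "\<bar>q - p\<bar> < \<rho>"
  proof -
    have "\<alpha> * y\<^sup>2 \<le> E"
    proof -
      have "0 \<le> \<kappa> / 2 * (dist z w)\<^sup>2" "0 \<le> \<beta> / 2 * (fst w)\<^sup>2" using \<kappa> \<beta> by auto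
      then show ?thesis using coercive[OF zQ wQ] \<Phi>zw d0 by (simp add: sy)
    qed
    then have "4 * \<alpha> * (\<alpha> * y\<^sup>2) \<le> 4 * \<alpha> * E" using \<alpha> by (intro mult_left_mono) auto
    then have "\<bar>2 * \<alpha> * y\<bar>\<^sup>2 < \<rho>\<^sup>2" using \<alpha>E by (simp add: power2_eq_square mult_ac)
    then have "\<bar>2 * \<alpha> * y\<bar> < \<rho>" using \<rho>(1) by (rule_tac power2_less_imp_less) auto
    then show ?thesis by (simp add: q_def)
  qed
  ultimately have "\<bar>F q - F p\<bar> < 2 * \<beta>" using \<rho> by (intro \<rho>') auto
  moreover have "0 \<le> 2 * \<beta> * s" using \<beta> s0 by simp
  ultimately show False using tsF tsF' by (simp add: algebra_simps abs_less_iff)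
qed

section \<open>Upper limits and homogenization\<close>

text \<open>A barrier of initial size \<open>exp (- 40 * T)\<close> is of order 1 at time
  \<open>T\<close>. Beyond distance 80 T it dominates the linear spread \<open>D * r\<close> from
  the start, because there \<open>exp (r - 40 * T) \<ge> exp (r / 2) \<ge> r\<close>; hence the
  window in \<open>near\<close>. The final constant is the sum of \<open>C\<close>, the barrier
  height \<open>D\<close>, the velocity margin \<open>M\<close> and 1 for rounding.\<close>

lemma FK_below_planar:
  assumes \<alpha>: "20 \<le> \<alpha>" and F: "planar_mean_velocity \<alpha> L C F"
    and sys: "FK_system \<alpha> L U X" and UX: "\<And>i. X i 0 = U i 0"
    and lip: "\<And>i j. \<bar>U (i + j) 0 - U i 0\<bar> \<le> K * \<bar>of_int j\<bar>"
    and near: "\<And>i. \<bar>of_int i\<bar> \<le> 80 * T \<Longrightarrow> U (i + k) s \<le> p * of_int i + b"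
    and s: "0 \<le> s" and T: "0 < T"
  shows "U k (s + T) \<le> F p * T + b + (C + 3 * K + 5 + \<bar>L\<bar> + \<bar>p\<bar>)"
proof -
  obtain P Q where P: "FK_system \<alpha> L P Q" "\<And>i. P i 0 = p * of_int i" "\<And>i. Q i 0 = p * of_int i"
    using FK_planar_exists[of \<alpha> L p] \<alpha> by auto
  have K: "0 \<le> K" using lip[of 0 1] by simp
  define D where "D = K + 1 + \<bar>p\<bar>"
  define B where "B = D * exp (- 40 * T)"
  define M where "M = 2 * K + 3 + \<bar>L\<bar>"
  \<comment> \<open>The planar solution may be raised only by an integer, and it must also lie above
    \<open>X\<close>, which exceeds \<open>U\<close> by up to \<open>M\<close> at the restart
    time.\<close>
  define n where "n = \<lceil>b + M\<rceil>"
  have D: "0 \<le> D" using K by (simp add: D_def)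
  then have B: "0 \<le> B" by (simp add: B_def)
  have Ule: "U (i + k) s \<le> p * of_int i + b + B * exp \<bar>of_int i\<bar>" for i
  proof (cases "\<bar>of_int i\<bar> \<le> 80 * T")
    case True
    then show ?thesis using near[of i] mult_nonneg_nonneg[OF B, of "exp \<bar>of_int i\<bar>"] by simp
  next
    case False
    define r where "r = \<bar>of_int i :: real\<bar>"
    have "i \<noteq> 0" using False T by auto
    then have r1: "1 \<le> r" unfolding r_def by linarith
    have "\<bar>U (k + i) s - U k s - 0\<bar> \<le> K * r + 1"
      unfolding r_def by (rule FK_spread[OF \<alpha> sys UX _ s]) (use lip in simp)
    moreover have "U k s \<le> b" using near[of 0] T by simp
    moreover have "- p * of_int i \<le> \<bar>p\<bar> * r"
      unfolding r_def by (metis abs_ge_self abs_minus_cancel abs_mult)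
    ultimately have "U (i + k) s \<le> p * of_int i + b + (K * r + \<bar>p\<bar> * r + r)"
      using r1 by (simp add: add.commute abs_le_iff)
    also have "K * r + \<bar>p\<bar> * r + r = D * r" by (simp add: D_def algebra_simps)
    also have "r \<le> exp (r - 40 * T)"
    proof -
      have "0 \<le> (r / 2 - 1)\<^sup>2" by simp
      then have "r \<le> 1 + r / 2 + (r / 2)\<^sup>2 / 2" by (simp add: power2_eq_square algebra_simps)
      also have "\<dots> \<le> exp (r / 2)" using r1 by (intro exp_lower_Taylor_quadratic) simp
      also have "\<dots> \<le> exp (r - 40 * T)" using False by (simp add: r_def)
      finally show ?thesis .
    qed
    then have "D * r \<le> D * exp (r - 40 * T)" using D by (rule mult_left_mono)
    also have "\<dots> = B * exp \<bar>of_int i\<bar>" by (simp add: B_def r_def exp_diff exp_minus field_simps)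
    finally show ?thesis by simp
  qed
  have Xle: "X (i + k) s \<le> p * of_int i + b + M + B * exp \<bar>of_int i\<bar>" for i
    using FK_velocity(1)[OF \<alpha> sys, of 0 K s "i + k"] Ule[of i] lip[of _ 1] UX s
    by (simp add: M_def abs_le_iff)
  have late: "FK_system \<alpha> L (\<lambda>i \<tau>. U (i + k) (\<tau> + s)) (\<lambda>i \<tau>. X (i + k) (\<tau> + s))"
    using FK_system_shift[OF sys s, of k 0] by simp
  have up: "FK_system \<alpha> L (\<lambda>i \<tau>. P i \<tau> + of_int n) (\<lambda>i \<tau>. Q i \<tau> + of_int n)"
    using FK_system_shift[OF P(1) order.refl, of 0 n] by simp
  have n: "b + M \<le> of_int n" "of_int n \<le> b + M + 1" unfolding n_def by linarith+
  have M: "0 \<le> M" using K by (simp add: M_def)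
  have "U (0 + k) (T + s) \<le> (P 0 T + of_int n) + B * exp (40 * T + \<bar>of_int 0 - of_int 0\<bar>)"
  proof (rule FK_comparison[OF \<alpha> late up B, THEN conjunct1])
    fix i
    show "U (i + k) (0 + s) \<le> P i 0 + of_int n + B * exp \<bar>of_int i - of_int 0\<bar>"
      using Ule[of i] n(1) M P(2)[of i] by simp
    show "X (i + k) (0 + s) \<le> Q i 0 + of_int n + B * exp \<bar>of_int i - of_int 0\<bar>"
      using Xle[of i] n(1) P(3)[of i] by simp
  qed (use T in simp)
  moreover have "B * exp (40 * T) = D" by (simp add: B_def exp_minus)
  moreover have "\<bar>P 0 T - F p * T\<bar> \<le> C" using planar_mean_velocityD[OF F P] T by simp
  ultimately show ?thesis using n(2) by (simp add: M_def D_def add.commute abs_le_iff)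
qed

section \<open>Upper limits of families of functions\<close>

definition upper_lim :: "'a filter \<Rightarrow> ('a \<Rightarrow> real) \<Rightarrow> real" where
  "upper_lim G f = Inf {c. \<forall>\<^sub>F x in G. f x \<le> c}"

text \<open>The eventual bound \<open>B\<close> makes the set of eventual upper bounds bounded
  below, so that its infimum in the reals is meaningful.\<close>

lemma upper_lim_least:
  assumes "G \<noteq> bot" "\<forall>\<^sub>F x in G. \<bar>f x\<bar> \<le> B" "\<forall>\<^sub>F x in G. f x \<le> c"
  shows "upper_lim G f \<le> c"
  unfolding upper_lim_def
proof (rule cInf_lower)
  show "bdd_below {c. \<forall>\<^sub>F x in G. f x \<le> c}"
  proof (rule bdd_belowI[of _ "- B"])
    fix c assume "c \<in> {c. \<forall>\<^sub>F x in G. f x \<le> c}"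
    with assms(2) have "\<forall>\<^sub>F x in G. - B \<le> c" by (auto elim: eventually_elim2)
    then show "- B \<le> c" using assms(1) by simp
  qed
qed (use assms in simp)

lemma upper_lim_greatest:
  assumes "G \<noteq> bot" "\<forall>\<^sub>F x in G. \<bar>f x\<bar> \<le> B" "\<forall>\<^sub>F x in G. c \<le> f x"
  shows "c \<le> upper_lim G f"
  unfolding upper_lim_def
proof (rule cInf_greatest)
  show "{c. \<forall>\<^sub>F x in G. f x \<le> c} \<noteq> {}"
    using assms(2) by (auto intro!: exI[of _ B] elim: eventually_mono)
  fix d assume "d \<in> {c. \<forall>\<^sub>F x in G. f x \<le> c}"
  with assms(3) have "\<forall>\<^sub>F x in G. c \<le> d" by (auto elim: eventually_elim2)
  then show "c \<le> d" using assms(1) by simp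
qed

lemma upper_lim_eventually_less:
  assumes "\<forall>\<^sub>F x in G. \<bar>f x\<bar> \<le> B" "0 < e"
  shows "\<forall>\<^sub>F x in G. f x < upper_lim G f + e"
proof -
  have "{c. \<forall>\<^sub>F x in G. f x \<le> c} \<noteq> {}"
    using assms(1) by (auto intro!: exI[of _ B] elim: eventually_mono)
  then obtain c where "\<forall>\<^sub>F x in G. f x \<le> c" "c < upper_lim G f + e"
    using cInf_lessD[of "{c. \<forall>\<^sub>F x in G. f x \<le> c}" "upper_lim G f + e"] assms(2)
    unfolding upper_lim_def by auto
  then show ?thesis by (auto elim: eventually_mono)
qed

lemma eventually_at_right_0_less:
  fixes a :: real
  assumes "0 < a"
  shows "\<forall>\<^sub>F \<epsilon> in at_right 0. 0 < \<epsilon> \<and> \<epsilon> < a"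
  using assms by (auto simp: eventually_at_right_field)

text \<open>The family \<open>r\<close> consists of step functions in \<open>x\<close>, so it is Lipschitz only up to an error \<open>K * \<epsilon>\<close>.\<close>
definition approx_lipschitz :: "real \<Rightarrow> (real \<Rightarrow> real) \<Rightarrow> (real \<Rightarrow> real \<times> real \<Rightarrow> real) \<Rightarrow> bool" where
  "approx_lipschitz K u0 r \<longleftrightarrow> 0 \<le> K \<and>
     (\<forall>\<epsilon>>0. (\<forall>z\<in>{0..} \<times> UNIV. \<forall>w\<in>{0..} \<times> UNIV. \<bar>r \<epsilon> z - r \<epsilon> w\<bar> \<le> K * (dist z w + \<epsilon>)) \<and>
             (\<forall>x. \<bar>r \<epsilon> (0, x) - u0 x\<bar> \<le> K * \<epsilon>))"

lemma approx_lipschitzD: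
  assumes "approx_lipschitz K u0 r"
  shows "0 \<le> K"
    "0 < \<epsilon> \<Longrightarrow> z \<in> {0..} \<times> UNIV \<Longrightarrow> w \<in> {0..} \<times> UNIV \<Longrightarrow> \<bar>r \<epsilon> z - r \<epsilon> w\<bar> \<le> K * (dist z w + \<epsilon>)"
    "0 < \<epsilon> \<Longrightarrow> \<bar>r \<epsilon> (0, x) - u0 x\<bar> \<le> K * \<epsilon>"
  using assms unfolding approx_lipschitz_def by blast+

lemma approx_lipschitz_minus:
  "approx_lipschitz K u0 r \<Longrightarrow> approx_lipschitz K (\<lambda>x. - u0 x) (\<lambda>\<epsilon> z. - r \<epsilon> z)"
  unfolding approx_lipschitz_def by (auto simp: abs_minus_commute)

lemma approx_lipschitz_bounded:
  assumes r: "approx_lipschitz K u0 r" and z: "z \<in> {0..} \<times> UNIV"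
  shows "\<exists>B. \<forall>\<^sub>F \<epsilon> in at_right 0. \<bar>r \<epsilon> z\<bar> \<le> B"
proof -
  note D = approx_lipschitzD[OF r]
  have "\<forall>\<^sub>F \<epsilon> in at_right 0. \<bar>r \<epsilon> z\<bar> \<le> \<bar>u0 (snd z)\<bar> + K * (dist z (0, snd z) + 2)"
    using eventually_at_right_0_less[of 1, simplified]
  proof (rule eventually_mono)
    fix \<epsilon> :: real assume \<epsilon>: "0 < \<epsilon> \<and> \<epsilon> < 1"
    have "\<bar>r \<epsilon> z - r \<epsilon> (0, snd z)\<bar> \<le> K * (dist z (0, snd z) + \<epsilon>)" using D(2)[of \<epsilon> z "(0, snd z)"] \<epsilon> z by auto
    moreover have "\<bar>r \<epsilon> (0, snd z) - u0 (snd z)\<bar> \<le> K * \<epsilon>" using D(3) \<epsilon> by auto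
    moreover have "K * \<epsilon> \<le> K * 1" using D(1) \<epsilon> by (intro mult_left_mono) auto
    ultimately show "\<bar>r \<epsilon> z\<bar> \<le> \<bar>u0 (snd z)\<bar> + K * (dist z (0, snd z) + 2)"
      by (simp add: algebra_simps abs_le_iff) linarith
  qed
  then show ?thesis by blast
qed

lemma upper_lim_lipschitz:
  assumes r: "approx_lipschitz K u0 r"
  shows "K-lipschitz_on ({0..} \<times> UNIV) (\<lambda>z. upper_lim (at_right 0) (\<lambda>\<epsilon>. r \<epsilon> z))"
proof -
  note D = approx_lipschitzD[OF r]
  let ?u = "\<lambda>z. upper_lim (at_right 0) (\<lambda>\<epsilon>. r \<epsilon> z)"
  have le: "?u z \<le> ?u w + K * dist z w" if zw: "z \<in> {0..} \<times> UNIV" "w \<in> {0..} \<times> UNIV" for z w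
  proof (rule field_le_epsilon)
    fix e :: real assume e: "0 < e"
    obtain B where B: "\<forall>\<^sub>F \<epsilon> in at_right 0. \<bar>r \<epsilon> z\<bar> \<le> B" using approx_lipschitz_bounded[OF r zw(1)] by blast
    obtain B' where B': "\<forall>\<^sub>F \<epsilon> in at_right 0. \<bar>r \<epsilon> w\<bar> \<le> B'" using approx_lipschitz_bounded[OF r zw(2)] by blast
    define a where "a = e / 2 / (K + 1)"
    have a: "0 < a" "K * a \<le> e / 2" using e D(1) by (auto simp: a_def field_simps)
    have "\<forall>\<^sub>F \<epsilon> in at_right 0. r \<epsilon> z \<le> ?u w + K * dist z w + e"
      using upper_lim_eventually_less[OF B' half_gt_zero[OF e]] eventually_at_right_0_less[OF a(1)]
    proof eventually_elim
      case (elim \<epsilon>)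
      have "K * \<epsilon> \<le> K * a" using elim D(1) by (intro mult_left_mono) auto
      then show ?case using D(2)[of \<epsilon> z w] zw elim a(2) by (simp add: algebra_simps abs_le_iff)
    qed
    then show "?u z \<le> ?u w + K * dist z w + e" by (rule upper_lim_least[OF trivial_limit_at_right_real B])
  qed
  show ?thesis
  proof (rule lipschitz_onI)
    fix z w :: "real \<times> real" assume "z \<in> {0..} \<times> UNIV" "w \<in> {0..} \<times> UNIV"
    then show "dist (?u z) (?u w) \<le> K * dist z w"
      using le[of z w] le[of w z] unfolding dist_real_def dist_commute[of w z] by linarith
  qed (rule D(1))
qed

lemma upper_lim_initial:
  assumes r: "approx_lipschitz K u0 r"
  shows "upper_lim (at_right 0) (\<lambda>\<epsilon>. r \<epsilon> (0, x)) = u0 x"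
proof -
  note D = approx_lipschitzD[OF r]
  obtain B where B: "\<forall>\<^sub>F \<epsilon> in at_right 0. \<bar>r \<epsilon> (0, x)\<bar> \<le> B" using approx_lipschitz_bounded[OF r, of "(0, x)"] by auto
  have ev: "\<forall>\<^sub>F \<epsilon> in at_right 0. \<bar>r \<epsilon> (0, x) - u0 x\<bar> \<le> e" if "0 < e" for e
  proof -
    have "0 < e / (K + 1)" using that D(1) by simp
    then show ?thesis
    proof (rule eventually_at_right_0_less[THEN eventually_mono])
      fix \<epsilon> assume \<epsilon>: "0 < \<epsilon> \<and> \<epsilon> < e / (K + 1)"
      have "K * \<epsilon> \<le> (K + 1) * \<epsilon>" using \<epsilon> by simp
      also have "\<dots> \<le> e" using \<epsilon> D(1) by (simp add: field_simps)
      finally show "\<bar>r \<epsilon> (0, x) - u0 x\<bar> \<le> e" using D(3)[of \<epsilon> x] \<epsilon> by simp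
    qed
  qed
  have "upper_lim (at_right 0) (\<lambda>\<epsilon>. r \<epsilon> (0, x)) \<le> u0 x"
  proof (rule field_le_epsilon)
    fix e :: real assume "0 < e"
    then show "upper_lim (at_right 0) (\<lambda>\<epsilon>. r \<epsilon> (0, x)) \<le> u0 x + e"
      by (intro upper_lim_least[OF _ B] eventually_mono[OF ev]) auto
  qed
  moreover have "u0 x \<le> upper_lim (at_right 0) (\<lambda>\<epsilon>. r \<epsilon> (0, x))"
  proof (rule field_le_epsilon)
    fix e :: real assume "0 < e"
    then have "u0 x - e \<le> upper_lim (at_right 0) (\<lambda>\<epsilon>. r \<epsilon> (0, x))"
      by (intro upper_lim_greatest[OF _ B] eventually_mono[OF ev]) auto
    then show "u0 x \<le> upper_lim (at_right 0) (\<lambda>\<epsilon>. r \<epsilon> (0, x)) + e" by simp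
  qed
  ultimately show ?thesis by simp
qed

text \<open>A finite net turns the pointwise upper bound into a uniform one. The four quarters of
  \<open>e\<close> pay for the bound at the net point, the mesh, the step error of the family, and
  the Lipschitz bound of the limit.\<close>

lemma upper_lim_uniform:
  assumes r: "approx_lipschitz K u0 r" and S: "compact S" "S \<subseteq> {0..} \<times> UNIV" and e: "0 < e"
  shows "\<forall>\<^sub>F \<epsilon> in at_right 0. \<forall>z\<in>S. r \<epsilon> z \<le> upper_lim (at_right 0) (\<lambda>\<epsilon>. r \<epsilon> z) + e"
proof -
  note D = approx_lipschitzD[OF r]
  let ?u = "\<lambda>z. upper_lim (at_right 0) (\<lambda>\<epsilon>. r \<epsilon> z)"
  define a where "a = e / 4 / (K + 1)"
  have a: "0 < a" "K * a \<le> e / 4" using e D(1) by (auto simp: a_def field_simps)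
  obtain N where N: "finite N" "N \<subseteq> S" "S \<subseteq> (\<Union>w\<in>N. ball w a)"
    using seq_compact_imp_totally_bounded[of S] S(1) a(1) by (meson compact_imp_seq_compact)
  have "\<forall>\<^sub>F \<epsilon> in at_right 0. \<forall>w\<in>N. r \<epsilon> w < ?u w + e / 4"
  proof (rule eventually_ball_finite[OF N(1)], rule ballI)
    fix w assume "w \<in> N"
    then have "w \<in> {0..} \<times> UNIV" using N(2) S(2) by blast
    then obtain B where "\<forall>\<^sub>F \<epsilon> in at_right 0. \<bar>r \<epsilon> w\<bar> \<le> B" using approx_lipschitz_bounded[OF r] by blast
    then show "\<forall>\<^sub>F \<epsilon> in at_right 0. r \<epsilon> w < ?u w + e / 4"
      by (rule upper_lim_eventually_less) (use e in simp)
  qed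
  then show ?thesis
    using eventually_at_right_0_less[OF a(1)]
  proof eventually_elim
    case (elim \<epsilon>)
    show ?case
    proof
      fix z assume z: "z \<in> S"
      then obtain w where w: "w \<in> N" "dist w z < a" using N(3) by auto
      have zw: "z \<in> {0..} \<times> UNIV" "w \<in> {0..} \<times> UNIV" using z w N(2) S(2) by auto
      have "K * dist z w \<le> K * a" "K * \<epsilon> \<le> K * a"
        using w elim D(1) by (auto intro!: mult_left_mono simp: dist_commute)
      moreover have "\<bar>r \<epsilon> z - r \<epsilon> w\<bar> \<le> K * dist z w + K * \<epsilon>"
        using D(2)[of \<epsilon>, OF _ zw] elim by (simp add: distrib_left)
      moreover have "r \<epsilon> w < ?u w + e / 4" using elim w by simp
      moreover have "\<bar>?u w - ?u z\<bar> \<le> K * dist z w"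
        using lipschitz_onD[OF upper_lim_lipschitz[OF r] zw(2,1)] by (simp add: dist_real_def dist_commute)
      ultimately show "r \<epsilon> z \<le> ?u z + e" using a(2) by linarith
    qed
  qed
qed

section \<open>Rescaled particle systems and their limits\<close>

definition FK_family ::
  "real \<Rightarrow> real \<Rightarrow> (real \<Rightarrow> real) \<Rightarrow> (real \<Rightarrow> int \<Rightarrow> real \<Rightarrow> real) \<Rightarrow> (real \<Rightarrow> int \<Rightarrow> real \<Rightarrow> real) \<Rightarrow> bool" where
  "FK_family \<alpha> L u0 U X \<longleftrightarrow>
     (\<forall>\<epsilon>>0. FK_system \<alpha> L (U \<epsilon>) (X \<epsilon>) \<and>
        (\<forall>i. U \<epsilon> i 0 = u0 (of_int i * \<epsilon>) / \<epsilon> \<and> X \<epsilon> i 0 = u0 (of_int i * \<epsilon>) / \<epsilon>))"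

lemma FK_familyD:
  assumes "FK_family \<alpha> L u0 U X" "0 < \<epsilon>"
  shows "FK_system \<alpha> L (U \<epsilon>) (X \<epsilon>)" "U \<epsilon> i 0 = u0 (of_int i * \<epsilon>) / \<epsilon>" "X \<epsilon> i 0 = U \<epsilon> i 0"
  using assms unfolding FK_family_def by auto

lemma FK_family_minus:
  assumes "FK_family \<alpha> L u0 U X"
  shows "FK_family \<alpha> (- L) (\<lambda>x. - u0 x) (\<lambda>\<epsilon> i \<tau>. - U \<epsilon> i \<tau>) (\<lambda>\<epsilon> i \<tau>. - X \<epsilon> i \<tau>)"
  using assms FK_system_minus unfolding FK_family_def by simp

lemma rescaled_minus: "rescaled \<epsilon> (\<lambda>i \<tau>. - U i \<tau>) z = - rescaled \<epsilon> U z"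
  by (cases z) (simp add: rescaled_def)

lemma sampled_lipschitz:
  assumes u0: "K-lipschitz_on UNIV u0" and \<epsilon>: "0 < \<epsilon>"
  shows "\<bar>u0 (x * \<epsilon>) / \<epsilon> - u0 (y * \<epsilon>) / \<epsilon>\<bar> \<le> K * \<bar>x - y\<bar>"
proof -
  have "\<bar>u0 (x * \<epsilon>) - u0 (y * \<epsilon>)\<bar> \<le> K * \<bar>x * \<epsilon> - y * \<epsilon>\<bar>"
    using lipschitz_onD[OF u0, of "x * \<epsilon>" "y * \<epsilon>"] by (simp add: dist_real_def)
  also have "\<dots> = K * \<bar>x - y\<bar> * \<epsilon>" using \<epsilon> by (simp add: abs_mult flip: left_diff_distrib)
  finally show ?thesis using \<epsilon> by (simp add: field_simps flip: diff_divide_distrib)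
qed

text \<open>Two sites may be one index further apart than their positions suggest, which costs
  \<open>K\<close>, and \<open>FK_spread\<close> costs 1; rescaling multiplies both by \<epsilon>.
  The stated constant dominates \<open>3 * K + 3 + \<bar>L\<bar>\<close> for space and time,
  \<open>K + 1\<close> for the step error and \<open>K\<close> for the initial data.\<close>

lemma rescaled_approx_lipschitz:
  assumes \<alpha>: "20 \<le> \<alpha>" and u0: "K-lipschitz_on UNIV u0" and fam: "FK_family \<alpha> L u0 U X"
  shows "approx_lipschitz (4 * K + 4 + \<bar>L\<bar>) u0 (\<lambda>\<epsilon>. rescaled \<epsilon> (U \<epsilon>))"
  unfolding approx_lipschitz_def
proof (intro conjI allI impI ballI)
  have K: "0 \<le> K" using u0 by (rule lipschitz_on_nonneg)
  then show K': "0 \<le> 4 * K + 4 + \<bar>L\<bar>" by simp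
  fix \<epsilon> :: real assume \<epsilon>: "0 < \<epsilon>"
  note sys = FK_familyD[OF fam \<epsilon>]
  have init: "\<bar>U \<epsilon> (i + j) 0 - U \<epsilon> i 0\<bar> \<le> K * \<bar>of_int j\<bar>" for i j
    using sampled_lipschitz[OF u0 \<epsilon>, of "of_int (i + j)" "of_int i"] by (simp add: sys(2))
  {
    fix z w :: "real \<times> real" assume zw: "z \<in> {0..} \<times> UNIV" "w \<in> {0..} \<times> UNIV"
    obtain t x s y where z: "z = (t, x)" and w: "w = (s, y)" by (cases z, cases w)
    have ts: "0 \<le> t / \<epsilon>" "0 \<le> s / \<epsilon>" using zw \<epsilon> by (auto simp: z w)
    define i j where "i = \<lfloor>x / \<epsilon>\<rfloor>" and "j = \<lfloor>y / \<epsilon>\<rfloor>"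
    define M where "M = 2 * K + 3 + \<bar>L\<bar>"
    have "\<bar>of_int (i - j)\<bar> \<le> \<bar>x / \<epsilon> - y / \<epsilon>\<bar> + 1" unfolding i_def j_def by linarith
    also have "\<bar>x / \<epsilon> - y / \<epsilon>\<bar> = \<bar>x - y\<bar> / \<epsilon>" using \<epsilon> by (simp add: flip: diff_divide_distrib)
    finally have ij: "K * \<bar>of_int (i - j)\<bar> \<le> K * (\<bar>x - y\<bar> / \<epsilon> + 1)" using K by (rule mult_left_mono)
    have "\<bar>U \<epsilon> (j + (i - j)) (t / \<epsilon>) - U \<epsilon> j (t / \<epsilon>) - 0\<bar> \<le> K * \<bar>of_int (i - j)\<bar> + 1"
      by (rule FK_spread[OF \<alpha> sys(1,3) _ ts(1)]) (use init[of _ "i - j"] in simp)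
    then have A: "\<bar>U \<epsilon> i (t / \<epsilon>) - U \<epsilon> j (t / \<epsilon>)\<bar> \<le> K * (\<bar>x - y\<bar> / \<epsilon> + 1) + 1" using ij by simp
    have "\<bar>U \<epsilon> j (t / \<epsilon>) - U \<epsilon> j (s / \<epsilon>)\<bar> \<le> M * \<bar>t / \<epsilon> - s / \<epsilon>\<bar>"
      unfolding M_def by (rule FK_velocity(2)[OF \<alpha> sys(1,3) _ ts, of 0]) (use init[of _ 1] in simp)
    also have "\<bar>t / \<epsilon> - s / \<epsilon>\<bar> = \<bar>t - s\<bar> / \<epsilon>" using \<epsilon> by (simp add: flip: diff_divide_distrib)
    finally have "\<bar>U \<epsilon> i (t / \<epsilon>) - U \<epsilon> j (s / \<epsilon>)\<bar> \<le> K * (\<bar>x - y\<bar> / \<epsilon> + 1) + 1 + M * (\<bar>t - s\<bar> / \<epsilon>)"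
      using A by linarith
    then have "\<epsilon> * \<bar>U \<epsilon> i (t / \<epsilon>) - U \<epsilon> j (s / \<epsilon>)\<bar> \<le> \<epsilon> * (K * (\<bar>x - y\<bar> / \<epsilon> + 1) + 1 + M * (\<bar>t - s\<bar> / \<epsilon>))"
      using \<epsilon> by (intro mult_left_mono) auto
    also have "\<dots> = K * \<bar>x - y\<bar> + M * \<bar>t - s\<bar> + (K + 1) * \<epsilon>" using \<epsilon> by (simp add: field_simps)
    also have "\<dots> \<le> K * dist z w + M * dist z w + (K + 1) * \<epsilon>"
      using dist_fst_le[of z w] dist_snd_le[of z w] K
      by (intro add_mono mult_left_mono) (auto simp: z w dist_real_def M_def)
    also have "\<dots> = (3 * K + 3 + \<bar>L\<bar>) * dist z w + (K + 1) * \<epsilon>" by (simp add: M_def algebra_simps)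
    also have "\<dots> \<le> (4 * K + 4 + \<bar>L\<bar>) * dist z w + (4 * K + 4 + \<bar>L\<bar>) * \<epsilon>"
      using K \<epsilon> by (intro add_mono[OF mult_right_mono mult_right_mono]) auto
    finally show "\<bar>rescaled \<epsilon> (U \<epsilon>) z - rescaled \<epsilon> (U \<epsilon>) w\<bar> \<le> (4 * K + 4 + \<bar>L\<bar>) * (dist z w + \<epsilon>)"
      using \<epsilon> unfolding rescaled_def z w i_def j_def
      by (simp add: abs_mult distrib_left flip: right_diff_distrib)
  }
  fix x
  have "\<bar>of_int \<lfloor>x / \<epsilon>\<rfloor> * \<epsilon> - x\<bar> \<le> \<epsilon>"
  proof -
    have "of_int \<lfloor>x / \<epsilon>\<rfloor> \<le> x / \<epsilon>" "x / \<epsilon> \<le> of_int \<lfloor>x / \<epsilon>\<rfloor> + 1" by linarith+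
    then have "of_int \<lfloor>x / \<epsilon>\<rfloor> * \<epsilon> \<le> x" "x \<le> (of_int \<lfloor>x / \<epsilon>\<rfloor> + 1) * \<epsilon>"
      using \<epsilon> by (simp_all only: pos_le_divide_eq pos_divide_le_eq)
    then show ?thesis by (simp add: distrib_right abs_le_iff)
  qed
  then have "K * \<bar>of_int \<lfloor>x / \<epsilon>\<rfloor> * \<epsilon> - x\<bar> \<le> K * \<epsilon>" using K by (rule mult_left_mono)
  also have "\<dots> \<le> (4 * K + 4 + \<bar>L\<bar>) * \<epsilon>" using K \<epsilon> by (intro mult_right_mono) auto
  finally show "\<bar>rescaled \<epsilon> (U \<epsilon>) (0, x) - u0 x\<bar> \<le> (4 * K + 4 + \<bar>L\<bar>) * \<epsilon>"
    using lipschitz_onD[OF u0, of "of_int \<lfloor>x / \<epsilon>\<rfloor> * \<epsilon>" x] \<epsilon>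
    by (simp add: rescaled_def sys(2) dist_real_def)
qed

text \<open>
  At the macroscopic time \<open>t0 - h\<close> the upper limit lies below a plane of slope \<open>p\<close>, up to \<open>o(h)\<close> on an interval
  of length of order \<open>h\<close> around \<open>x0\<close>. Comparing the particles with the planar solution of slope \<open>p\<close> on
  the time interval of length \<open>h / \<epsilon>\<close>, during which remote particles have no influence, no corrector
  is needed.
\<close>
lemma upper_lim_visc_subsolution:
  assumes \<alpha>: "20 \<le> \<alpha>" and F: "planar_mean_velocity \<alpha> L C F"
    and u0: "K-lipschitz_on UNIV u0" and fam: "FK_family \<alpha> L u0 U X"
  shows "visc_subsolution F (\<lambda>z. upper_lim (at_right 0) (\<lambda>\<epsilon>. rescaled \<epsilon> (U \<epsilon>) z))"
  unfolding visc_subsolution_def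
proof (intro allI impI ballI)
  define u where "u z = upper_lim (at_right 0) (\<lambda>\<epsilon>. rescaled \<epsilon> (U \<epsilon>) z)" for z
  note r = rescaled_approx_lipschitz[OF \<alpha> u0 fam]
  fix \<phi> \<phi>t \<phi>x z0
  assume \<phi>: "C1_test \<phi> \<phi>t \<phi>x" and z0: "z0 \<in> {0::real<..} \<times> (UNIV :: real set)"
    and loc: "\<forall>\<^sub>F w in nhds z0. upper_lim (at_right 0) (\<lambda>\<epsilon>. rescaled \<epsilon> (U \<epsilon>) w) - \<phi> w
      \<le> upper_lim (at_right 0) (\<lambda>\<epsilon>. rescaled \<epsilon> (U \<epsilon>) z0) - \<phi> z0"
  obtain t0 x0 where z0_eq: "z0 = (t0, x0)" and t0: "0 < t0" using z0 by auto
  define a p where "a = \<phi>t z0" and "p = \<phi>x z0"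
  show "\<phi>t z0 \<le> F (\<phi>x z0)"
    unfolding a_def[symmetric] p_def[symmetric]
  proof (rule field_le_epsilon)
    fix e :: real assume e: "0 < e"
    obtain d1 where d1: "0 < d1" "\<And>w. dist w z0 < d1 \<Longrightarrow> u w - \<phi> w \<le> u z0 - \<phi> z0"
      using loc unfolding eventually_nhds_metric u_def by blast
    have "(\<phi> has_derivative (\<lambda>h. a * fst h + p * snd h)) (at z0)"
      using \<phi> z0 unfolding C1_test_def a_def p_def by blast
    then obtain d2 where d2: "0 < d2" "\<And>w. norm (w - z0) < d2 \<Longrightarrow>
        norm (\<phi> w - \<phi> z0 - (a * fst (w - z0) + p * snd (w - z0))) \<le> e / 246 * norm (w - z0)"
      using e unfolding has_derivative_at_alt by (metis divide_pos_pos zero_less_numeral)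
    \<comment> \<open>The comparison uses particles within macroscopic distance 80 h of the site of
      \<open>x0\<close>, and that site is off by at most \<epsilon> < h: hence 81 h. Adding the time
      step keeps all points within 82 h of \<open>z0\<close>, and as 246 = 3 * 82 the
      differentiability error is at most e/3 h. The other two thirds go to the uniform upper limit
      and to the particle-scale errors.\<close>
    define h where "h = min (t0 / 2) (min d1 d2 / 100)"
    have h: "0 < h" "h < t0" "82 * h < d1" "82 * h < d2" using t0 d1(1) d2(1) by (auto simp: h_def min_def)
    have plane: "u (t0 - h, x) \<le> u z0 - a * h + p * (x - x0) + e / 3 * h" if x: "\<bar>x - x0\<bar> \<le> 81 * h" for x
    proof -
      let ?w = "(t0 - h, x)"
      have "dist ?w z0 \<le> \<bar>h\<bar> + \<bar>x - x0\<bar>"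
        using norm_Pair_le[of "- h" "x - x0"] by (simp add: z0_eq dist_norm)
      then have dw: "dist ?w z0 \<le> 82 * h" using x h by simp
      then have "u ?w - \<phi> ?w \<le> u z0 - \<phi> z0" using d1(2) h by simp
      moreover have "\<bar>\<phi> ?w - \<phi> z0 - (a * (- h) + p * (x - x0))\<bar> \<le> e / 246 * dist ?w z0"
        using d2(2)[of ?w] dw h by (simp add: z0_eq dist_norm)
      moreover have "e / 246 * dist ?w z0 \<le> e / 246 * (82 * h)" using dw e by (intro mult_left_mono) auto
      ultimately have "u ?w \<le> u z0 + (a * (- h) + p * (x - x0)) + e / 246 * (82 * h)" by linarith
      then show ?thesis by simp
    qed
    define S where "S = {t0 - h} \<times> {x0 - 81 * h..x0 + 81 * h}"
    have S: "compact S" "S \<subseteq> {0..} \<times> UNIV" using h by (auto simp: S_def intro: compact_Times)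
    \<comment> \<open>All particle-scale errors together. One \<open>\<bar>p\<bar>\<close> comes
      from the barrier, the other from replacing \<open>x0\<close> by the position of its site. For
      \<epsilon> < b they amount to at most e/3 h.\<close>
    define c where "c = C + 3 * K + 5 + \<bar>L\<bar> + \<bar>p\<bar> + \<bar>p\<bar>"
    define b where "b = e / 3 * h / (\<bar>c\<bar> + 1)"
    have b: "0 < b" using e h by (simp add: b_def add_nonneg_pos)
    obtain B where B: "\<forall>\<^sub>F \<epsilon> in at_right 0. \<bar>rescaled \<epsilon> (U \<epsilon>) z0\<bar> \<le> B"
      using approx_lipschitz_bounded[OF r, of z0] z0 by auto
    have eh: "0 < e / 3 * h" using e h by simp
    have "\<forall>\<^sub>F \<epsilon> in at_right 0. rescaled \<epsilon> (U \<epsilon>) z0 \<le> u z0 + h * (F p - a + e)"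
      using upper_lim_uniform[OF r S eh] eventually_at_right_0_less[OF b] eventually_at_right_0_less[OF h(1)]
    proof eventually_elim
      case (elim \<epsilon>)
      then have \<epsilon>: "0 < \<epsilon>" "\<epsilon> < h" "\<epsilon> < b" by auto
      note sys = FK_familyD[OF fam \<epsilon>(1)]
      define k where "k = \<lfloor>x0 / \<epsilon>\<rfloor>"
      have k: "of_int k * \<epsilon> \<le> x0" "x0 \<le> of_int k * \<epsilon> + \<epsilon>"
      proof -
        have "of_int k \<le> x0 / \<epsilon>" "x0 / \<epsilon> \<le> of_int k + 1" unfolding k_def by linarith+
        then show "of_int k * \<epsilon> \<le> x0" "x0 \<le> of_int k * \<epsilon> + \<epsilon>" using \<epsilon> by (auto simp: field_simps)
      qed
      define q where "q = (u z0 - a * h + 2 * e / 3 * h) / \<epsilon> + \<bar>p\<bar>"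
      have near: "U \<epsilon> (i + k) ((t0 - h) / \<epsilon>) \<le> p * of_int i + q" if i: "\<bar>of_int i\<bar> \<le> 80 * (h / \<epsilon>)" for i
      proof -
        define x where "x = of_int (i + k) * \<epsilon>"
        have "\<bar>of_int i * \<epsilon>\<bar> \<le> 80 * h" using i \<epsilon> by (simp add: abs_mult field_simps)
        then have x: "\<bar>x - x0\<bar> \<le> 81 * h" using k \<epsilon> by (simp add: x_def algebra_simps abs_le_iff)
        then have "(t0 - h, x) \<in> S" by (auto simp: S_def abs_le_iff)
        then have "rescaled \<epsilon> (U \<epsilon>) (t0 - h, x) \<le> u (t0 - h, x) + e / 3 * h" using elim(1) by (simp add: u_def)
        also have "rescaled \<epsilon> (U \<epsilon>) (t0 - h, x) = \<epsilon> * U \<epsilon> (i + k) ((t0 - h) / \<epsilon>)"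
          using \<epsilon> by (simp add: rescaled_def x_def del: of_int_add)
        finally have "\<epsilon> * U \<epsilon> (i + k) ((t0 - h) / \<epsilon>) \<le> u z0 - a * h + p * (x - x0) + 2 * e / 3 * h"
          using plane[OF x] by simp
        also have "p * (x - x0) = p * of_int i * \<epsilon> + p * (of_int k * \<epsilon> - x0)" by (simp add: x_def algebra_simps)
        also have "p * (of_int k * \<epsilon> - x0) \<le> \<bar>p\<bar> * \<bar>of_int k * \<epsilon> - x0\<bar>" by (metis abs_ge_self abs_mult)
        also have "\<dots> \<le> \<bar>p\<bar> * \<epsilon>" using k by (intro mult_left_mono) auto
        finally have "\<epsilon> * U \<epsilon> (i + k) ((t0 - h) / \<epsilon>) \<le> u z0 - a * h + (p * of_int i * \<epsilon> + \<bar>p\<bar> * \<epsilon>) + 2 * e / 3 * h"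
          by simp
        also have "\<dots> = \<epsilon> * (p * of_int i + q)" using \<epsilon> by (simp add: q_def field_simps)
        finally show ?thesis using \<epsilon> by simp
      qed
      have "U \<epsilon> k ((t0 - h) / \<epsilon> + h / \<epsilon>) \<le> F p * (h / \<epsilon>) + q + (C + 3 * K + 5 + \<bar>L\<bar> + \<bar>p\<bar>)"
      proof (rule FK_below_planar[OF \<alpha> F sys(1,3) _ near])
        show "\<bar>U \<epsilon> (i + j) 0 - U \<epsilon> i 0\<bar> \<le> K * \<bar>of_int j\<bar>" for i j
          using sampled_lipschitz[OF u0 \<epsilon>(1), of "of_int (i + j)" "of_int i"] by (simp add: sys(2))
      qed (use h \<epsilon> in auto)
      also have "(t0 - h) / \<epsilon> + h / \<epsilon> = t0 / \<epsilon>" by (simp flip: add_divide_distrib)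
      finally have "\<epsilon> * U \<epsilon> k (t0 / \<epsilon>) \<le> \<epsilon> * (F p * (h / \<epsilon>) + q + (C + 3 * K + 5 + \<bar>L\<bar> + \<bar>p\<bar>))"
        using \<epsilon> by (intro mult_left_mono) auto
      also have "\<dots> = F p * h + (u z0 - a * h + 2 * e / 3 * h) + c * \<epsilon>"
        using \<epsilon> by (simp add: q_def c_def field_simps)
      also have "c * \<epsilon> \<le> e / 3 * h"
      proof -
        have "c * \<epsilon> \<le> (\<bar>c\<bar> + 1) * \<epsilon>" using \<epsilon> by (intro mult_right_mono) auto
        also have "\<dots> \<le> (\<bar>c\<bar> + 1) * b" using \<epsilon> by (intro mult_left_mono) auto
        also have "\<dots> = e / 3 * h"
        proof -
          have "\<bar>c\<bar> + 1 \<noteq> 0" by linarith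
          then show ?thesis
            unfolding b_def times_divide_eq_right by (rule nonzero_mult_div_cancel_left)
        qed
        finally show ?thesis .
      qed
      finally show ?case by (simp add: rescaled_def z0_eq k_def algebra_simps)
    qed
    \<comment> \<open>As \<epsilon> tends to 0 with \<open>h\<close> fixed, the value at
      \<open>z0\<close> appears on both sides, leaving only the sign of
      \<open>F p - a + e\<close>.\<close>
    then have "u z0 \<le> u z0 + h * (F p - a + e)"
      unfolding u_def[of z0] by (rule upper_lim_least[OF trivial_limit_at_right_real B])
    then show "a \<le> F p + e" using h by (simp add: zero_le_mult_iff)
  qed
qed

text \<open>The open half-plane is a neighbourhood of each contact point, so agreement there
  suffices; the upper and lower limits are identified at nonnegative times only.\<close>

lemma visc_supersolution_cong:
  assumes super: "visc_supersolution F u" and eq: "\<And>z. z \<in> {0<..} \<times> UNIV \<Longrightarrow> v z = u z"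
  shows "visc_supersolution F v"
  unfolding visc_supersolution_def
proof (intro allI impI ballI)
  fix \<phi> \<phi>t \<phi>x z
  assume \<phi>: "C1_test \<phi> \<phi>t \<phi>x" and z: "z \<in> {0::real<..} \<times> (UNIV :: real set)"
    and loc: "\<forall>\<^sub>F w in nhds z. v z - \<phi> z \<le> v w - \<phi> w"
  have "\<forall>\<^sub>F w in nhds z. w \<in> {0::real<..} \<times> (UNIV :: real set)"
    using z by (intro eventually_nhds_in_open open_Times) auto
  with loc have "\<forall>\<^sub>F w in nhds z. u z - \<phi> z \<le> u w - \<phi> w"
    by eventually_elim (use eq z in auto)
  then show "F (\<phi>x z) \<le> \<phi>t z" using super \<phi> z unfolding visc_supersolution_def by blast
qed

lemma FK_homogenization:
  assumes \<alpha>: "20 \<le> \<alpha>" and F: "planar_mean_velocity \<alpha> L C F"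
    and u0: "K-lipschitz_on UNIV u0" and fam: "FK_family \<alpha> L u0 U X"
  obtains u K' where "visc_solution F u0 u" "K'-lipschitz_on ({0..} \<times> UNIV) u"
    "\<And>S. compact S \<Longrightarrow> S \<subseteq> {0..} \<times> UNIV \<Longrightarrow> uniform_limit S (\<lambda>\<epsilon>. rescaled \<epsilon> (U \<epsilon>)) u (at_right 0)"
proof -
  define K' where "K' = 4 * K + 4 + \<bar>L\<bar>"
  define u where "u z = upper_lim (at_right 0) (\<lambda>\<epsilon>. rescaled \<epsilon> (U \<epsilon>) z)" for z
  \<comment> \<open>\<open>- w\<close> is the lower limit. Working with the negated family lets the
    subsolution argument and the one-sided uniform bound serve twice.\<close>
  define w where "w z = upper_lim (at_right 0) (\<lambda>\<epsilon>. - rescaled \<epsilon> (U \<epsilon>) z)" for z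
  have r: "approx_lipschitz K' u0 (\<lambda>\<epsilon>. rescaled \<epsilon> (U \<epsilon>))"
    unfolding K'_def by (rule rescaled_approx_lipschitz[OF \<alpha> u0 fam])
  note r' = approx_lipschitz_minus[OF r]
  have ulip: "K'-lipschitz_on ({0..} \<times> UNIV) u" unfolding u_def by (rule upper_lim_lipschitz[OF r])
  have wlip: "K'-lipschitz_on ({0..} \<times> UNIV) w" unfolding w_def by (rule upper_lim_lipschitz[OF r'])
  have u_init: "u (0, x) = u0 x" for x unfolding u_def by (rule upper_lim_initial[OF r])
  have w_init: "w (0, x) = - u0 x" for x unfolding w_def by (rule upper_lim_initial[OF r'])
  have sub: "visc_subsolution F u" unfolding u_def by (rule upper_lim_visc_subsolution[OF \<alpha> F u0 fam])
  have "K-lipschitz_on UNIV (\<lambda>x. - u0 x)" using u0 unfolding lipschitz_on_def by (simp add: dist_minus)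
  from upper_lim_visc_subsolution[OF \<alpha> planar_mean_velocity_minus[OF F] this FK_family_minus[OF fam]]
  have "visc_subsolution (\<lambda>p. - F (- p)) w" unfolding w_def rescaled_minus .
  from visc_supersolution_minus[OF this] have super: "visc_supersolution F (\<lambda>z. - w z)" by simp
  have wcont: "continuous_on ({0..} \<times> UNIV) (\<lambda>z. - w z)"
    by (intro continuous_intros lipschitz_on_continuous_on[OF wlip])
  \<comment> \<open>The Lipschitz bound on \<open>w\<close> in time supplies the initial condition
    of the comparison.\<close>
  have le: "u (t, x) \<le> - w (t, x)" if "0 \<le> t" for t x
  proof (rule visc_comparison[OF planar_mean_velocity_continuous[OF \<alpha> F] ulip sub wcont super _ that])
    fix s y :: real assume "0 \<le> s"
    then show "u (0, y) - K' * s \<le> - w (s, y)"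
      using lipschitz_onD[OF wlip, of "(s, y)" "(0, y)"]
      by (simp add: u_init w_init dist_prod_def dist_real_def abs_le_iff)
  qed
  have ge: "- w z \<le> u z" if z: "z \<in> {0..} \<times> UNIV" for z
  proof (rule field_le_epsilon)
    fix e :: real assume e: "0 < e"
    have S: "compact {z}" "{z} \<subseteq> {0..} \<times> UNIV" using z by auto
    have "\<forall>\<^sub>F \<epsilon> :: real in at_right 0. - w z \<le> u z + e"
      using upper_lim_uniform[OF r S half_gt_zero[OF e]] upper_lim_uniform[OF r' S half_gt_zero[OF e]]
      by eventually_elim (simp add: u_def w_def)
    then show "- w z \<le> u z + e" by simp
  qed
  have eq: "u z = - w z" if "z \<in> {0..} \<times> UNIV" for z
    using le[of "fst z" "snd z"] ge[OF that] that by (cases z) auto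
  show thesis
  proof (rule that[of u K'])
    have "visc_supersolution F u"
      by (rule visc_supersolution_cong[OF super eq]) auto
    then show "visc_solution F u0 u"
      using sub lipschitz_on_continuous_on[OF ulip] u_init by (simp add: visc_solution_def)
    fix S :: "(real \<times> real) set" assume S: "compact S" "S \<subseteq> {0..} \<times> UNIV"
    show "uniform_limit S (\<lambda>\<epsilon>. rescaled \<epsilon> (U \<epsilon>)) u (at_right 0)"
    proof (rule uniform_limitI)
      fix e :: real assume e: "0 < e"
      show "\<forall>\<^sub>F \<epsilon> in at_right 0. \<forall>z\<in>S. dist (rescaled \<epsilon> (U \<epsilon>) z) (u z) < e"
        using upper_lim_uniform[OF r S half_gt_zero[OF e]] upper_lim_uniform[OF r' S half_gt_zero[OF e]]
      proof eventually_elim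
        case (elim \<epsilon>)
        show ?case
        proof
          fix z assume z: "z \<in> S"
          have "rescaled \<epsilon> (U \<epsilon>) z \<le> u z + e / 2" using elim(1) z by (simp add: u_def)
          moreover have "- rescaled \<epsilon> (U \<epsilon>) z \<le> w z + e / 2" using elim(2) z by (simp add: w_def)
          moreover have "u z = - w z" using eq z S(2) by blast
          ultimately show "dist (rescaled \<epsilon> (U \<epsilon>) z) (u z) < e"
            using e unfolding dist_real_def by linarith
        qed
      qed
    qed
  qed (rule ulip)
qed

text \<open>Comparison wants the Lipschitz function on the subsolution side. Negating both functions
  exchanges their roles, with \<open>- F (- p)\<close> in place of \<open>F p\<close>, so that
  \<open>u\<close> can occupy that side both times.\<close>

lemma visc_solution_unique:
  assumes F: "continuous_on UNIV F" "\<And>p. \<bar>F p\<bar> \<le> M"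
    and u: "visc_solution F u0 u" "K-lipschitz_on ({0..} \<times> UNIV) u" and v: "visc_solution F u0 v" and t: "0 \<le> t"
  shows "v (t, x) = u (t, x)"
proof (rule antisym)
  have M: "0 \<le> M" using F(2)[of 0] by linarith
  have Fle: "- M \<le> F p" "- M \<le> - F (- p)" for p
    using F(2)[of p] F(2)[of "- p"] by (auto simp: abs_le_iff)
  have vD: "continuous_on ({0..} \<times> UNIV) v" "visc_subsolution F v" "visc_supersolution F v" "\<And>x. v (0, x) = u0 x"
    using v by (auto simp: visc_solution_def)
  have uD: "visc_subsolution F u" "visc_supersolution F u" "\<And>x. u (0, x) = u0 x"
    using u(1) by (auto simp: visc_solution_def)
  show "u (t, x) \<le> v (t, x)"
  proof (rule visc_comparison[OF F(1) u(2) uD(1) vD(1,3) _ t])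
    show "u (0, y) - M * s \<le> v (s, y)" if "0 \<le> s" for s y
      using visc_supersolution_time_lower_bound[OF Fle(1) M vD(1,3) that, of y] by (simp add: uD vD)
  qed
  have v': "continuous_on ({0..} \<times> UNIV) (\<lambda>z. - v z)" using vD(1) by (rule continuous_on_minus)
  have "continuous_on UNIV (\<lambda>p. - F (- p))"
    by (intro continuous_intros continuous_on_compose2[OF F(1)]) auto
  moreover have "K-lipschitz_on ({0..} \<times> UNIV) (\<lambda>z. - u z)"
    using u(2) unfolding lipschitz_on_def by (simp add: dist_minus)
  ultimately have "- u (t, x) \<le> - v (t, x)"
  proof (rule visc_comparison[OF _ _ visc_subsolution_minus[OF uD(2)] v' visc_supersolution_minus[OF vD(2)] _ t])
    show "- u (0, y) - M * s \<le> - v (s, y)" if "0 \<le> s" for s y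
      using visc_supersolution_time_lower_bound[OF Fle(2) M v' visc_supersolution_minus[OF vD(2)] that, of y]
      by (simp add: uD vD)
  qed
  then show "v (t, x) \<le> u (t, x)" by simp
qed

section \<open>Return to the second-order system\<close>

lemma FK_solution_exists:
  fixes a :: "real \<Rightarrow> real"
  assumes m: "0 < m" and a: "continuous_on UNIV a" "\<And>x. \<bar>a (x + 1) - a x\<bar> \<le> K"
  shows "\<exists>U. FK_solution m L (\<lambda>i. a (of_int i)) U"
proof -
  define \<alpha> where "\<alpha> = 1 / (2 * m)"
  have \<alpha>: "0 \<le> \<alpha>" "2 * \<alpha> * m = 1" using m by (auto simp: \<alpha>_def)
  obtain U X where sys: "FK_system \<alpha> L U X"
    and U0: "\<And>i. U i 0 = a (of_int i)" and X0: "\<And>i. X i 0 = a (of_int i)"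
    and Ud: "\<And>i \<tau>. 0 \<le> \<tau> \<Longrightarrow> (U i has_real_derivative \<alpha> * (X i \<tau> - U i \<tau>)) (at \<tau> within {0..})"
    and bd: "\<And>T. \<exists>C. \<forall>i. \<forall>\<tau>\<in>{0..T}. \<bar>U i \<tau> - a (of_int i)\<bar> \<le> C"
    by (rule FK_system_exists[OF a \<alpha>(1), of L]) iprover
  define V where "V i \<tau> = \<alpha> * (X i \<tau> - U i \<tau>)" for i \<tau>
  define A where "A i \<tau> = 2 * \<alpha> * (FK_force L U i \<tau> - V i \<tau>)" for i \<tau>
  have Vd: "(V i has_real_derivative A i \<tau>) (at \<tau>)" if "0 < \<tau>" for i \<tau>
    unfolding V_def A_def
    using FK_systemD(3,4)[OF sys that] by (auto intro!: derivative_eq_intros simp: algebra_simps)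
  have Vc: "continuous_on {0..} (V i)" for i
    unfolding V_def by (intro continuous_intros FK_systemD(1,2)[OF sys])
  have eqn: "m * A i \<tau> + V i \<tau> = FK_force L U i \<tau>" for i \<tau>
  proof -
    have "m * A i \<tau> = (2 * \<alpha> * m) * (FK_force L U i \<tau> - V i \<tau>)" by (simp add: A_def)
    then show ?thesis using \<alpha>(2) by simp
  qed
  have "FK_solution m L (\<lambda>i. a (of_int i)) U"
    unfolding FK_solution_def
  proof (rule conjI, rule exI[of _ V], rule exI[of _ A], rule allI, intro conjI allI impI)
    show "\<forall>T>0. \<exists>C. \<forall>i. \<forall>\<tau>\<in>{0..T}. \<bar>U i \<tau> - U i 0\<bar> \<le> C" using bd by (simp add: U0)
    show "(U i has_real_derivative V i \<tau>) (at \<tau> within {0..})" if "0 \<le> \<tau>" for i \<tau>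
      using Ud[OF that] by (simp add: V_def)
    show "m * A i \<tau> + V i \<tau> = U (i + 1) \<tau> - 2 * U i \<tau> + U (i - 1) \<tau> + sin (2 * pi * U i \<tau>) + L" for i \<tau>
      using eqn by (simp add: FK_force_def)
  qed (use Vd Vc U0 X0 in \<open>auto simp: V_def\<close>)
  then show ?thesis by blast
qed

text \<open>Bounded distance from the data bounds the force on bounded time intervals, and damping
  at rate \<open>1 / m\<close> turns this into a velocity bound. Hence \<open>X\<close> grows at
  most linearly in the index.\<close>

lemma FK_system_of_solution:
  assumes m: "0 < m" and sol: "FK_solution m L a U" and a: "\<And>i. \<bar>a (i + 1) - a i\<bar> \<le> K"
  obtains X where "FK_system (1 / (2 * m)) L U X" "\<And>i. U i 0 = a i" "\<And>i. X i 0 = a i"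
proof -
  obtain V A where Ud: "\<And>i \<tau>. 0 \<le> \<tau> \<Longrightarrow> (U i has_real_derivative V i \<tau>) (at \<tau> within {0..})"
    and Vc: "\<And>i. continuous_on {0..} (V i)"
    and Vd: "\<And>i \<tau>. 0 < \<tau> \<Longrightarrow> (V i has_real_derivative A i \<tau>) (at \<tau>)"
    and eqn: "\<And>i \<tau>. 0 < \<tau> \<Longrightarrow> m * A i \<tau> + V i \<tau> = FK_force L U i \<tau>"
    and U0: "\<And>i. U i 0 = a i" and V0: "\<And>i. V i 0 = 0"
    and bd: "\<And>T. 0 < T \<Longrightarrow> \<exists>C. \<forall>i. \<forall>\<tau>\<in>{0..T}. \<bar>U i \<tau> - U i 0\<bar> \<le> C"
    using sol unfolding FK_solution_def FK_force_def by blast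
  have Uc: "continuous_on {0..} (U i)" for i using Ud by (auto intro!: DERIV_continuous_on)
  have Ud': "(U i has_real_derivative V i \<tau>) (at \<tau>)" if "0 < \<tau>" for i \<tau>
    using Ud[of \<tau> i] that at_within_interior[of \<tau> "{0..}"] by simp
  define X where "X i \<tau> = U i \<tau> + 2 * m * V i \<tau>" for i \<tau>
  have K: "0 \<le> K" using a[of 0] by linarith
  have aj: "\<bar>a i\<bar> \<le> \<bar>a 0\<bar> + K * \<bar>of_int i\<bar>" for i
  proof (induction i rule: int_induct[of _ 0])
    case (step1 i)
    then show ?case using a[of i] by (simp add: algebra_simps)
  next
    case (step2 i)
    then show ?case using a[of "i - 1"] by (simp add: algebra_simps)
  qed auto
  have growth: "\<exists>C. \<forall>i. \<forall>\<tau>\<in>{0..T}. \<bar>U i \<tau>\<bar> \<le> C * (1 + \<bar>of_int i\<bar>) \<and> \<bar>X i \<tau>\<bar> \<le> C * (1 + \<bar>of_int i\<bar>)" for T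
  proof -
    \<comment> \<open>The distance bound of the solution class is available for positive horizons
      only.\<close>
    define T' where "T' = max T 1"
    have "0 < T'" by (simp add: T'_def)
    then obtain C where "\<forall>i. \<forall>\<tau>\<in>{0..T'}. \<bar>U i \<tau> - U i 0\<bar> \<le> C" using bd by blast
    then have C: "\<bar>U i \<tau> - a i\<bar> \<le> C" if "0 \<le> \<tau>" "\<tau> \<le> T'" for i \<tau> using that by (simp add: U0)
    have C0: "0 \<le> C" using C[of 0 0] by (simp add: T'_def U0)
    define M where "M = 2 * K + 4 * C + 1 + \<bar>L\<bar>"
    have M: "0 \<le> M" using K C0 by (simp add: M_def)
    have V: "\<bar>V i \<tau>\<bar> \<le> M" if "0 \<le> \<tau>" "\<tau> \<le> T'" for i \<tau>
    proof (rule damped_abs_le[of T' "V i" "1 / m" M "FK_force L U i"])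
      show "continuous_on {0..T'} (V i)" using Vc by (rule continuous_on_subset) auto
      fix s assume s: "0 < s" "s \<le> T'"
      have "A i s = 1 / m * (FK_force L U i s - V i s)" using eqn[OF s(1), of i] m by (simp add: field_simps)
      then show "(V i has_real_derivative 1 / m * (FK_force L U i s - V i s)) (at s)" using Vd[OF s(1), of i] by simp
      have "\<bar>a (i + 1) - a i\<bar> \<le> K" "\<bar>a i - a (i - 1)\<bar> \<le> K" using a[of i] a[of "i - 1"] by simp_all
      moreover have "\<bar>U (i + 1) s - a (i + 1)\<bar> \<le> C" "\<bar>U i s - a i\<bar> \<le> C" "\<bar>U (i - 1) s - a (i - 1)\<bar> \<le> C"
        using C s by auto
      ultimately show "\<bar>FK_force L U i s\<bar> \<le> M"
        using sin_le_one[of "2 * pi * U i s"] sin_ge_minus_one[of "2 * pi * U i s"]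
          abs_ge_self[of L] abs_ge_minus_self[of L]
        unfolding FK_force_def M_def abs_le_iff by (intro conjI; argo)
    qed (use V0 m M that in auto)
    show ?thesis
    proof (intro exI[of _ "\<bar>a 0\<bar> + C + 2 * m * M + K"] allI ballI)
      fix i \<tau> assume \<tau>: "\<tau> \<in> {0..T}"
      then have \<tau>': "0 \<le> \<tau>" "\<tau> \<le> T'" by (auto simp: T'_def)
      have "\<bar>2 * m * V i \<tau>\<bar> \<le> 2 * m * M" using V[OF \<tau>'] m by (simp add: abs_mult)
      moreover have "\<bar>a 0\<bar> + K * \<bar>of_int i\<bar> + C + 2 * m * M \<le> (\<bar>a 0\<bar> + C + 2 * m * M + K) * (1 + \<bar>of_int i\<bar>)"
      proof -
        have "0 \<le> (\<bar>a 0\<bar> + C + 2 * m * M) * \<bar>of_int i\<bar>" using C0 m M by simp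
        then show ?thesis using K by (simp add: algebra_simps)
      qed
      moreover have "0 \<le> 2 * m * M" using m M by simp
      ultimately show "\<bar>U i \<tau>\<bar> \<le> (\<bar>a 0\<bar> + C + 2 * m * M + K) * (1 + \<bar>of_int i\<bar>) \<and>
          \<bar>X i \<tau>\<bar> \<le> (\<bar>a 0\<bar> + C + 2 * m * M + K) * (1 + \<bar>of_int i\<bar>)"
        using C[OF \<tau>', of i] aj[of i] unfolding X_def by linarith
    qed
  qed
  show thesis
  proof (rule that[of X])
    show "FK_system (1 / (2 * m)) L U X"
      unfolding FK_system_def
    proof (intro conjI allI impI growth)
      show "continuous_on {0..} (X i)" for i unfolding X_def by (intro continuous_intros Uc Vc)
      fix i and \<tau> :: real assume \<tau>: "0 < \<tau>"
      have "1 / (2 * m) * (X i \<tau> - U i \<tau>) = V i \<tau>" using m by (simp add: X_def)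
      then show "(U i has_real_derivative 1 / (2 * m) * (X i \<tau> - U i \<tau>)) (at \<tau>)" using Ud'[OF \<tau>] by simp
      have "(X i has_real_derivative V i \<tau> + 2 * m * A i \<tau>) (at \<tau>)"
        unfolding X_def using Ud'[OF \<tau>] Vd[OF \<tau>] by (auto intro!: derivative_eq_intros)
      moreover have "V i \<tau> + 2 * m * A i \<tau> = 2 * FK_force L U i \<tau> + 1 / (2 * m) * (U i \<tau> - X i \<tau>)"
      proof -
        have "1 / (2 * m) * (U i \<tau> - X i \<tau>) = - V i \<tau>" using m by (simp add: X_def)
        then show ?thesis using eqn[OF \<tau>, of i] by simp
      qed
      ultimately show "(X i has_real_derivative 2 * FK_force L U i \<tau> + 1 / (2 * m) * (U i \<tau> - X i \<tau>)) (at \<tau>)" by simp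
    qed (rule Uc)
  qed (auto simp: U0 V0 X_def)
qed

lemma FK_solution_unique:
  assumes m: "0 < m" "m \<le> 1 / 40" and U: "FK_solution m L a U" and W: "FK_solution m L a W"
    and a: "\<And>i. \<bar>a (i + 1) - a i\<bar> \<le> K" and \<tau>: "0 \<le> \<tau>"
  shows "W i \<tau> = U i \<tau>"
proof -
  have \<alpha>: "20 \<le> 1 / (2 * m)" using m by (simp add: field_simps)
  obtain X where X: "FK_system (1 / (2 * m)) L U X" "\<And>i. U i 0 = a i" "\<And>i. X i 0 = a i"
    by (rule FK_system_of_solution[OF m(1) U a]) iprover
  obtain Y where Y: "FK_system (1 / (2 * m)) L W Y" "\<And>i. W i 0 = a i" "\<And>i. Y i 0 = a i"
    by (rule FK_system_of_solution[OF m(1) W a]) iprover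
  show ?thesis by (rule FK_unique[OF \<alpha> Y(1) X(1) _ _ \<tau>]) (simp_all add: X Y)
qed

lemma FK_homogenization_of_solutions:
  assumes m: "0 < m" "m \<le> 1 / 40" and F: "planar_mean_velocity (1 / (2 * m)) L C F"
    and u0: "K-lipschitz_on UNIV u0"
  shows "(\<forall>\<epsilon>>0. \<exists>U. FK_solution m L (\<lambda>i. u0 (of_int i * \<epsilon>) / \<epsilon>) U \<and>
           (\<forall>W. FK_solution m L (\<lambda>i. u0 (of_int i * \<epsilon>) / \<epsilon>) W \<longrightarrow> (\<forall>i. \<forall>\<tau>\<ge>0. W i \<tau> = U i \<tau>))) \<and>
        (\<exists>u. visc_solution F u0 u \<and>
           (\<forall>v. visc_solution F u0 v \<longrightarrow> (\<forall>t\<ge>0. \<forall>x. v (t, x) = u (t, x))) \<and>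
           (\<forall>U. (\<forall>\<epsilon>>0. FK_solution m L (\<lambda>i. u0 (of_int i * \<epsilon>) / \<epsilon>) (U \<epsilon>)) \<longrightarrow>
              (\<forall>S. compact S \<and> S \<subseteq> {0<..} \<times> UNIV \<longrightarrow>
                 uniform_limit S (\<lambda>\<epsilon>. rescaled \<epsilon> (U \<epsilon>)) u (at_right 0))))"
proof -
  have \<alpha>: "20 \<le> 1 / (2 * m)" using m by (simp add: field_simps)
  define a where "a \<epsilon> i = u0 (of_int i * \<epsilon>) / \<epsilon>" for \<epsilon> and i :: int
  have a: "\<bar>a \<epsilon> (i + 1) - a \<epsilon> i\<bar> \<le> K" if "0 < \<epsilon>" for \<epsilon> i
    using sampled_lipschitz[OF u0 that, of "of_int (i + 1)" "of_int i"] by (simp add: a_def)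
  have ex: "\<exists>U. FK_solution m L (a \<epsilon>) U" if \<epsilon>: "0 < \<epsilon>" for \<epsilon>
    unfolding a_def
  proof (rule FK_solution_exists[OF m(1), of "\<lambda>x. u0 (x * \<epsilon>) / \<epsilon>"])
    show "continuous_on UNIV (\<lambda>x. u0 (x * \<epsilon>) / \<epsilon>)"
      using \<epsilon> by (intro continuous_intros continuous_on_compose2[OF lipschitz_on_continuous_on[OF u0]]) auto
    show "\<bar>u0 ((x + 1) * \<epsilon>) / \<epsilon> - u0 (x * \<epsilon>) / \<epsilon>\<bar> \<le> K" for x
      using sampled_lipschitz[OF u0 \<epsilon>, of "x + 1" x] by simp
  qed
  have uniq: "W i \<tau> = U i \<tau>" if "0 < \<epsilon>" "FK_solution m L (a \<epsilon>) U" "FK_solution m L (a \<epsilon>) W" "0 \<le> \<tau>" for \<epsilon> U W i \<tau>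
    by (rule FK_solution_unique[OF m that(2,3) a[OF that(1)] that(4)])
  obtain U where U: "\<And>\<epsilon>. 0 < \<epsilon> \<Longrightarrow> FK_solution m L (a \<epsilon>) (U \<epsilon>)" using ex by metis
  have "\<exists>X. FK_system (1 / (2 * m)) L (U \<epsilon>) X \<and> (\<forall>i. U \<epsilon> i 0 = a \<epsilon> i \<and> X i 0 = a \<epsilon> i)" if "0 < \<epsilon>" for \<epsilon>
    by (rule FK_system_of_solution[OF m(1) U[OF that] a[OF that]]) blast
  then obtain X where "\<And>\<epsilon>. 0 < \<epsilon> \<Longrightarrow> FK_system (1 / (2 * m)) L (U \<epsilon>) (X \<epsilon>) \<and> (\<forall>i. U \<epsilon> i 0 = a \<epsilon> i \<and> X \<epsilon> i 0 = a \<epsilon> i)"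
    by metis
  then have fam: "FK_family (1 / (2 * m)) L u0 U X" by (simp add: FK_family_def a_def)
  obtain u K' where u: "visc_solution F u0 u" "K'-lipschitz_on ({0..} \<times> UNIV) u"
    and lim: "\<And>S. compact S \<Longrightarrow> S \<subseteq> {0..} \<times> UNIV \<Longrightarrow> uniform_limit S (\<lambda>\<epsilon>. rescaled \<epsilon> (U \<epsilon>)) u (at_right 0)"
    by (rule FK_homogenization[OF \<alpha> F u0 fam]) iprover
  \<comment> \<open>By uniqueness an arbitrary family of solutions agrees at nonnegative times with
    the chosen one, for which convergence is known.\<close>
  have "uniform_limit S (\<lambda>\<epsilon>. rescaled \<epsilon> (W \<epsilon>)) u (at_right 0)"
    if W: "\<And>\<epsilon>. 0 < \<epsilon> \<Longrightarrow> FK_solution m L (a \<epsilon>) (W \<epsilon>)" and S: "compact S" "S \<subseteq> {0<..} \<times> UNIV" for W S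
  proof -
    have S': "S \<subseteq> {0..} \<times> UNIV" using S(2) by auto
    have "rescaled \<epsilon> (W \<epsilon>) z = rescaled \<epsilon> (U \<epsilon>) z" if "0 < \<epsilon>" "z \<in> S" for \<epsilon> z
    proof -
      obtain t x where z: "z = (t, x)" "0 \<le> t" using \<open>z \<in> S\<close> S' by auto
      then show ?thesis using uniq[OF that(1) U W] that(1) by (simp add: rescaled_def)
    qed
    then have "\<forall>\<^sub>F \<epsilon> in at_right 0. \<forall>z\<in>S. rescaled \<epsilon> (W \<epsilon>) z = rescaled \<epsilon> (U \<epsilon>) z"
      using eventually_at_right_0_less[of 1] by (auto elim: eventually_mono)
    then show ?thesis using lim[OF S(1) S'] by (subst uniform_limit_cong) auto
  qed
  moreover have "v (t, x) = u (t, x)" if "visc_solution F u0 v" "0 \<le> t" for v t x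
    by (rule visc_solution_unique[OF planar_mean_velocity_continuous[OF \<alpha> F]
          planar_mean_velocity_bounded[OF \<alpha> F] u that])
  moreover have "\<exists>V. FK_solution m L (a \<epsilon>) V \<and> (\<forall>W. FK_solution m L (a \<epsilon>) W \<longrightarrow> (\<forall>i. \<forall>\<tau>\<ge>0. W i \<tau> = V i \<tau>))"
    if "0 < \<epsilon>" for \<epsilon>
    using U[OF that] uniq[OF that U[OF that]] by blast
  ultimately show ?thesis using u(1) unfolding a_def by blast
qed

theorem theorem1p1:
  "\<exists>mc>0. \<forall>m\<^sub>0\<in>{0<..mc}. \<forall>L::real. \<exists>F :: real \<Rightarrow> real. continuous_on UNIV F \<and>
     (\<forall>(u\<^sub>0 :: real \<Rightarrow> real) K\<^sub>0.
        (\<exists>C. C-lipschitz_on UNIV u\<^sub>0) \<and> K\<^sub>0 > 0 \<and>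
        (AE x in lebesgue. u\<^sub>0 differentiable (at x) \<and> 1 / K\<^sub>0 \<le> deriv u\<^sub>0 x \<and> deriv u\<^sub>0 x \<le> K\<^sub>0)
        \<longrightarrow>
        (\<forall>\<epsilon>>0. \<exists>U. FK_solution m\<^sub>0 L (\<lambda>i. u\<^sub>0 (of_int i * \<epsilon>) / \<epsilon>) U \<and>
           (\<forall>W. FK_solution m\<^sub>0 L (\<lambda>i. u\<^sub>0 (of_int i * \<epsilon>) / \<epsilon>) W \<longrightarrow>
              (\<forall>i. \<forall>\<tau>\<ge>0. W i \<tau> = U i \<tau>))) \<and>
        (\<exists>u. visc_solution F u\<^sub>0 u \<and>
           (\<forall>v. visc_solution F u\<^sub>0 v \<longrightarrow> (\<forall>t\<ge>0. \<forall>x. v (t, x) = u (t, x))) \<and>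
           (\<forall>U. (\<forall>\<epsilon>>0. FK_solution m\<^sub>0 L (\<lambda>i. u\<^sub>0 (of_int i * \<epsilon>) / \<epsilon>) (U \<epsilon>)) \<longrightarrow>
              (\<forall>K. compact K \<and> K \<subseteq> {0<..} \<times> UNIV \<longrightarrow>
                 uniform_limit K (\<lambda>\<epsilon>. rescaled \<epsilon> (U \<epsilon>)) u (at_right 0)))))"
proof (intro exI[of _ "1 / 40 :: real"] conjI ballI allI)
  fix m L :: real assume "m \<in> {0<..1 / 40}"
  then have m: "0 < m" "m \<le> 1 / 40" by auto
  then have \<alpha>: "20 \<le> 1 / (2 * m)" by (simp add: field_simps)
  \<comment> \<open>\<open>F\<close> is fixed by \<open>m\<close> and \<open>L\<close> before any
    initial datum enters.\<close>
  obtain F where F: "planar_mean_velocity (1 / (2 * m)) L (5 + \<bar>L\<bar>) F"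
    by (rule planar_mean_velocity_exists[OF \<alpha>])
  show "\<exists>F :: real \<Rightarrow> real. continuous_on UNIV F \<and>
     (\<forall>(u\<^sub>0 :: real \<Rightarrow> real) K\<^sub>0.
        (\<exists>C. C-lipschitz_on UNIV u\<^sub>0) \<and> K\<^sub>0 > 0 \<and>
        (AE x in lebesgue. u\<^sub>0 differentiable (at x) \<and> 1 / K\<^sub>0 \<le> deriv u\<^sub>0 x \<and> deriv u\<^sub>0 x \<le> K\<^sub>0)
        \<longrightarrow>
        (\<forall>\<epsilon>>0. \<exists>U. FK_solution m L (\<lambda>i. u\<^sub>0 (of_int i * \<epsilon>) / \<epsilon>) U \<and>
           (\<forall>W. FK_solution m L (\<lambda>i. u\<^sub>0 (of_int i * \<epsilon>) / \<epsilon>) W \<longrightarrow>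
              (\<forall>i. \<forall>\<tau>\<ge>0. W i \<tau> = U i \<tau>))) \<and>
        (\<exists>u. visc_solution F u\<^sub>0 u \<and>
           (\<forall>v. visc_solution F u\<^sub>0 v \<longrightarrow> (\<forall>t\<ge>0. \<forall>x. v (t, x) = u (t, x))) \<and>
           (\<forall>U. (\<forall>\<epsilon>>0. FK_solution m L (\<lambda>i. u\<^sub>0 (of_int i * \<epsilon>) / \<epsilon>) (U \<epsilon>)) \<longrightarrow>
              (\<forall>K. compact K \<and> K \<subseteq> {0<..} \<times> UNIV \<longrightarrow>
                 uniform_limit K (\<lambda>\<epsilon>. rescaled \<epsilon> (U \<epsilon>)) u (at_right 0)))))"
    by (intro exI[of _ F] conjI[OF planar_mean_velocity_continuous[OF \<alpha> F]] allI impI, elim conjE exE)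
      (rule FK_homogenization_of_solutions[OF m F])
qed simp

end
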